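(* Let $n=3$, let $\Omega\subset\mathbb{R}^3$ be a connected bounded open set with Lipschitz boundary, $a,\tilde a\in L^\infty(\Omega)$ with $0<m\le a,\tilde a\le M$, $H,\tilde H\in L^\infty(\Omega)$, and $F=\nabla f$, $\tilde F=\nabla\tilde f$ with $f,\tilde f\in C^1(\Omega)\cap C(\overline\Omega)$ and $\|F\|_{L^1(\Omega)}\le k_1$. Let $u,u_1,u_2,\tilde u$ be admissible for the data $(a,F,H)$, $(a,F,\tilde H)$, $(\tilde a,F,\tilde H)$, $(\tilde a,\tilde F,\tilde H)$ respectively (with constants $\sigma_0,\sigma_1,m,M$), all vanishing on $\partial\Omega$. Suppose that for each $v\in\{u+f,\ u_1+f,\ u_2+f\}$ the level sets of $v$ can be foliated to one-dimensional curves, with constants $c_g,C_g,K$. Then $$\|u-\tilde u\|_{L^1(\Omega)}\le C\left(\|H-\tilde H\|_{L^\infty(\Omega)}^{1/2}+\|a-\tilde a\|_{L^\infty(\Omega)}^{1/2}+\max\left(\|f-\tilde f\|_{W^{1,1}(\Omega)}^{1/2},\ \|f-\tilde f\|_{W^{1,1}(\Omega)}\right)\right)$$ for some constant $C$ (depending only on $\Omega,m,M,k_1,K,\sigma_0,\sigma_1,c_g,C_g$) independent of $\tilde u$ and of its coefficient $\tilde\sigma$.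
   Context: Admissibility: fix $\sigma_0,\sigma_1>0$. For data $(a,F,H)$, $u\in C^1(\overline\Omega)$ is admissible if $u$ minimizes $\int_\Omega(a|Dw+F|+Hw)\,dx$ over $w\in H_0^1(\Omega)$ and there is $\sigma\in C(\Omega)$ with $0<\sigma_0\le\sigma\le\sigma_1$ such that $J=\sigma(\nabla u+F)$ and $m\le|J|\le M$. Here $J$ is the flux field of the problem (a solution of the dual problem of maximizing $\int_\Omega F\cdot b\,dx$ over $b\in L^2(\Omega;\mathbb{R}^n)$ with $|b|\le a$ a.e. and $\int_\Omega(\nabla w\cdot b+Hw)\,dx=0$ for all $w\in H^1_0(\Omega)$); thus $\nabla\cdot J=H$ weakly, $|J|=a$ and $\sigma=a/|\nabla u+F|$. Foliation ($n=3$): the level sets of $v$ can be foliated to one-dimensional curves if for almost every $t$ in the range of $v$ there is a $C^1$ function $g_t$ on the surface $\{v=t\}\cap\Omega$ with $0<c_g\le|\nabla g_t|\le C_g$ (surface gradient; constants independent of $t$), such that for almost every $r\in\mathbb{R}$ every connected component of $\{v=t\}\cap\{g_t=r\}\cap\Omega$ is a $C^1$ curve reaching $\partial\Omega$, and $\sup_{t,r}\int_{\{v=t\}\cap\{g_t=r\}\cap\Omega}dl\le K<\infty$. *)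

theory Defs
  imports "HOL-Analysis.Analysis" "HOL-Probability.Essential_Supremum"
begin

section \<open>Domains and classical differentiability\<close>

text \<open>Near each boundary point, in suitable Cartesian coordinates, \<open>\<Omega>\<close> is the strict epigraph of a
  Lipschitz function \<open>h\<close> defined on the hyperplane orthogonal to the unit vector \<open>e\<close>.\<close>

definition lipschitz_boundary :: "'a::euclidean_space set \<Rightarrow> bool" where
  "lipschitz_boundary \<Omega> \<longleftrightarrow>
     (\<forall>p\<in>frontier \<Omega>. \<exists>e (h :: 'a \<Rightarrow> real) L \<epsilon>. norm e = 1 \<and> \<epsilon> > 0 \<and>
        L-lipschitz_on {y. y \<bullet> e = 0} h \<and>
        (\<forall>x\<in>ball p \<epsilon>. x \<in> \<Omega> \<longleftrightarrow> h (x - (x \<bullet> e) *\<^sub>R e) < x \<bullet> e))"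

definition grad :: "('a::euclidean_space \<Rightarrow> real) \<Rightarrow> 'a \<Rightarrow> 'a" where
  "grad f x = (THE D. GDERIV f x :> D)"

definition C1_on :: "'a::euclidean_space set \<Rightarrow> ('a \<Rightarrow> real) \<Rightarrow> bool" where
  "C1_on \<Omega> f \<longleftrightarrow> (\<forall>x\<in>\<Omega>. f differentiable (at x)) \<and> continuous_on \<Omega> (grad f)"

text \<open>The space \<open>C\<^sup>1\<close> of the closure: \<open>f\<close> and its gradient extend continuously to the closure.
  On the boundary the values of \<open>f\<close> are those of the extension, so that traces are pointwise.\<close>

definition C1_closure :: "'a::euclidean_space set \<Rightarrow> ('a \<Rightarrow> real) \<Rightarrow> bool" where
  "C1_closure \<Omega> f \<longleftrightarrow> C1_on \<Omega> f \<and> continuous_on (closure \<Omega>) f \<and>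
     (\<exists>G. continuous_on (closure \<Omega>) G \<and> (\<forall>x\<in>\<Omega>. G x = grad f x))"

primrec Ck_on :: "nat \<Rightarrow> 'a::euclidean_space set \<Rightarrow> ('a \<Rightarrow> real) \<Rightarrow> bool" where
  "Ck_on 0 S f \<longleftrightarrow> continuous_on S f"
| "Ck_on (Suc k) S f \<longleftrightarrow>
     (\<forall>x\<in>S. f differentiable (at x)) \<and> (\<forall>e. Ck_on k S (\<lambda>x. grad f x \<bullet> e))"

definition test_function :: "'a::euclidean_space set \<Rightarrow> ('a \<Rightarrow> real) \<Rightarrow> bool" where
  "test_function \<Omega> \<phi> \<longleftrightarrow> (\<forall>k. Ck_on k UNIV \<phi>) \<and>
     compact (closure {x. \<phi> x \<noteq> 0}) \<and> closure {x. \<phi> x \<noteq> 0} \<subseteq> \<Omega>"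

section \<open>Lebesgue and Sobolev spaces\<close>

definition Linf_on :: "'a::euclidean_space set \<Rightarrow> ('a \<Rightarrow> real) \<Rightarrow> bool" where
  "Linf_on \<Omega> f \<longleftrightarrow> f \<in> borel_measurable (lebesgue_on \<Omega>) \<and>
     esssup (lebesgue_on \<Omega>) (\<lambda>x. ennreal \<bar>f x\<bar>) < \<infinity>"

definition Linf_norm :: "'a::euclidean_space set \<Rightarrow> ('a \<Rightarrow> real) \<Rightarrow> real" where
  "Linf_norm \<Omega> f = enn2real (esssup (lebesgue_on \<Omega>) (\<lambda>x. ennreal \<bar>f x\<bar>))"

definition L1_on :: "'a::euclidean_space set \<Rightarrow> ('a \<Rightarrow> 'b::euclidean_space) \<Rightarrow> bool" where
  "L1_on \<Omega> f \<longleftrightarrow> integrable (lebesgue_on \<Omega>) f"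

text \<open>Meaningful only for \<open>L1_on \<Omega> f\<close>, as a Bochner integral of a non-integrable function is 0.\<close>

definition L1_norm :: "'a::euclidean_space set \<Rightarrow> ('a \<Rightarrow> 'b::euclidean_space) \<Rightarrow> real" where
  "L1_norm \<Omega> f = (\<integral>x. norm (f x) \<partial>lebesgue_on \<Omega>)"

text \<open>Only used for \<open>h\<close> of class \<open>C\<^sup>1\<close>, for which the classical gradient is the weak one.\<close>

definition W11_norm :: "'a::euclidean_space set \<Rightarrow> ('a \<Rightarrow> real) \<Rightarrow> real" where
  "W11_norm \<Omega> h = L1_norm \<Omega> h + L1_norm \<Omega> (grad h)"

definition L2_on :: "'a::euclidean_space set \<Rightarrow> ('a \<Rightarrow> 'b::euclidean_space) \<Rightarrow> bool" where
  "L2_on \<Omega> f \<longleftrightarrow> f \<in> borel_measurable (lebesgue_on \<Omega>) \<and>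
     integrable (lebesgue_on \<Omega>) (\<lambda>x. (norm (f x))\<^sup>2)"

text \<open>\<open>in_H1 \<Omega> w G\<close>: \<open>w\<close> is in \<open>H\<^sup>1\<close> and \<open>G\<close> is a representative of its weak gradient.\<close>

definition in_H1 :: "'a::euclidean_space set \<Rightarrow> ('a \<Rightarrow> real) \<Rightarrow> ('a \<Rightarrow> 'a) \<Rightarrow> bool" where
  "in_H1 \<Omega> w G \<longleftrightarrow> L2_on \<Omega> w \<and> L2_on \<Omega> G \<and>
     (\<forall>\<phi>. test_function \<Omega> \<phi> \<longrightarrow>
        (\<integral>x. w x *\<^sub>R grad \<phi> x \<partial>lebesgue_on \<Omega>) = - (\<integral>x. \<phi> x *\<^sub>R G x \<partial>lebesgue_on \<Omega>))"

text \<open>The closure of the test functions in the \<open>H\<^sup>1\<close> norm; again \<open>G\<close> represents the weak gradient.\<close>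

definition in_H10 :: "'a::euclidean_space set \<Rightarrow> ('a \<Rightarrow> real) \<Rightarrow> ('a \<Rightarrow> 'a) \<Rightarrow> bool" where
  "in_H10 \<Omega> w G \<longleftrightarrow> in_H1 \<Omega> w G \<and>
     (\<exists>\<phi> :: nat \<Rightarrow> 'a \<Rightarrow> real. (\<forall>k. test_function \<Omega> (\<phi> k)) \<and>
        (\<lambda>k. \<integral>x. (w x - \<phi> k x)\<^sup>2 + (norm (G x - grad (\<phi> k) x))\<^sup>2 \<partial>lebesgue_on \<Omega>)
          \<longlonglongrightarrow> 0)"

section \<open>The variational problem, its dual, and admissibility\<close>

text \<open>\<open>Dw\<close> stands for the (weak) gradient of \<open>w\<close>.\<close>

definition energy :: "'a::euclidean_space set \<Rightarrow> ('a \<Rightarrow> real) \<Rightarrow> ('a \<Rightarrow> 'a) \<Rightarrow> ('a \<Rightarrow> real) \<Rightarrow>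
    ('a \<Rightarrow> real) \<Rightarrow> ('a \<Rightarrow> 'a) \<Rightarrow> real" where
  "energy \<Omega> a F H w Dw = (\<integral>x. a x * norm (Dw x + F x) + H x * w x \<partial>lebesgue_on \<Omega>)"

text \<open>For \<open>u\<close> of class \<open>C\<^sup>1\<close>, the only case used, the weak gradient is the classical one.\<close>

definition minimizes_energy :: "'a::euclidean_space set \<Rightarrow> ('a \<Rightarrow> real) \<Rightarrow> ('a \<Rightarrow> 'a) \<Rightarrow>
    ('a \<Rightarrow> real) \<Rightarrow> ('a \<Rightarrow> real) \<Rightarrow> bool" where
  "minimizes_energy \<Omega> a F H u \<longleftrightarrow> in_H10 \<Omega> u (grad u) \<and>
     (\<forall>w Dw. in_H10 \<Omega> w Dw \<longrightarrow> energy \<Omega> a F H u (grad u) \<le> energy \<Omega> a F H w Dw)"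

definition dual_feasible :: "'a::euclidean_space set \<Rightarrow> ('a \<Rightarrow> real) \<Rightarrow> ('a \<Rightarrow> real) \<Rightarrow>
    ('a \<Rightarrow> 'a) \<Rightarrow> bool" where
  "dual_feasible \<Omega> a H b \<longleftrightarrow> L2_on \<Omega> b \<and> (AE x in lebesgue_on \<Omega>. norm (b x) \<le> a x) \<and>
     (\<forall>w Dw. in_H10 \<Omega> w Dw \<longrightarrow> (\<integral>x. Dw x \<bullet> b x + H x * w x \<partial>lebesgue_on \<Omega>) = 0)"

definition dual_solution :: "'a::euclidean_space set \<Rightarrow> ('a \<Rightarrow> real) \<Rightarrow> ('a \<Rightarrow> 'a) \<Rightarrow>
    ('a \<Rightarrow> real) \<Rightarrow> ('a \<Rightarrow> 'a) \<Rightarrow> bool" where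
  "dual_solution \<Omega> a F H J \<longleftrightarrow> dual_feasible \<Omega> a H J \<and>
     (\<forall>b. dual_feasible \<Omega> a H b \<longrightarrow>
        (\<integral>x. F x \<bullet> b x \<partial>lebesgue_on \<Omega>) \<le> (\<integral>x. F x \<bullet> J x \<partial>lebesgue_on \<Omega>))"

text \<open>The bounds on \<open>\<sigma>\<close> and on the flux force \<open>F\<close> to be bounded on \<open>\<Omega>\<close>, so for bounded \<open>\<Omega>\<close>,
  continuous \<open>F\<close> and essentially bounded \<open>a\<close>, \<open>H\<close> all the integrals involved converge. The relations
  \<open>|J| = a\<close> and \<open>\<sigma> = a / |\<nabla>u + F|\<close> are consequences and not part of the definition.\<close>

definition admissible :: "'a::euclidean_space set \<Rightarrow> real \<Rightarrow> real \<Rightarrow> real \<Rightarrow> real \<Rightarrow>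
    ('a \<Rightarrow> real) \<Rightarrow> ('a \<Rightarrow> 'a) \<Rightarrow> ('a \<Rightarrow> real) \<Rightarrow> ('a \<Rightarrow> real) \<Rightarrow> bool" where
  "admissible \<Omega> \<sigma>0 \<sigma>1 m M a F H u \<longleftrightarrow> C1_closure \<Omega> u \<and> minimizes_energy \<Omega> a F H u \<and>
     (\<exists>\<sigma> J. continuous_on \<Omega> \<sigma> \<and> (\<forall>x\<in>\<Omega>. \<sigma>0 \<le> \<sigma> x \<and> \<sigma> x \<le> \<sigma>1) \<and>
        (\<forall>x\<in>\<Omega>. J x = \<sigma> x *\<^sub>R (grad u x + F x)) \<and>
        (\<forall>x\<in>\<Omega>. m \<le> norm (J x) \<and> norm (J x) \<le> M) \<and>
        dual_solution \<Omega> a F H J)"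

section \<open>Foliation of level sets by curves\<close>

text \<open>One-dimensional Hausdorff measure, which is arc length \<open>dl\<close> on \<open>C\<^sup>1\<close> curves. The explicit
  boundedness is needed since the value of \<open>diameter\<close> on unbounded sets is unspecified.\<close>

definition hausdorff1 :: "'a::euclidean_space set \<Rightarrow> ennreal" where
  "hausdorff1 A =
     (SUP \<delta>\<in>{0<..}. INF U\<in>{U :: nat \<Rightarrow> 'a set. A \<subseteq> (\<Union>i. U i) \<and>
          (\<forall>i. bounded (U i) \<and> diameter (U i) \<le> \<delta>)}. \<Sum>i. ennreal (diameter (U i)))"

text \<open>\<open>g\<close> is \<open>C\<^sup>1\<close> on the level surface \<open>S\<close> of \<open>v\<close>, with surface gradient \<open>\<xi>\<close>: the tangential field
  representing the derivative of \<open>g\<close> along \<open>S\<close>. It is unique as \<open>S\<close> is a \<open>C\<^sup>1\<close> surface with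
  normal \<open>grad v\<close>, provided the latter does not vanish.\<close>

definition C1_surface_function :: "(real^3 \<Rightarrow> real) \<Rightarrow> (real^3) set \<Rightarrow> (real^3 \<Rightarrow> real) \<Rightarrow>
    (real^3 \<Rightarrow> real^3) \<Rightarrow> bool" where
  "C1_surface_function v S g \<xi> \<longleftrightarrow> continuous_on S \<xi> \<and>
     (\<forall>x\<in>S. \<xi> x \<bullet> grad v x = 0 \<and> (g has_derivative (\<lambda>h. \<xi> x \<bullet> h)) (at x within S))"

text \<open>A \<open>C\<^sup>1\<close> curve in \<open>\<Omega>\<close> reaching the boundary is not closed, hence the open parameter interval.\<close>

definition C1_curve :: "'a::euclidean_space set \<Rightarrow> bool" where
  "C1_curve \<Gamma> \<longleftrightarrow> (\<exists>\<gamma> \<gamma>' :: real \<Rightarrow> 'a. continuous_on {0<..<1} \<gamma>' \<and>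
     (\<forall>s\<in>{0<..<1}. (\<gamma> has_vector_derivative \<gamma>' s) (at s) \<and> \<gamma>' s \<noteq> 0) \<and>
     inj_on \<gamma> {0<..<1} \<and> \<gamma> ` {0<..<1} = \<Gamma>)"

definition level_sets_foliated :: "(real^3) set \<Rightarrow> real \<Rightarrow> real \<Rightarrow> real \<Rightarrow> (real^3 \<Rightarrow> real) \<Rightarrow> bool"
  where
  "level_sets_foliated \<Omega> cg Cg K v \<longleftrightarrow>
     (AE t in lborel. t \<in> v ` \<Omega> \<longrightarrow>
       (\<exists>g \<xi>. C1_surface_function v {x\<in>\<Omega>. v x = t} g \<xi> \<and>
          (\<forall>x\<in>{x\<in>\<Omega>. v x = t}. cg \<le> norm (\<xi> x) \<and> norm (\<xi> x) \<le> Cg) \<and>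
          (AE r in lborel. \<forall>\<Gamma>\<in>components {x\<in>\<Omega>. v x = t \<and> g x = r}.
              C1_curve \<Gamma> \<and> closure \<Gamma> \<inter> frontier \<Omega> \<noteq> {}) \<and>
          (\<forall>r. hausdorff1 {x\<in>\<Omega>. v x = t \<and> g x = r} \<le> ennreal K)))"

end

theory Submission
  imports Defs
begin

text \<open>Let \<open>v = u + f\<close>, \<open>q = \<nabla>v\<close>, \<open>q' = \<nabla>(u' + f')\<close> and \<open>w = u' - u\<close>. Two ingredients are combined.

  First, \<open>\<integral>\<bar>w\<bar> \<le> C \<integral>\<bar>P \<nabla>w\<bar>\<close>, where \<open>P\<close> projects onto the tangent planes of the level sets of \<open>v\<close>: every
  leaf reaches the boundary, where \<open>w\<close> vanishes, so on a leaf \<open>\<bar>w\<bar>\<close> is at most the integral of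
  \<open>\<bar>P \<nabla>w\<bar>\<close> along that leaf; integrate over the leaves of a level set and then over the levels. In place of
  Hausdorff measures and the coarea formula it is enough, up to constants, to cut the domain, the level
  sets and the leaves into countably many pieces with bi-Lipschitz coordinates, in which integrals
  are ordinary Lebesgue integrals and Fubini's theorem applies.

  Second, minimality of \<open>u\<close> against \<open>u + s (u' - u)\<close>, and of \<open>u'\<close> against \<open>u' + s (u - u')\<close>, bounds the integral of
  \<open>1 - cos \<angle>(q, q')\<close> by the differences of the data. As \<open>P q = 0\<close>, \<open>P \<nabla>w\<close> is \<open>P q'\<close> up to
  \<open>P (\<nabla>f' - \<nabla>f)\<close>, and \<open>\<bar>P q'\<bar>\<^sup>2 \<le> 2 \<bar>q'\<bar>\<^sup>2 (1 - cos \<angle>(q, q'))\<close>.\<close>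

section \<open>Lipschitz images and integrals over charts\<close>

text \<open>The functions \<open>g\<close> that foliate the level \<open>t\<close> come with no
  measurable dependence on \<open>t\<close>, so integrals over leaves cannot be integrated in
  \<open>t\<close> directly. Hence each level is estimated in coordinates \<open>p i\<close> taken
  from one countable cover of \<open>\<Omega>\<close>; the coordinates built from \<open>g\<close>
  enter and leave inside \<open>surface_inequality\<close>, and only integrals that Fubini's theorem
  makes Borel in \<open>t\<close> are integrated. Uniform constants come from admissibility: it
  forces m / \<sigma>1 \<le> |q| \<le> M / \<sigma>0, so the Lipschitz constants of the coordinates
  depend neither on the point nor on the level. The number and size of the pieces do not matter, as
  they are made disjoint. The square roots arise because the bound on the integral of 1 - cos is
  linear in the differences of the data, while |P q'| is only of order sqrt (1 - cos). The
  difference of the sources appears multiplied by the integral of |w|, the very quantity to be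
  estimated; the trivial bound 1 - cos \<le> 2 closes this loop.\<close>

text \<open>Cover \<open>A\<close> by nonoverlapping dyadic cubes inside an open set of almost the
  same measure. The part of \<open>A\<close> in a cube of side \<open>s\<close> has diameter at most
  DIM * s, so its image lies in a cube of side 2 * L * DIM * s, whence the constant. Outer measure
  is used since neither \<open>A\<close> nor its image need be measurable.\<close>

lemma lipschitz_outer_measure_le:
  fixes f :: "'a::euclidean_space \<Rightarrow> 'b::euclidean_space"
  assumes dim: "DIM('a) = DIM('b)" and A: "bounded A" and L: "L > 0"
    and lip: "\<And>x y. x \<in> A \<Longrightarrow> y \<in> A \<Longrightarrow> dist (f x) (f y) \<le> L * dist x y"
  shows "outer_measure_of lborel (f ` A) \<le>
    ennreal ((2 * L * DIM('a)) ^ DIM('a)) * outer_measure_of lborel A"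
proof -
  let ?d = "DIM('a)"
  let ?c = "(2 * L * ?d) ^ ?d"
  have cpos: "?c > 0" using L by simp
  obtain E where E: "E \<in> sets borel" "A \<subseteq> E" "outer_measure_of lborel A = emeasure lborel E"
    using outer_measure_of_attain[of A lborel] by auto
  obtain R where R: "R > 0" "\<And>x. x \<in> A \<Longrightarrow> norm x \<le> R"
    using A bounded_pos by blast
  have Acb: "A \<subseteq> cbox (- (R *\<^sub>R One)) (R *\<^sub>R One)"
  proof
    fix x assume "x \<in> A"
    then have "norm x \<le> R" by (rule R)
    then have "\<And>i. i \<in> Basis \<Longrightarrow> \<bar>x \<bullet> i\<bar> \<le> R" using Basis_le_norm order_trans by blast
    then have "\<And>i. i \<in> Basis \<Longrightarrow> - R \<le> x \<bullet> i \<and> x \<bullet> i \<le> R" by (meson abs_le_D1 abs_le_D2 minus_le_iff)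
    then show "x \<in> cbox (- (R *\<^sub>R One)) (R *\<^sub>R One)"
      by (simp add: mem_box)
  qed
  have main: "outer_measure_of lborel (f ` A) \<le> ennreal ?c * (emeasure lborel E + ennreal e)"
    if e: "e > 0" for e
  proof -
    obtain U where U: "open U" "E \<subseteq> U" "emeasure lebesgue (U - E) < ennreal e" "U - E \<in> lmeasurable"
    proof (rule sets_lebesgue_outer_open[OF _ e])
      show "E \<in> sets lebesgue" using E(1) by simp
    qed
    have "emeasure lborel U \<le> emeasure lborel E + emeasure lborel (U - E)"
      using U(1,2) E(1) by (metis Diff_partition borel_open emeasure_subadditive sets.Diff sets_lborel)
    also have "emeasure lborel (U - E) \<le> ennreal e"
      using U(1,3) E(1) by (simp add: borel_open)
    finally have Ue: "emeasure lborel U \<le> emeasure lborel E + ennreal e" by (simp add: add_left_mono)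
    \<comment> \<open>With this gauge the condition \<open>K \<subseteq> g x\<close> of the covering
      lemma confines every cube to \<open>U\<close>.\<close>
    define g where "g x = (if x \<in> U then U else UNIV)" for x
    have gg: "gauge g" using U(1) by (auto simp: gauge_def g_def)
    have bx: "box (- (R *\<^sub>R One)) (R *\<^sub>R One :: 'a) \<noteq> {}"
      using R(1) by (simp add: box_ne_empty)
    obtain D where D: "countable D"
      "\<And>K. K \<in> D \<Longrightarrow> interior K \<noteq> {} \<and> (\<exists>c d. K = cbox c d)"
      "pairwise (\<lambda>A B. interior A \<inter> interior B = {}) D"
      "\<And>K. K \<in> D \<Longrightarrow> \<exists>x \<in> A \<inter> K. K \<subseteq> g x"
      "\<And>u v. cbox u v \<in> D \<Longrightarrow> \<exists>n. \<forall>i\<in>Basis. v \<bullet> i - u \<bullet> i = (R *\<^sub>R One \<bullet> i - - (R *\<^sub>R One) \<bullet> i) / 2^n"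
      "A \<subseteq> \<Union>D"
      by (rule covering_lemma[OF Acb bx gg]) blast
    have KU: "K \<subseteq> U" if "K \<in> D" for K
      using D(4)[OF that] E(2) U(2) by (auto simp: g_def split: if_splits)
    have ex: "\<exists>C. C \<in> sets borel \<and> f ` (A \<inter> K) \<subseteq> C \<and> emeasure lborel C \<le> ennreal ?c * emeasure lborel (interior K)"
      if K: "K \<in> D" for K
    proof -
      obtain u v where uv: "K = cbox u v" using D(2)[OF K] by blast
      obtain n where n: "\<forall>i\<in>Basis. v \<bullet> i - u \<bullet> i = (R *\<^sub>R One \<bullet> i - - (R *\<^sub>R One) \<bullet> i) / 2^n"
        using D(5) K uv by blast
      \<comment> \<open>The starting box is a cube of side 2 * R, so all edges of a dyadic cell have
        this common length.\<close>
      define s where "s = 2 * R / 2^n"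
      have s: "\<And>i. i \<in> Basis \<Longrightarrow> v \<bullet> i - u \<bullet> i = s" "s > 0"
        using n R(1) by (auto simp: s_def)
      obtain x where x: "x \<in> A" "x \<in> K" using D(4)[OF K] by blast
      define r where "r = L * (?d * s)"
      have r: "r > 0" using L s by (simp add: r_def)
      have dK: "dist y x \<le> ?d * s" if "y \<in> K" for y
      proof -
        have "dist y x \<le> (\<Sum>i\<in>Basis. \<bar>(y - x) \<bullet> i\<bar>)"
          unfolding dist_norm by (rule norm_le_l1)
        also have "\<dots> \<le> (\<Sum>i\<in>(Basis::'a set). s)"
        proof (rule sum_mono)
          fix i :: 'a assume i: "i \<in> Basis"
          have "u \<bullet> i \<le> y \<bullet> i" "y \<bullet> i \<le> v \<bullet> i" "u \<bullet> i \<le> x \<bullet> i" "x \<bullet> i \<le> v \<bullet> i"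
            using that x(2) i by (auto simp: uv mem_box)
          then show "\<bar>(y - x) \<bullet> i\<bar> \<le> s" using s(1)[OF i] by (simp add: inner_diff_left)
        qed
        finally show ?thesis by simp
      qed
      define C where "C = cbox (f x - r *\<^sub>R One) (f x + r *\<^sub>R One)"
      have "f ` (A \<inter> K) \<subseteq> C"
      proof safe
        fix y assume y: "y \<in> A" "y \<in> K"
        have "dist (f y) (f x) \<le> L * dist y x" by (rule lip[OF y(1) x(1)])
        also have "\<dots> \<le> r" unfolding r_def using dK[OF y(2)] L by simp
        finally have "norm (f y - f x) \<le> r" by (simp add: dist_norm)
        then have *: "\<bar>(f y - f x) \<bullet> i\<bar> \<le> r" if "i \<in> Basis" for i
          using Basis_le_norm[OF that, of "f y - f x"] by linarith
        have "f x \<bullet> i - r \<le> f y \<bullet> i \<and> f y \<bullet> i \<le> f x \<bullet> i + r" if "i \<in> Basis" for i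
          using *[OF that] by (simp add: inner_diff_left abs_le_iff algebra_simps)
        then show "f y \<in> C"
          unfolding C_def mem_box by (simp add: inner_diff_left inner_add_left)
      qed
      moreover have "emeasure lborel C = ennreal ?c * emeasure lborel (interior K)"
      proof -
        have "emeasure lborel C = ennreal (\<Prod>b\<in>(Basis::'b set). 2 * r)"
        proof -
          have "emeasure lborel C = (\<Prod>b\<in>Basis. (f x + r *\<^sub>R One - (f x - r *\<^sub>R One)) \<bullet> b)"
            unfolding C_def using r
            by (intro emeasure_lborel_cbox) (simp add: inner_diff_left inner_add_left)
          also have "(\<Prod>b\<in>(Basis::'b set). (f x + r *\<^sub>R One - (f x - r *\<^sub>R One)) \<bullet> b) = (\<Prod>b\<in>(Basis::'b set). 2 * r)"
            by (rule prod.cong) (simp_all add: inner_diff_left inner_add_left)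
          finally show ?thesis .
        qed
        also have "\<dots> = ennreal ((2 * r) ^ ?d)" by (simp add: dim)
        also have "(2 * r) ^ ?d = ?c * s ^ ?d" 
          unfolding r_def power_mult_distrib[symmetric]
          by (rule arg_cong[where f="\<lambda>x. x ^ _"]) (simp add: algebra_simps)
        also have "s ^ ?d = (\<Prod>b\<in>(Basis::'a set). (v - u) \<bullet> b)"
          by (simp add: inner_diff_left s(1))
        also have "ennreal (?c * (\<Prod>b\<in>(Basis::'a set). (v - u) \<bullet> b)) = ennreal ?c * emeasure lborel (interior K)"
        proof -
          have "emeasure lborel (box u v) = ennreal (\<Prod>b\<in>(Basis::'a set). (v - u) \<bullet> b)"
          proof (rule emeasure_lborel_box)
            show "u \<bullet> b \<le> v \<bullet> b" if "b \<in> Basis" for b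
              using s(1)[OF that] s(2) by linarith
          qed
          moreover have "(\<Prod>b\<in>(Basis::'a set). (v - u) \<bullet> b) \<ge> 0"
            using s by (intro prod_nonneg) (simp add: inner_diff_left)
          ultimately show ?thesis
            unfolding uv interior_cbox using cpos by (simp add: ennreal_mult)
        qed
        finally show ?thesis .
      qed
      ultimately show ?thesis unfolding C_def by (intro exI[of _ C]) (auto simp: C_def)
    qed
    then obtain C where C: "\<And>K. K \<in> D \<Longrightarrow> C K \<in> sets borel"
      "\<And>K. K \<in> D \<Longrightarrow> f ` (A \<inter> K) \<subseteq> C K"
      "\<And>K. K \<in> D \<Longrightarrow> emeasure lborel (C K) \<le> ennreal ?c * emeasure lborel (interior K)"
      by metis
    \<comment> \<open>\<open>D\<close> may be finite; indexing by naturals with empty sets elsewhere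
      fits the countable sums. The interiors are disjoint, so their measures add up to at most that
      of \<open>U\<close>.\<close>
    define I where "I = to_nat_on D ` D"
    define k where "k = from_nat_into D"
    have kI: "k n \<in> D" if "n \<in> I" for n using that D(1) by (auto simp: I_def k_def)
    have kinj: "inj_on k I" using D(1) by (auto simp: I_def k_def inj_on_def)
    have ksurj: "k ` I = D" using D(1) by (simp add: I_def k_def image_image)
    define X where "X n = (if n \<in> I then interior (k n) else {})" for n
    define Y where "Y n = (if n \<in> I then C (k n) else {})" for n
    have Xs: "range X \<subseteq> sets lborel" by (auto simp: X_def)
    have Ys: "range Y \<subseteq> sets lborel" using C(1) kI by (auto simp: Y_def)
    have Xd: "disjoint_family X"
      unfolding disjoint_family_on_def
    proof (intro ballI impI)
      fix m n :: nat assume "m \<noteq> n"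
      then show "X m \<inter> X n = {}"
        using pairwiseD[OF D(3), of "k m" "k n"] kI[of m] kI[of n] inj_onD[OF kinj, of m n]
        by (auto simp: X_def)
    qed
    have XU: "(\<Union>n. X n) \<subseteq> U" 
    proof (rule UN_least)
      show "X n \<subseteq> U" for n
        using KU[OF kI, of n] interior_subset[of "k n"] by (auto simp: X_def)
    qed
    have "f ` A \<subseteq> (\<Union>n. Y n)"
    proof
      fix z assume "z \<in> f ` A"
      then obtain x where x: "x \<in> A" "z = f x" by blast
      then obtain K where "K \<in> D" "x \<in> K" using D(6) by blast
      then obtain n where n: "n \<in> I" "k n = K" using ksurj by blast
      then have "z \<in> Y n" using C(2)[OF \<open>K \<in> D\<close>] x \<open>x \<in> K\<close> by (auto simp: Y_def)
      then show "z \<in> (\<Union>n. Y n)" by blast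
    qed
    then have "outer_measure_of lborel (f ` A) \<le> outer_measure_of lborel (\<Union>n. Y n)"
      by (rule outer_measure_of_mono)
    also have "\<dots> = emeasure lborel (\<Union>n. Y n)" using Ys by (intro outer_measure_of_eq) auto
    also have "\<dots> \<le> (\<Sum>n. emeasure lborel (Y n))" by (rule emeasure_subadditive_countably[OF Ys])
    also have "\<dots> \<le> (\<Sum>n. ennreal ?c * emeasure lborel (X n))"
      using C(3) kI by (intro suminf_le) (auto simp: X_def Y_def)
    also have "\<dots> = ennreal ?c * (\<Sum>n. emeasure lborel (X n))" by simp
    also have "(\<Sum>n. emeasure lborel (X n)) = emeasure lborel (\<Union>n. X n)"
      by (rule suminf_emeasure[OF Xs Xd])
    also have "\<dots> \<le> emeasure lborel U" using XU U(1) by (intro emeasure_mono) auto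
    also note Ue
    finally show ?thesis by (simp add: mult_left_mono)
  qed
  have "outer_measure_of lborel (f ` A) \<le> ennreal ?c * outer_measure_of lborel A + ennreal e" if e: "e > 0" for e
  proof -
    have "ennreal ?c * ennreal (e / ?c) = ennreal e"
      using e cpos L ennreal_mult[of ?c "e / ?c"] by simp
    then show ?thesis using main[of "e / ?c"] e cpos by (simp add: E(3) distrib_left)
  qed
  then show ?thesis by (rule ennreal_le_epsilon)
qed

section \<open>Charts, their measures, and change of coordinates\<close>

text \<open>Compactness makes the inverse of \<open>\<alpha>\<close> continuous, hence Borel, and
  the images of Borel sets Borel. Lipschitz bounds are kept out of the notion: they enter only when
  two charts are compared, on their overlap.\<close>

definition chart :: "'a::euclidean_space set \<Rightarrow> ('a \<Rightarrow> 'b::euclidean_space) \<Rightarrow> bool" where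
  "chart N \<alpha> \<longleftrightarrow> compact N \<and> continuous_on N \<alpha> \<and> inj_on \<alpha> N"

text \<open>Bi-Lipschitz charts into spaces of equal dimension give comparable measures (see
  \<open>chart_integral_le\<close> below), which makes this a substitute for the Hausdorff measure of that dimension
  on \<open>N\<close>.\<close>

definition chart_measure :: "'a::euclidean_space set \<Rightarrow> ('a \<Rightarrow> 'b::euclidean_space) \<Rightarrow> 'a measure" where
  "chart_measure N \<alpha> = distr (restrict_space lborel (\<alpha> ` N)) borel (inv_into N \<alpha>)"

lemma sets_chart_measure [simp, measurable_cong]: "sets (chart_measure N \<alpha>) = sets borel"
  and space_chart_measure [simp]: "space (chart_measure N \<alpha>) = UNIV"
  by (simp_all add: chart_measure_def)

lemma chart_image_borel: "chart N \<alpha> \<Longrightarrow> \<alpha> ` N \<in> sets borel"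
  unfolding chart_def by (intro borel_compact compact_continuous_image) auto

lemma chart_inv_measurable:
  assumes "chart N \<alpha>"
  shows "inv_into N \<alpha> \<in> restrict_space borel (\<alpha> ` N) \<rightarrow>\<^sub>M borel"
    "inv_into N \<alpha> \<in> restrict_space lborel (\<alpha> ` N) \<rightarrow>\<^sub>M borel"
proof -
  show 1: "inv_into N \<alpha> \<in> restrict_space borel (\<alpha> ` N) \<rightarrow>\<^sub>M borel"
    using assms unfolding chart_def
    by (intro borel_measurable_continuous_on_restrict continuous_on_inv) (auto simp: inv_into_f_f)
  have "sets (restrict_space lborel (\<alpha> ` N)) = sets (restrict_space borel (\<alpha> ` N))"
    by (simp add: sets_restrict_space)
  then show "inv_into N \<alpha> \<in> restrict_space lborel (\<alpha> ` N) \<rightarrow>\<^sub>M borel"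
    using 1 measurable_cong_sets by blast
qed

lemma chart_vimage_eq:
  assumes "chart N \<alpha>"
  shows "inv_into N \<alpha> -` A \<inter> \<alpha> ` N = \<alpha> ` (N \<inter> A)"
proof -
  have "inj_on \<alpha> N" using assms by (simp add: chart_def)
  then show ?thesis by (auto simp: inv_into_f_f)
qed

lemma chart_image_Int_borel:
  assumes "chart N \<alpha>" "A \<in> sets borel"
  shows "\<alpha> ` (N \<inter> A) \<in> sets borel"
proof -
  have "inv_into N \<alpha> -` A \<inter> space (restrict_space borel (\<alpha> ` N)) \<in> sets (restrict_space borel (\<alpha> ` N))"
    by (rule measurable_sets[OF chart_inv_measurable(1)[OF assms(1)] assms(2)])
  then show ?thesis
    using chart_image_borel[OF assms(1)]
    by (auto simp: space_restrict_space chart_vimage_eq[OF assms(1)] sets_restrict_space_iff)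
qed

lemma emeasure_chart_measure:
  assumes "chart N \<alpha>" "A \<in> sets borel"
  shows "emeasure (chart_measure N \<alpha>) A = emeasure lborel (\<alpha> ` (N \<inter> A))"
proof -
  have "emeasure (chart_measure N \<alpha>) A = emeasure (restrict_space lborel (\<alpha> ` N)) (inv_into N \<alpha> -` A \<inter> \<alpha> ` N)"
    unfolding chart_measure_def
    by (subst emeasure_distr[OF chart_inv_measurable(2)[OF assms(1)]])
       (auto simp: assms(2) space_restrict_space)
  also have "\<dots> = emeasure lborel (\<alpha> ` (N \<inter> A))"
    unfolding chart_vimage_eq[OF assms(1)]
    using chart_image_borel[OF assms(1)] by (intro emeasure_restrict_space) auto
  finally show ?thesis .
qed

lemma AE_chart_measure:
  assumes "chart N \<alpha>"
  shows "AE x in chart_measure N \<alpha>. x \<in> N"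
proof -
  have b: "- N \<in> sets borel"
    using assms unfolding chart_def by (simp add: borel_comp borel_compact)
  have "emeasure (chart_measure N \<alpha>) (- N) = 0"
    by (simp add: emeasure_chart_measure[OF assms b])
  then show ?thesis
    by (intro AE_I[of _ _ "- N"]) (auto simp: b)
qed

text \<open>The bound on measurable subsets of \<open>Q\<close> is domination of one density measure
  by a multiple of the other, and integrals are monotone in the measure.\<close>

lemma nn_integral_indicator_le_scaled:
  assumes s: "sets M = sets M'" and Q: "Q \<in> sets M" and h: "h \<in> borel_measurable M"
    and le: "\<And>A. A \<in> sets M \<Longrightarrow> A \<subseteq> Q \<Longrightarrow> emeasure M A \<le> c * emeasure M' A"
  shows "(\<integral>\<^sup>+x. h x * indicator Q x \<partial>M) \<le> c * (\<integral>\<^sup>+x. h x * indicator Q x \<partial>M')"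
proof -
  have Q': "Q \<in> sets M'" and h': "h \<in> borel_measurable M'"
    using Q h s by (simp_all cong: measurable_cong_sets)
  have sp: "space M = space M'" by (rule sets_eq_imp_space_eq[OF s])
  have le': "density M (indicator Q) \<le> scale_measure c (density M' (indicator Q))"
  proof (subst le_measure)
    show "\<forall>A\<in>sets (density M (indicator Q)).
       emeasure (density M (indicator Q)) A \<le> emeasure (scale_measure c (density M' (indicator Q))) A"
    proof
      fix A assume "A \<in> sets (density M (indicator Q))"
      then have A: "A \<in> sets M" "A \<in> sets M'" using s by auto
      show "emeasure (density M (indicator Q)) A \<le> emeasure (scale_measure c (density M' (indicator Q))) A"
        using le[of "Q \<inter> A"] A Q Q' by (simp add: emeasure_restricted)
    qed
  qed (simp add: s)
  have "(\<integral>\<^sup>+x. h x * indicator Q x \<partial>M) = (\<integral>\<^sup>+x. h x \<partial>density M (indicator Q))"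
    using Q h by (subst nn_integral_density) (auto simp: mult.commute)
  also have "\<dots> \<le> (\<integral>\<^sup>+x. h x \<partial>scale_measure c (density M' (indicator Q)))"
    by (intro nn_integral_mono_measure le') (simp add: s)
  also have "\<dots> = c * (\<integral>\<^sup>+x. h x \<partial>density M' (indicator Q))"
    using h' by (intro nn_integral_scale_measure) auto
  also have "(\<integral>\<^sup>+x. h x \<partial>density M' (indicator Q)) = (\<integral>\<^sup>+x. h x * indicator Q x \<partial>M')"
    using Q' h' by (subst nn_integral_density) (auto simp: mult.commute)
  finally show ?thesis .
qed

text \<open>The factor in \<open>lipschitz_outer_measure_le\<close>: what a change of chart costs in
  dimension \<open>d\<close>.\<close>

definition distortion :: "nat \<Rightarrow> real \<Rightarrow> real" where
  "distortion d L = (2 * L * d) ^ d"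

text \<open>The transition map from \<open>\<beta>\<close> to \<open>\<alpha>\<close> coordinates is
  \<open>L\<close>-Lipschitz on the overlap, to which \<open>Q\<close> localizes the comparison, so
  it enlarges measures at most by the distortion factor.\<close>

lemma chart_integral_le:
  fixes \<alpha> :: "'a::euclidean_space \<Rightarrow> 'b::euclidean_space" and \<beta> :: "'a \<Rightarrow> 'c::euclidean_space"
  assumes dim: "DIM('c) = DIM('b)" and ch: "chart N \<alpha>" "chart N' \<beta>"
    and Q: "Q \<in> sets borel" "N \<inter> Q \<subseteq> N'" and L: "L > 0"
    and lip: "\<And>x y. x \<in> N \<inter> Q \<Longrightarrow> y \<in> N \<inter> Q \<Longrightarrow> dist (\<alpha> x) (\<alpha> y) \<le> L * dist (\<beta> x) (\<beta> y)"
    and h: "h \<in> borel_measurable borel"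
  shows "(\<integral>\<^sup>+x. h x * indicator Q x \<partial>chart_measure N \<alpha>) \<le>
    ennreal (distortion DIM('b) L) * (\<integral>\<^sup>+x. h x * indicator Q x \<partial>chart_measure N' \<beta>)"
proof (rule nn_integral_indicator_le_scaled)
  fix A assume A: "A \<in> sets (chart_measure N \<alpha>)" "A \<subseteq> Q"
  have Ab: "A \<in> sets borel" using A by simp
  let ?f = "\<lambda>z. \<alpha> (inv_into N' \<beta> z)"
  have inj: "inj_on \<beta> N'" using ch by (simp add: chart_def)
  have inv: "inv_into N' \<beta> (\<beta> x) = x" if "x \<in> N \<inter> A" for x
    using that A Q inj by (intro inv_into_f_f) auto
  have im: "?f ` (\<beta> ` (N \<inter> A)) = \<alpha> ` (N \<inter> A)"
    using inv by (auto simp: image_image)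
  have sub: "N \<inter> A \<subseteq> N' \<inter> A" using A Q by auto
  have "emeasure (chart_measure N \<alpha>) A = outer_measure_of lborel (?f ` (\<beta> ` (N \<inter> A)))"
    unfolding im emeasure_chart_measure[OF ch(1) Ab]
    using chart_image_Int_borel[OF ch(1) Ab] by simp
  also have "\<dots> \<le> ennreal ((2 * L * DIM('c)) ^ DIM('c)) * outer_measure_of lborel (\<beta> ` (N \<inter> A))"
  proof (rule lipschitz_outer_measure_le[OF dim _ L])
    have "compact (\<beta> ` N')" using ch(2) unfolding chart_def by (intro compact_continuous_image) auto
    then show "bounded (\<beta> ` (N \<inter> A))" using sub
      by (meson bounded_subset compact_imp_bounded image_mono le_inf_iff order_trans order_refl)
  next
    fix z w assume "z \<in> \<beta> ` (N \<inter> A)" "w \<in> \<beta> ` (N \<inter> A)"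
    then obtain x y where "x \<in> N \<inter> A" "z = \<beta> x" "y \<in> N \<inter> A" "w = \<beta> y" by auto
    then show "dist (?f z) (?f w) \<le> L * dist z w" using lip[of x y] A by (auto simp: inv)
  qed
  also have "outer_measure_of lborel (\<beta> ` (N \<inter> A)) \<le> outer_measure_of lborel (\<beta> ` (N' \<inter> A))"
    using sub by (intro outer_measure_of_mono image_mono)
  also have "\<dots> = emeasure (chart_measure N' \<beta>) A"
    unfolding emeasure_chart_measure[OF ch(2) Ab]
    using chart_image_Int_borel[OF ch(2) Ab] by simp
  finally show "emeasure (chart_measure N \<alpha>) A \<le>
      ennreal (distortion DIM('b) L) * emeasure (chart_measure N' \<beta>) A"
    by (simp add: mult_left_mono distortion_def dim)
qed (use Q h in auto)

text \<open>The \<open>N i\<close> are closed in the whole space, not just in \<open>S\<close>: the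
  disjointed pieces are then Borel, and the same family serves \<open>S\<close>, its level sets and
  the leaves.\<close>

definition atlas :: "'a::euclidean_space set \<Rightarrow> (nat \<Rightarrow> 'a set) \<Rightarrow> (nat \<Rightarrow> 'a \<Rightarrow> 'b::euclidean_space) \<Rightarrow> bool"
  where "atlas S N \<alpha> \<longleftrightarrow> (\<forall>i. closed (N i) \<and> chart (N i \<inter> S) (\<alpha> i)) \<and> S \<subseteq> (\<Union>i. N i)"

text \<open>\<open>disjointed N\<close> makes the pieces disjoint; only the closed sets \<open>N i \<inter> S\<close> need to be compact.\<close>

definition atlas_integral :: "'a::euclidean_space set \<Rightarrow> (nat \<Rightarrow> 'a set) \<Rightarrow> (nat \<Rightarrow> 'a \<Rightarrow> 'b::euclidean_space) \<Rightarrow>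
    ('a \<Rightarrow> ennreal) \<Rightarrow> ennreal" where
  "atlas_integral S N \<alpha> h =
    (\<Sum>i. \<integral>\<^sup>+x. h x * indicator (disjointed N i) x \<partial>chart_measure (N i \<inter> S) (\<alpha> i))"

lemma disjointed_borel:
  assumes "atlas S N \<alpha>" shows "disjointed N i \<in> sets borel"
proof -
  have "range N \<subseteq> sets borel" using assms by (auto simp: atlas_def borel_closed)
  from sets.range_disjointed_sets[OF this] show ?thesis by auto
qed

lemma suminf_indicator_disjointed:
  "(\<Sum>i. indicator (disjointed N i) x :: ennreal) = indicator (\<Union>i. N i) x"
  using suminf_indicator[OF disjoint_family_disjointed, of N x] by (simp add: UN_disjointed_eq)

lemma ennreal_suminf_swap:
  fixes f :: "nat \<Rightarrow> nat \<Rightarrow> ennreal"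
  shows "(\<Sum>i. \<Sum>j. f i j) = (\<Sum>j. \<Sum>i. f i j)"
proof -
  have "(\<Sum>i. \<Sum>j. f i j) = (\<integral>\<^sup>+i. (\<Sum>j. f i j) \<partial>count_space UNIV)"
    by (rule nn_integral_count_space_nat[symmetric])
  also have "\<dots> = (\<Sum>j. \<integral>\<^sup>+i. f i j \<partial>count_space UNIV)"
    by (rule nn_integral_suminf) simp
  finally show ?thesis by (simp add: nn_integral_count_space_nat)
qed

text \<open>The pieces of both atlases are intersected, the charts compared on each overlap, and the
  double sum resummed over the other atlas. One \<open>L\<close> for all overlaps makes the factor
  independent of the number of pieces.\<close>

lemma atlas_integral_le:
  fixes \<alpha> :: "nat \<Rightarrow> 'a::euclidean_space \<Rightarrow> 'b::euclidean_space" and \<beta> :: "nat \<Rightarrow> 'a \<Rightarrow> 'c::euclidean_space"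
  assumes dim: "DIM('c) = DIM('b)" and at: "atlas S N \<alpha>" "atlas S N' \<beta>" and L: "L > 0"
    and lip: "\<And>i j x y. x \<in> N i \<inter> N' j \<inter> S \<Longrightarrow> y \<in> N i \<inter> N' j \<inter> S \<Longrightarrow>
        dist (\<alpha> i x) (\<alpha> i y) \<le> L * dist (\<beta> j x) (\<beta> j y)"
    and h: "h \<in> borel_measurable borel"
  shows "atlas_integral S N \<alpha> h \<le> ennreal (distortion DIM('b) L) * atlas_integral S N' \<beta> h"
proof -
  let ?B = "disjointed N" and ?B' = "disjointed N'" and ?c = "ennreal (distortion DIM('b) L)"
  have [measurable]: "?B i \<in> sets borel" "?B' i \<in> sets borel" for i
    using disjointed_borel[OF at(1)] disjointed_borel[OF at(2)] by auto
  note h[measurable]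
  have ch: "chart (N i \<inter> S) (\<alpha> i)" "chart (N' i \<inter> S) (\<beta> i)" for i using at by (auto simp: atlas_def)
  have "atlas_integral S N \<alpha> h =
     (\<Sum>i. \<Sum>j. \<integral>\<^sup>+x. h x * indicator (?B i \<inter> ?B' j) x \<partial>chart_measure (N i \<inter> S) (\<alpha> i))"
    unfolding atlas_integral_def
  proof (rule suminf_cong)
    fix i
    have "(\<integral>\<^sup>+x. h x * indicator (?B i) x \<partial>chart_measure (N i \<inter> S) (\<alpha> i)) =
       (\<integral>\<^sup>+x. (\<Sum>j. h x * indicator (?B i \<inter> ?B' j) x) \<partial>chart_measure (N i \<inter> S) (\<alpha> i))"
    proof (rule nn_integral_cong_AE)
      show "AE x in chart_measure (N i \<inter> S) (\<alpha> i).
         h x * indicator (?B i) x = (\<Sum>j. h x * indicator (?B i \<inter> ?B' j) x)"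
        using AE_chart_measure[OF ch(1)]
      proof (eventually_elim)
        case (elim x)
        then have "x \<in> (\<Union>j. N' j)" using at(2) by (auto simp: atlas_def)
        then have "(\<Sum>j. indicator (?B' j) x :: ennreal) = 1"
          by (simp add: suminf_indicator_disjointed)
        then show ?case
          by (simp add: indicator_inter_arith mult.assoc[symmetric])
      qed
    qed
    also have "\<dots> = (\<Sum>j. \<integral>\<^sup>+x. h x * indicator (?B i \<inter> ?B' j) x \<partial>chart_measure (N i \<inter> S) (\<alpha> i))"
      by (rule nn_integral_suminf) measurable
    finally show "(\<integral>\<^sup>+x. h x * indicator (?B i) x \<partial>chart_measure (N i \<inter> S) (\<alpha> i)) = \<dots>" .
  qed
  also have "\<dots> \<le> (\<Sum>i. \<Sum>j. ?c * (\<integral>\<^sup>+x. h x * indicator (?B i \<inter> ?B' j) x \<partial>chart_measure (N' j \<inter> S) (\<beta> j)))"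
  proof (intro suminf_le summableI allI)
    fix i j
    have "?B i \<subseteq> N i" "?B' j \<subseteq> N' j" by (auto simp: disjointed_subset)
    then show "(\<integral>\<^sup>+x. h x * indicator (?B i \<inter> ?B' j) x \<partial>chart_measure (N i \<inter> S) (\<alpha> i)) \<le>
       ?c * (\<integral>\<^sup>+x. h x * indicator (?B i \<inter> ?B' j) x \<partial>chart_measure (N' j \<inter> S) (\<beta> j))"
      by (intro chart_integral_le[OF dim ch(1) ch(2) _ _ L lip h]) auto
  qed
  also have "\<dots> = ?c * (\<Sum>i. \<Sum>j. \<integral>\<^sup>+x. h x * indicator (?B i \<inter> ?B' j) x \<partial>chart_measure (N' j \<inter> S) (\<beta> j))"
    by simp
  also have "(\<Sum>i. \<Sum>j. \<integral>\<^sup>+x. h x * indicator (?B i \<inter> ?B' j) x \<partial>chart_measure (N' j \<inter> S) (\<beta> j)) =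
     (\<Sum>j. \<Sum>i. \<integral>\<^sup>+x. h x * indicator (?B i \<inter> ?B' j) x \<partial>chart_measure (N' j \<inter> S) (\<beta> j))"
    by (rule ennreal_suminf_swap)
  \<comment> \<open>The pieces \<open>disjointed N i\<close> are disjoint, so their indicators sum
    to at most 1.\<close>
  also have "\<dots> \<le> atlas_integral S N' \<beta> h"
    unfolding atlas_integral_def
  proof (intro suminf_le summableI allI)
    fix j
    have "(\<Sum>i. \<integral>\<^sup>+x. h x * indicator (?B i \<inter> ?B' j) x \<partial>chart_measure (N' j \<inter> S) (\<beta> j)) =
      (\<integral>\<^sup>+x. (\<Sum>i. h x * indicator (?B i \<inter> ?B' j) x) \<partial>chart_measure (N' j \<inter> S) (\<beta> j))"
      by (rule nn_integral_suminf[symmetric]) measurable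
    also have "\<dots> = (\<integral>\<^sup>+x. h x * indicator (?B' j) x * (\<Sum>i. indicator (?B i) x) \<partial>chart_measure (N' j \<inter> S) (\<beta> j))"
      unfolding ennreal_suminf_cmult[symmetric]
      by (intro nn_integral_cong suminf_cong) (simp split: split_indicator)
    also have "\<dots> \<le> (\<integral>\<^sup>+x. h x * indicator (?B' j) x \<partial>chart_measure (N' j \<inter> S) (\<beta> j))"
      by (intro nn_integral_mono) (auto simp: suminf_indicator_disjointed split: split_indicator)
    finally show "(\<Sum>i. \<integral>\<^sup>+x. h x * indicator (?B i \<inter> ?B' j) x \<partial>chart_measure (N' j \<inter> S) (\<beta> j)) \<le> \<dots>" .
  qed
  finally show ?thesis by (simp add: mult_left_mono)
qed

section \<open>Slicing charts and atlases at the last coordinate\<close>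

lemma chart_slice:
  fixes p :: "'a::euclidean_space \<Rightarrow> 'b::euclidean_space" and v :: "'a \<Rightarrow> real"
  assumes ch: "chart N (\<lambda>x. (p x, v x))"
  shows "chart {x \<in> N. v x = t} p"
proof -
  have c: "compact N" "continuous_on N (\<lambda>x. (p x, v x))" "inj_on (\<lambda>x. (p x, v x)) N"
    using ch by (auto simp: chart_def)
  have p: "continuous_on N p" and v: "continuous_on N v"
    using continuous_on_fst[OF c(2)] continuous_on_snd[OF c(2)] by auto
  have "compact (N \<inter> v -` {t})"
    using continuous_closedin_preimage[OF v, of "{t}"] c(1)
    by (meson closed_singleton closedin_compact)
  moreover have "N \<inter> v -` {t} = {x \<in> N. v x = t}" by auto
  ultimately show ?thesis
    unfolding chart_def using continuous_on_subset[OF p] c(3)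
    by (auto simp: inj_on_def)
qed

text \<open>The measure of a chart is Lebesgue measure in the coordinates \<open>(p x, v x)\<close>.
  As \<open>v\<close> itself is a coordinate, the slices are those of Fubini's theorem and no
  Jacobian appears.\<close>

lemma chart_fubini:
  fixes p :: "'a::euclidean_space \<Rightarrow> 'b::euclidean_space" and v :: "'a \<Rightarrow> real"
  assumes ch: "chart N (\<lambda>x. (p x, v x))" and h: "h \<in> borel_measurable borel"
  shows "(\<integral>\<^sup>+x. h x \<partial>chart_measure N (\<lambda>x. (p x, v x))) =
      (\<integral>\<^sup>+t. (\<integral>\<^sup>+x. h x \<partial>chart_measure {x \<in> N. v x = t} p) \<partial>lborel)" (is ?eq)
    and "(\<lambda>t. \<integral>\<^sup>+x. h x \<partial>chart_measure {x \<in> N. v x = t} p) \<in> borel_measurable borel" (is ?meas)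
proof -
  let ?\<phi> = "\<lambda>x. (p x, v x)"
  \<comment> \<open>The integrand carried over to coordinate space and extended by 0, hence Borel on
    the full product.\<close>
  define G where "G z = h (inv_into N ?\<phi> z) * indicator (?\<phi> ` N) z" for z
  have im: "?\<phi> ` N \<in> sets borel" by (rule chart_image_borel[OF ch])
  have "(\<lambda>z. h (inv_into N ?\<phi> z)) \<in> borel_measurable (restrict_space borel (?\<phi> ` N))"
    using measurable_compose[OF chart_inv_measurable(1)[OF ch] h] by (simp add: comp_def)
  then have G: "G \<in> borel_measurable borel"
    unfolding G_def using im by (subst (asm) borel_measurable_restrict_space_iff_ennreal) (auto simp: mult.commute)
  then have G2: "G \<in> borel_measurable (lborel \<Otimes>\<^sub>M lborel)" by (simp add: lborel_prod)
  have inner: "(\<integral>\<^sup>+y. G (y, t) \<partial>lborel) = (\<integral>\<^sup>+x. h x \<partial>chart_measure {x \<in> N. v x = t} p)" for t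
  proof -
    let ?N = "{x \<in> N. v x = t}"
    have ch': "chart ?N p" by (rule chart_slice[OF ch])
    have "(\<integral>\<^sup>+x. h x \<partial>chart_measure ?N p) = (\<integral>\<^sup>+y. h (inv_into ?N p y) * indicator (p ` ?N) y \<partial>lborel)"
      unfolding chart_measure_def using chart_image_borel[OF ch'] h
      by (subst nn_integral_distr[OF chart_inv_measurable(2)[OF ch']])
         (auto simp: nn_integral_restrict_space)
    also have "\<dots> = (\<integral>\<^sup>+y. G (y, t) \<partial>lborel)"
    proof (rule nn_integral_cong)
      fix y
      show "h (inv_into ?N p y) * indicator (p ` ?N) y = G (y, t)"
      proof (cases "y \<in> p ` ?N")
        case True
        then obtain x where x: "x \<in> N" "v x = t" "y = p x" by auto
        have "inv_into ?N p y = x" using ch' x by (auto simp: chart_def intro: inv_into_f_eq)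
        moreover have "inv_into N ?\<phi> (y, t) = x"
          using ch x by (auto simp: chart_def intro: inv_into_f_eq)
        moreover have "(y, t) \<in> ?\<phi> ` N" using x by auto
        ultimately show ?thesis using True by (simp add: G_def)
      next
        case False
        then have "(y, t) \<notin> ?\<phi> ` N" by auto
        then show ?thesis using False by (simp add: G_def)
      qed
    qed
    finally show ?thesis by simp
  qed
  have "(\<integral>\<^sup>+x. h x \<partial>chart_measure N ?\<phi>) = (\<integral>\<^sup>+z. G z \<partial>lborel)"
    unfolding chart_measure_def G_def using im h
    by (subst nn_integral_distr[OF chart_inv_measurable(2)[OF ch]])
       (auto simp: nn_integral_restrict_space)
  also have "\<dots> = (\<integral>\<^sup>+z. G z \<partial>(lborel \<Otimes>\<^sub>M lborel))" by (simp add: lborel_prod)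
  also have "\<dots> = (\<integral>\<^sup>+t. (\<integral>\<^sup>+y. G (y, t) \<partial>lborel) \<partial>lborel)"
    by (rule lborel_pair.nn_integral_snd[OF G2, symmetric])
  finally show ?eq by (simp add: inner)
  have "(\<lambda>t. \<integral>\<^sup>+y. G (y, t) \<partial>lborel) \<in> borel_measurable lborel"
    using G2 by measurable
  then show ?meas by (simp add: inner)
qed

lemma atlas_slice:
  fixes p :: "nat \<Rightarrow> 'a::euclidean_space \<Rightarrow> 'b::euclidean_space" and v :: "'a \<Rightarrow> real"
  assumes "atlas S N (\<lambda>i x. (p i x, v x))"
  shows "atlas {x \<in> S. v x = t} N p"
proof -
  have "{x \<in> N i \<inter> S. v x = t} = N i \<inter> {x \<in> S. v x = t}" for i by auto
  then show ?thesis
    using assms chart_slice[of "N _ \<inter> S" "p _" v t] unfolding atlas_def by (metis (mono_tags, lifting) mem_Collect_eq subset_iff)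
qed

lemma atlas_fubini:
  fixes p :: "nat \<Rightarrow> 'a::euclidean_space \<Rightarrow> 'b::euclidean_space" and v :: "'a \<Rightarrow> real"
  assumes at: "atlas S N (\<lambda>i x. (p i x, v x))" and h: "h \<in> borel_measurable borel"
  shows "atlas_integral S N (\<lambda>i x. (p i x, v x)) h =
      (\<integral>\<^sup>+t. atlas_integral {x \<in> S. v x = t} N p h \<partial>lborel)"
    and "(\<lambda>t. atlas_integral {x \<in> S. v x = t} N p h) \<in> borel_measurable borel"
proof -
  have eq: "{x \<in> N i \<inter> S. v x = t} = N i \<inter> {x \<in> S. v x = t}" for i t by auto
  have ch: "chart (N i \<inter> S) (\<lambda>x. (p i x, v x))" for i using at by (auto simp: atlas_def)
  have hm: "(\<lambda>x. h x * indicator (disjointed N i) x) \<in> borel_measurable borel" for i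
    using disjointed_borel[OF at] h by measurable
  note f = chart_fubini[OF ch hm, unfolded eq]
  show "atlas_integral S N (\<lambda>i x. (p i x, v x)) h =
      (\<integral>\<^sup>+t. atlas_integral {x \<in> S. v x = t} N p h \<partial>lborel)"
    unfolding atlas_integral_def f(1)
    by (rule nn_integral_suminf[symmetric]) (simp add: f(2))
  show "(\<lambda>t. atlas_integral {x \<in> S. v x = t} N p h) \<in> borel_measurable borel"
    unfolding atlas_integral_def using f(2) by measurable
qed

section \<open>Integrals along curves\<close>

lemma outer_measure_of_UN_le:
  fixes A :: "nat \<Rightarrow> 'a::euclidean_space set"
  shows "outer_measure_of lborel (\<Union>n. A n) \<le> (\<Sum>n. outer_measure_of lborel (A n))"
proof -
  have "\<forall>n. \<exists>E\<in>sets lborel. A n \<subseteq> E \<and> outer_measure_of lborel (A n) = emeasure lborel E"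
    by (intro allI outer_measure_of_attain) simp
  then obtain E where E: "\<And>n. E n \<in> sets lborel" "\<And>n. A n \<subseteq> E n"
    "\<And>n. outer_measure_of lborel (A n) = emeasure lborel (E n)"
    by metis
  have "outer_measure_of lborel (\<Union>n. A n) \<le> outer_measure_of lborel (\<Union>n. E n)"
    using E(2) by (intro outer_measure_of_mono) blast
  also have "\<dots> = emeasure lborel (\<Union>n. E n)" using E(1) by (intro outer_measure_of_eq) auto
  also have "\<dots> \<le> (\<Sum>n. emeasure lborel (E n))" using E(1) by (intro emeasure_subadditive_countably) auto
  finally show ?thesis by (simp add: E(3))
qed

lemma outer_measure_of_real_le:
  fixes X :: "real set"
  assumes "\<And>x y. x \<in> X \<Longrightarrow> y \<in> X \<Longrightarrow> \<bar>x - y\<bar> \<le> D"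
  shows "outer_measure_of lborel X \<le> ennreal D"
proof (cases "X = {}")
  case False
  then obtain a where a: "a \<in> X" by blast
  have bd: "bdd_below X" by (rule bdd_belowI[of _ "a - D"]) (use assms[OF a] in \<open>force simp: abs_le_iff\<close>)
  have le: "x \<le> Inf X + D" if "x \<in> X" for x
  proof -
    have "x - D \<le> Inf X"
      using False by (rule cInf_greatest) (use assms[OF that] in \<open>force simp: abs_le_iff\<close>)
    then show ?thesis by simp
  qed
  have "X \<subseteq> {Inf X .. Inf X + D}" using le cInf_lower[OF _ bd] by auto
  then have "outer_measure_of lborel X \<le> outer_measure_of lborel {Inf X .. Inf X + D}"
    by (rule outer_measure_of_mono)
  also have "\<dots> = emeasure lborel {Inf X .. Inf X + D}" by (rule outer_measure_of_eq) simp
  also have "\<dots> = ennreal D" using le[OF a] cInf_lower[OF a bd] by (subst emeasure_lborel_Icc) auto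
  finally show ?thesis .
qed simp

lemma finite_compact_separated:
  fixes C :: "nat \<Rightarrow> 'a::euclidean_space set"
  assumes "\<And>i. i < n \<Longrightarrow> compact (C i)" "\<And>i j. i < n \<Longrightarrow> j < n \<Longrightarrow> i \<noteq> j \<Longrightarrow> C i \<inter> C j = {}"
  obtains \<delta> where "\<delta> > 0"
    "\<And>i j x y. i < n \<Longrightarrow> j < n \<Longrightarrow> i \<noteq> j \<Longrightarrow> x \<in> C i \<Longrightarrow> y \<in> C j \<Longrightarrow> \<delta> \<le> dist x y"
proof -
  have "\<exists>d>0. \<forall>x\<in>C i. \<forall>y\<in>C j. d \<le> dist x y" if "i < n" "j < n" "i \<noteq> j" for i j
    using separate_compact_closed[of "C i" "C j"] assms that compact_imp_closed by blast
  then obtain d where d: "\<And>i j. i < n \<Longrightarrow> j < n \<Longrightarrow> i \<noteq> j \<Longrightarrow> d i j > 0"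
    "\<And>i j x y. i < n \<Longrightarrow> j < n \<Longrightarrow> i \<noteq> j \<Longrightarrow> x \<in> C i \<Longrightarrow> y \<in> C j \<Longrightarrow> d i j \<le> dist x y"
    by metis
  let ?P = "{(i, j). i < n \<and> j < n \<and> i \<noteq> j}"
  let ?F = "insert 1 ((\<lambda>(i, j). d i j) ` ?P)"
  have "finite ?P" by (rule finite_subset[of _ "{..<n} \<times> {..<n}"]) auto
  then have fin: "finite ?F" by simp
  show ?thesis
  proof (rule that[of "Min ?F"])
    show "Min ?F > 0" using fin d(1) by (subst Min_gr_iff) auto
    fix i j x y assume *: "i < n" "j < n" "i \<noteq> j" "x \<in> C i" "y \<in> C j"
    have "d i j \<in> ?F" using * by force
    then have "Min ?F \<le> d i j" using fin by (intro Min_le)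
    also have "\<dots> \<le> dist x y" using d(2) * by blast
    finally show "Min ?F \<le> dist x y" .
  qed
qed

text \<open>A set of small diameter meets at most one of the compact sets \<open>C i\<close>, so every fine cover
  of \<open>A\<close> splits into covers of the \<open>C i\<close>.\<close>

lemma sum_outer_measure_le_hausdorff1:
  fixes C :: "nat \<Rightarrow> 'a::euclidean_space set" and q :: "nat \<Rightarrow> 'a \<Rightarrow> real"
  assumes cpt: "\<And>i. i < n \<Longrightarrow> compact (C i)"
    and disj: "\<And>i j. i < n \<Longrightarrow> j < n \<Longrightarrow> i \<noteq> j \<Longrightarrow> C i \<inter> C j = {}"
    and sub: "\<And>i. i < n \<Longrightarrow> C i \<subseteq> A"
    and lip: "\<And>i x y. i < n \<Longrightarrow> x \<in> C i \<Longrightarrow> y \<in> C i \<Longrightarrow> \<bar>q i x - q i y\<bar> \<le> dist x y"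
  shows "(\<Sum>i<n. outer_measure_of lborel (q i ` C i)) \<le> hausdorff1 A"
proof -
  obtain \<delta> where \<delta>: "\<delta> > 0"
    "\<And>i j x y. i < n \<Longrightarrow> j < n \<Longrightarrow> i \<noteq> j \<Longrightarrow> x \<in> C i \<Longrightarrow> y \<in> C j \<Longrightarrow> \<delta> \<le> dist x y"
    by (rule finite_compact_separated[of n C]) (use cpt disj in blast)+
  \<comment> \<open>Half of the separation, since the diameters are bounded only non-strictly: a set
    of diameter \<delta> could still meet two of the \<open>C i\<close>.\<close>
  have "(\<Sum>i<n. outer_measure_of lborel (q i ` C i)) \<le>
     (INF U\<in>{U :: nat \<Rightarrow> 'a set. A \<subseteq> (\<Union>i. U i) \<and>
          (\<forall>i. bounded (U i) \<and> diameter (U i) \<le> \<delta> / 2)}. \<Sum>i. ennreal (diameter (U i)))"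
  proof (rule INF_greatest)
    fix U :: "nat \<Rightarrow> 'a set"
    assume "U \<in> {U. A \<subseteq> (\<Union>i. U i) \<and> (\<forall>i. bounded (U i) \<and> diameter (U i) \<le> \<delta> / 2)}"
    then have U: "A \<subseteq> (\<Union>i. U i)" "\<And>i. bounded (U i)" "\<And>i. diameter (U i) \<le> \<delta> / 2" by auto
    define e where "e i k = (if U k \<inter> C i = {} then 0 else ennreal (diameter (U k)))" for i k
    have 1: "outer_measure_of lborel (q i ` C i) \<le> (\<Sum>k. e i k)" if i: "i < n" for i
    proof -
      have "q i ` C i \<subseteq> (\<Union>k. q i ` (C i \<inter> U k))" using sub[OF i] U(1) by blast
      then have "outer_measure_of lborel (q i ` C i) \<le> outer_measure_of lborel (\<Union>k. q i ` (C i \<inter> U k))"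
        by (rule outer_measure_of_mono)
      also have "\<dots> \<le> (\<Sum>k. outer_measure_of lborel (q i ` (C i \<inter> U k)))"
        by (rule outer_measure_of_UN_le)
      also have "\<dots> \<le> (\<Sum>k. e i k)"
      proof (intro suminf_le summableI)
        fix k
        show "outer_measure_of lborel (q i ` (C i \<inter> U k)) \<le> e i k"
        proof (cases "U k \<inter> C i = {}")
          case True
          then have "C i \<inter> U k = {}" by blast
          then show ?thesis by simp
        next
          case False
          have "outer_measure_of lborel (q i ` (C i \<inter> U k)) \<le> ennreal (diameter (U k))"
          proof (rule outer_measure_of_real_le)
            fix s t assume "s \<in> q i ` (C i \<inter> U k)" "t \<in> q i ` (C i \<inter> U k)"
            then obtain x y where xy: "x \<in> C i" "x \<in> U k" "s = q i x" "y \<in> C i" "y \<in> U k" "t = q i y" by blast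
            have "\<bar>s - t\<bar> \<le> dist x y" using lip[OF i xy(1,4)] xy by simp
            also have "\<dots> \<le> diameter (U k)" by (rule diameter_bounded_bound[OF U(2) xy(2,5)])
            finally show "\<bar>s - t\<bar> \<le> diameter (U k)" .
          qed
          then show ?thesis using False by (simp add: e_def)
        qed
      qed
      finally show ?thesis .
    qed
    have 2: "(\<Sum>i<n. e i k) \<le> ennreal (diameter (U k))" for k
    proof (cases "\<exists>i<n. U k \<inter> C i \<noteq> {}")
      case True
      then obtain i where i: "i < n" "U k \<inter> C i \<noteq> {}" by blast
      then obtain x where x: "x \<in> U k" "x \<in> C i" by blast
      have "e j k = 0" if "j < n" "j \<noteq> i" for j
      proof (rule ccontr)
        assume "e j k \<noteq> 0"
        then obtain y where y: "y \<in> U k" "y \<in> C j" by (auto simp: e_def split: if_splits)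
        have "\<delta> \<le> dist y x" using \<delta>(2)[OF that(1) i(1) that(2) y(2) x(2)] .
        also have "\<dots> \<le> diameter (U k)" by (rule diameter_bounded_bound[OF U(2) y(1) x(1)])
        also have "\<dots> \<le> \<delta> / 2" by (rule U(3))
        finally show False using \<delta>(1) by simp
      qed
      then have "(\<Sum>i<n. e i k) = (\<Sum>j\<in>{i}. e j k)"
        using i by (intro sum.mono_neutral_right) auto
      then show ?thesis by (simp add: e_def)
    next
      case False
      then have "(\<Sum>i<n. e i k) = 0" by (intro sum.neutral) (auto simp: e_def)
      then show ?thesis by simp
    qed
    have "(\<Sum>i<n. outer_measure_of lborel (q i ` C i)) \<le> (\<Sum>i<n. \<Sum>k. e i k)"
      using 1 by (intro sum_mono) auto
    also have "\<dots> = (\<Sum>k. \<Sum>i<n. e i k)" by (rule suminf_sum[symmetric]) auto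
    also have "\<dots> \<le> (\<Sum>k. ennreal (diameter (U k)))" using 2 by (intro suminf_le) auto
    finally show "(\<Sum>i<n. outer_measure_of lborel (q i ` C i)) \<le> (\<Sum>k. ennreal (diameter (U k)))" .
  qed
  also have "\<dots> \<le> hausdorff1 A"
    unfolding hausdorff1_def by (rule SUP_upper) (use \<delta>(1) in simp)
  finally show ?thesis .
qed

lemma emeasure_chart_measure_finite:
  assumes "chart N \<alpha>"
  shows "emeasure (chart_measure N \<alpha>) A < \<infinity>"
proof -
  have c: "compact (\<alpha> ` N)" using assms unfolding chart_def by (intro compact_continuous_image) auto
  have "emeasure (chart_measure N \<alpha>) A \<le> emeasure (chart_measure N \<alpha>) UNIV"
    by (intro emeasure_mono) auto
  also have "\<dots> = emeasure lborel (\<alpha> ` N)" by (simp add: emeasure_chart_measure[OF assms])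
  also have "\<dots> < \<infinity>" by (rule emeasure_bounded_finite[OF compact_imp_bounded[OF c]])
  finally show ?thesis .
qed

text \<open>Fine covers split only over sets at positive distance. So the first \<open>n\<close>
  disjoint pieces are shrunk to compact subsets, by inner regularity of the chart measures, before
  \<open>sum_outer_measure_le_hausdorff1\<close> applies; the resulting bound does not depend on
  \<open>n\<close>.\<close>

lemma atlas_integral_one_le_hausdorff1:
  fixes q :: "nat \<Rightarrow> 'a::euclidean_space \<Rightarrow> real"
  assumes at: "atlas L N q"
    and lip: "\<And>i x y. x \<in> N i \<inter> L \<Longrightarrow> y \<in> N i \<inter> L \<Longrightarrow> \<bar>q i x - q i y\<bar> \<le> dist x y"
  shows "atlas_integral L N q (\<lambda>_. 1) \<le> hausdorff1 L"
proof -
  let ?\<mu> = "\<lambda>i. chart_measure (N i \<inter> L) (q i)"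
  have ch: "chart (N i \<inter> L) (q i)" for i using at by (simp add: atlas_def)
  have B: "disjointed N i \<in> sets borel" for i by (rule disjointed_borel[OF at])
  define E where "E i = disjointed N i \<inter> (N i \<inter> L)" for i
  have Eb: "E i \<in> sets borel" for i
    using B ch[of i] unfolding E_def chart_def by (intro sets.Int[OF B]) (auto intro: borel_compact)
  have eq: "(\<integral>\<^sup>+x. 1 * indicator (disjointed N i) x \<partial>?\<mu> i) = emeasure (?\<mu> i) (E i)" for i
  proof -
    have "(\<integral>\<^sup>+x. 1 * indicator (disjointed N i) x \<partial>?\<mu> i) = emeasure (?\<mu> i) (disjointed N i)"
      using B by simp
    also have "\<dots> = emeasure (?\<mu> i) (E i)"
    proof -
      have "N i \<inter> L \<inter> disjointed N i = N i \<inter> L \<inter> E i" by (auto simp: E_def)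
      then show ?thesis by (simp only: emeasure_chart_measure[OF ch B] emeasure_chart_measure[OF ch Eb])
    qed
    finally show ?thesis .
  qed
  have "(\<Sum>i<n. emeasure (?\<mu> i) (E i)) \<le> hausdorff1 L" for n
  proof (rule ennreal_le_epsilon)
    fix e :: real assume e: "e > 0"
    \<comment> \<open>The \<open>n\<close> errors e / Suc n add up to at most \<open>e\<close>;
      \<open>Suc\<close> also covers n = 0.\<close>
    have ex: "\<exists>C. compact C \<and> C \<subseteq> E i \<and> emeasure (?\<mu> i) (E i) \<le> emeasure (?\<mu> i) C + ennreal (e / Suc n)" for i
    proof -
      have fin: "emeasure (?\<mu> i) (E i) < \<infinity>" by (rule emeasure_chart_measure_finite[OF ch])
      have reg: "emeasure (?\<mu> i) (E i) = (SUP K\<in>{K. K \<subseteq> E i \<and> compact K}. emeasure (?\<mu> i) K)"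
        using emeasure_chart_measure_finite[OF ch, of i UNIV]
        by (intro inner_regular Eb) auto
      show ?thesis
      proof (cases "emeasure (?\<mu> i) (E i) = 0")
        case True
        then show ?thesis by (intro exI[of _ "{}"]) auto
      next
        case False
        then have "emeasure (?\<mu> i) (E i) - ennreal (e / Suc n) < emeasure (?\<mu> i) (E i)"
          using e fin by (intro ennreal_between) (auto simp: less_top zero_less_iff_neq_zero)
        then have "emeasure (?\<mu> i) (E i) - ennreal (e / Suc n) <
            (SUP K\<in>{K. K \<subseteq> E i \<and> compact K}. emeasure (?\<mu> i) K)"
          by (simp only: reg[symmetric])
        then obtain K where K: "K \<subseteq> E i" "compact K" "emeasure (?\<mu> i) (E i) - ennreal (e / Suc n) < emeasure (?\<mu> i) K"
          unfolding less_SUP_iff by blast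
        then show ?thesis using ennreal_minus_le_iff by (intro exI[of _ K]) (metis add.commute less_imp_le)
      qed
    qed
    then obtain C where C: "\<And>i. compact (C i)" "\<And>i. C i \<subseteq> E i"
      "\<And>i. emeasure (?\<mu> i) (E i) \<le> emeasure (?\<mu> i) (C i) + ennreal (e / Suc n)"
      by metis
    have Cb: "C i \<in> sets borel" for i using C(1) by (rule borel_compact)
    have "(\<Sum>i<n. emeasure (?\<mu> i) (E i)) \<le> (\<Sum>i<n. emeasure (?\<mu> i) (C i) + ennreal (e / Suc n))"
      using C(3) by (intro sum_mono) auto
    also have "\<dots> = (\<Sum>i<n. outer_measure_of lborel (q i ` C i)) + (\<Sum>i<n. ennreal (e / Suc n))"
    proof -
      have "emeasure (?\<mu> i) (C i) = outer_measure_of lborel (q i ` C i)" for i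
      proof -
        have "N i \<inter> L \<inter> C i = C i" using C(2)[of i] by (auto simp: E_def)
        then show ?thesis
          using emeasure_chart_measure[OF ch Cb, of i i] chart_image_Int_borel[OF ch Cb, of i i] by simp
      qed
      then show ?thesis by (simp add: sum.distrib)
    qed
    also have "\<dots> \<le> hausdorff1 L + ennreal e"
    proof (rule add_mono)
      show "(\<Sum>i<n. outer_measure_of lborel (q i ` C i)) \<le> hausdorff1 L"
      proof (rule sum_outer_measure_le_hausdorff1[OF C(1)])
        fix i j :: nat assume "i \<noteq> j"
        then have "disjointed N i \<inter> disjointed N j = {}"
          using disjoint_family_disjointed[of N] by (auto simp: disjoint_family_on_def)
        then show "C i \<inter> C j = {}" using C(2)[of i] C(2)[of j] by (auto simp: E_def)
      next
        fix i show "C i \<subseteq> L" using C(2)[of i] by (auto simp: E_def)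
      next
        fix i x y assume "x \<in> C i" "y \<in> C i"
        then show "\<bar>q i x - q i y\<bar> \<le> dist x y" using C(2)[of i] by (intro lip) (auto simp: E_def)
      qed
      have "(\<Sum>i<n. ennreal (e / Suc n)) = ennreal (\<Sum>i<n. e / Suc n)"
        using e by (intro sum_ennreal) auto
      also have "\<dots> \<le> ennreal e" using e by (intro ennreal_leI) (simp add: field_simps)
      finally show "(\<Sum>i<n. ennreal (e / Suc n)) \<le> ennreal e" .
    qed
    finally show "(\<Sum>i<n. emeasure (?\<mu> i) (E i)) \<le> hausdorff1 L + ennreal e" .
  qed
  then show ?thesis
    unfolding atlas_integral_def eq by (intro suminf_le_const) auto
qed

text \<open>The image of \<open>\<Gamma>\<close> is connected and contains the interval between the
  values at \<open>x\<close> and at a point where \<open>w\<close> is small. The value 0 is only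
  approached, because a leaf inside an open set meets the boundary in its closure alone.\<close>

lemma abs_le_outer_measure_image:
  fixes w :: "'a::euclidean_space \<Rightarrow> real"
  assumes "connected \<Gamma>" "continuous_on \<Gamma> w" "x \<in> \<Gamma>" and small: "\<And>e. e > 0 \<Longrightarrow> \<exists>y\<in>\<Gamma>. \<bar>w y\<bar> < e"
  shows "ennreal \<bar>w x\<bar> \<le> outer_measure_of lborel (w ` \<Gamma>)"
proof (rule ennreal_le_epsilon)
  fix e :: real assume e: "e > 0"
  obtain y where y: "y \<in> \<Gamma>" "\<bar>w y\<bar> < e" using small[OF e] by blast
  let ?a = "min (w x) (w y)" and ?b = "max (w x) (w y)"
  have "connected (w ` \<Gamma>)" using assms by (intro connected_continuous_image)
  then have "{?a..?b} \<subseteq> w ` \<Gamma>"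
    using assms(3) y(1) by (intro connected_contains_Icc) (auto simp: min_def max_def)
  then have "outer_measure_of lborel {?a..?b} \<le> outer_measure_of lborel (w ` \<Gamma>)"
    by (rule outer_measure_of_mono)
  moreover have "outer_measure_of lborel {?a..?b} = ennreal (?b - ?a)"
    by (subst outer_measure_of_eq) auto
  moreover have "ennreal \<bar>w x\<bar> \<le> ennreal (?b - ?a) + ennreal e"
  proof -
    have "\<bar>w x\<bar> \<le> (?b - ?a) + e" using y(2) by (auto simp: min_def max_def)
    then have "ennreal \<bar>w x\<bar> \<le> ennreal ((?b - ?a) + e)" by (rule ennreal_leI)
    also have "\<dots> = ennreal (?b - ?a) + ennreal e" using e by (intro ennreal_plus) auto
    finally show ?thesis .
  qed
  ultimately show "ennreal \<bar>w x\<bar> \<le> outer_measure_of lborel (w ` \<Gamma>) + ennreal e"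
    by (metis add_right_mono order_trans)
qed

text \<open>\<open>w ` \<Gamma>\<close> is an interval reaching down to 0, so \<open>\<bar>w x\<bar>\<close> is at most its length, which is summed
  over the pieces.\<close>

lemma abs_le_atlas_integral:
  fixes q :: "nat \<Rightarrow> 'a::euclidean_space \<Rightarrow> real" and w :: "'a \<Rightarrow> real"
  assumes at: "atlas L N q" and \<Gamma>: "connected \<Gamma>" "continuous_on \<Gamma> w" "x \<in> \<Gamma>" "\<Gamma> \<subseteq> L"
    and small: "\<And>e. e > 0 \<Longrightarrow> \<exists>y\<in>\<Gamma>. \<bar>w y\<bar> < e"
    and C: "C > 0" and \<kappa>: "\<And>i. \<kappa> i > 0"
    and lip: "\<And>i x y. x \<in> N i \<inter> L \<Longrightarrow> y \<in> N i \<inter> L \<Longrightarrow> \<bar>w x - w y\<bar> \<le> C * \<kappa> i * \<bar>q i x - q i y\<bar>"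
    and D: "\<And>i x. x \<in> N i \<inter> L \<Longrightarrow> ennreal (\<kappa> i) \<le> D x" "D \<in> borel_measurable borel"
  shows "ennreal \<bar>w x\<bar> \<le> ennreal (2 * C) * atlas_integral L N q D"
proof -
  let ?\<mu> = "\<lambda>i. chart_measure (N i \<inter> L) (q i)"
  let ?E = "\<lambda>i. N i \<inter> L \<inter> disjointed N i"
  have ch: "chart (N i \<inter> L) (q i)" for i using at by (simp add: atlas_def)
  have B: "disjointed N i \<in> sets borel" for i by (rule disjointed_borel[OF at])
  have "ennreal \<bar>w x\<bar> \<le> outer_measure_of lborel (w ` \<Gamma>)"
    by (rule abs_le_outer_measure_image[OF \<Gamma>(1-3) small])
  also have "\<dots> \<le> outer_measure_of lborel (\<Union>i. w ` ?E i)"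
  proof (rule outer_measure_of_mono)
    have "L \<subseteq> (\<Union>i. ?E i)"
    proof
      fix z assume z: "z \<in> L"
      then have "z \<in> (\<Union>i. disjointed N i)" using at by (auto simp: atlas_def UN_disjointed_eq)
      then obtain i where "z \<in> disjointed N i" by blast
      then show "z \<in> (\<Union>i. ?E i)" using disjointed_subset[of N i] z by blast
    qed
    then show "w ` \<Gamma> \<subseteq> (\<Union>i. w ` ?E i)" using \<Gamma>(4) by blast
  qed
  also have "\<dots> \<le> (\<Sum>i. outer_measure_of lborel (w ` ?E i))" by (rule outer_measure_of_UN_le)
  also have "\<dots> \<le> (\<Sum>i. ennreal (2 * C) * (\<integral>\<^sup>+x. D x * indicator (disjointed N i) x \<partial>?\<mu> i))"
  proof (intro suminf_le summableI)
    fix i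
    let ?f = "\<lambda>z. w (inv_into (N i \<inter> L) (q i) z)"
    have inj: "inj_on (q i) (N i \<inter> L)" using ch[of i] by (simp add: chart_def)
    have im: "w ` ?E i = ?f ` (q i ` ?E i)"
      using inj by (force simp: image_image inv_into_f_f)
    have "outer_measure_of lborel (?f ` (q i ` ?E i)) \<le>
       ennreal ((2 * (C * \<kappa> i) * DIM(real)) ^ DIM(real)) * outer_measure_of lborel (q i ` ?E i)"
    proof (rule lipschitz_outer_measure_le)
      have "compact (q i ` (N i \<inter> L))"
        using ch[of i] unfolding chart_def by (intro compact_continuous_image) auto
      then show "bounded (q i ` ?E i)" by (rule bounded_subset[OF compact_imp_bounded]) auto
      show "C * \<kappa> i > 0" using C \<kappa> by simp
      fix s t assume "s \<in> q i ` ?E i" "t \<in> q i ` ?E i"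
      then obtain y z where "y \<in> ?E i" "z \<in> ?E i" "s = q i y" "t = q i z" by blast
      then show "dist (?f s) (?f t) \<le> C * \<kappa> i * dist s t"
        using lip[of y i z] inj by (simp add: dist_real_def inv_into_f_f)
    qed simp
    also have "outer_measure_of lborel (q i ` ?E i) = emeasure (?\<mu> i) (disjointed N i)"
      using emeasure_chart_measure[OF ch B] chart_image_Int_borel[OF ch B] by simp
    \<comment> \<open>In dimension one the distortion of a map with Lipschitz constant C * \<kappa>
      i is twice that constant; hence the factor 2 * C in the statement.\<close>
    also have "ennreal ((2 * (C * \<kappa> i) * DIM(real)) ^ DIM(real)) = ennreal (2 * C) * ennreal (\<kappa> i)"
      using C \<kappa>[of i] by (simp add: ennreal_mult[symmetric] mult.assoc)
    also have "ennreal (2 * C) * ennreal (\<kappa> i) * emeasure (?\<mu> i) (disjointed N i) =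
        ennreal (2 * C) * (\<integral>\<^sup>+x. ennreal (\<kappa> i) * indicator (disjointed N i) x \<partial>?\<mu> i)"
      using B by (simp add: mult.assoc nn_integral_cmult)
    also have "\<dots> \<le> ennreal (2 * C) * (\<integral>\<^sup>+x. D x * indicator (disjointed N i) x \<partial>?\<mu> i)"
    proof (intro mult_left_mono nn_integral_mono_AE)
      show "AE x in ?\<mu> i. ennreal (\<kappa> i) * indicator (disjointed N i) x \<le> D x * indicator (disjointed N i) x"
        using AE_chart_measure[OF ch] by eventually_elim (auto intro!: mult_right_mono D(1))
    qed simp
    finally show "outer_measure_of lborel (w ` ?E i) \<le>
       ennreal (2 * C) * (\<integral>\<^sup>+x. D x * indicator (disjointed N i) x \<partial>?\<mu> i)"
      by (simp add: im)
  qed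
  finally show ?thesis by (simp add: atlas_integral_def)
qed

lemma atlas_integral_le_const:
  assumes at: "atlas L N q" and h: "\<And>x. x \<in> L \<Longrightarrow> h x \<le> A"
  shows "atlas_integral L N q h \<le> A * atlas_integral L N q (\<lambda>_. 1)"
proof -
  have ch: "chart (N i \<inter> L) (q i)" for i using at by (simp add: atlas_def)
  have B: "disjointed N i \<in> sets borel" for i by (rule disjointed_borel[OF at])
  have "(\<integral>\<^sup>+x. h x * indicator (disjointed N i) x \<partial>chart_measure (N i \<inter> L) (q i)) \<le>
     A * (\<integral>\<^sup>+x. 1 * indicator (disjointed N i) x \<partial>chart_measure (N i \<inter> L) (q i))" for i
  proof -
    have "(\<integral>\<^sup>+x. h x * indicator (disjointed N i) x \<partial>chart_measure (N i \<inter> L) (q i)) \<le>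
       (\<integral>\<^sup>+x. A * indicator (disjointed N i) x \<partial>chart_measure (N i \<inter> L) (q i))"
    proof (rule nn_integral_mono_AE)
      show "AE x in chart_measure (N i \<inter> L) (q i).
        h x * indicator (disjointed N i) x \<le> A * indicator (disjointed N i) x"
        using AE_chart_measure[OF ch] by eventually_elim (auto intro!: mult_right_mono h)
    qed
    then show ?thesis using B by (simp add: nn_integral_cmult)
  qed
  then have "atlas_integral L N q h \<le> (\<Sum>i. A * (\<integral>\<^sup>+x. 1 * indicator (disjointed N i) x \<partial>chart_measure (N i \<inter> L) (q i)))"
    unfolding atlas_integral_def by (intro suminf_le) auto
  then show ?thesis by (simp add: atlas_integral_def)
qed

section \<open>Level surfaces of continuously differentiable functions\<close>

lemma grad_unique:
  fixes f :: "'a::euclidean_space \<Rightarrow> real"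
  assumes "(f has_derivative (\<lambda>h. h \<bullet> D)) (at x)"
  shows "grad f x = D"
  unfolding grad_def
proof (rule the_equality)
  show "GDERIV f x :> D" using assms by (simp add: gderiv_def)
  fix E assume "GDERIV f x :> E"
  then have "(\<lambda>h. h \<bullet> E) = (\<lambda>h. h \<bullet> D)"
    unfolding gderiv_def by (rule has_derivative_unique[OF _ assms])
  then have "(E - D) \<bullet> E = (E - D) \<bullet> D" by metis
  then have "(E - D) \<bullet> (E - D) = 0" by (simp add: inner_diff_right)
  then show "E = D" by simp
qed

lemma has_derivative_grad:
  fixes f :: "'a::euclidean_space \<Rightarrow> real"
  assumes "f differentiable (at x)"
  shows "(f has_derivative (\<lambda>h. h \<bullet> grad f x)) (at x)"
proof -
  obtain f' where f': "(f has_derivative f') (at x)" using assms differentiable_def by blast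
  then interpret bounded_linear f' by (rule has_derivative_bounded_linear)
  define D where "D = (\<Sum>b\<in>Basis. f' b *\<^sub>R b)"
  have "f' h = h \<bullet> D" for h
  proof -
    have "f' h = f' (\<Sum>b\<in>Basis. (h \<bullet> b) *\<^sub>R b)" by (simp add: euclidean_representation)
    also have "\<dots> = (\<Sum>b\<in>Basis. (h \<bullet> b) * f' b)" by (simp add: sum scaleR)
    also have "\<dots> = h \<bullet> D" by (simp add: D_def inner_sum_right mult.commute)
    finally show ?thesis .
  qed
  then have D: "(f has_derivative (\<lambda>h. h \<bullet> D)) (at x)" using f' by presburger
  then show ?thesis using grad_unique[OF D] by simp
qed

lemma C1_on_has_derivative:
  assumes "C1_on \<Omega> f" "x \<in> \<Omega>"
  shows "(f has_derivative (\<lambda>h. h \<bullet> grad f x)) (at x)"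
  using assms has_derivative_grad unfolding C1_on_def by blast

lemma C1_on_imp_continuous_on: "C1_on \<Omega> f \<Longrightarrow> continuous_on \<Omega> f"
  by (meson C1_on_has_derivative continuous_at_imp_continuous_on has_derivative_continuous)

text \<open>Mean value inequality for \<open>v\<close> minus its linear part at \<open>z\<close>, on
  a ball where the gradient varies by at most \<eta>. This two-point form, unlike differentiability
  at \<open>z\<close>, yields Lipschitz bounds for coordinates in both directions.\<close>

lemma C1_on_strict_differentiable:
  fixes v :: "'a::euclidean_space \<Rightarrow> real"
  assumes "open \<Omega>" and C1: "C1_on \<Omega> v" and z: "z \<in> \<Omega>" and \<eta>: "\<eta> > 0"
  shows "\<exists>\<rho>>0. cball z \<rho> \<subseteq> \<Omega> \<and>
    (\<forall>x\<in>cball z \<rho>. \<forall>y\<in>cball z \<rho>. \<bar>v x - v y - (x - y) \<bullet> grad v z\<bar> \<le> \<eta> * norm (x - y))"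
proof -
  obtain r where r: "r > 0" "cball z r \<subseteq> \<Omega>" using assms open_contains_cball by blast
  have "continuous_on \<Omega> (grad v)" using C1 by (simp add: C1_on_def)
  then obtain d where d: "d > 0" "\<And>x. x \<in> \<Omega> \<Longrightarrow> dist x z < d \<Longrightarrow> dist (grad v x) (grad v z) < \<eta>"
    using z \<eta> unfolding continuous_on_iff by blast
  define \<rho> where "\<rho> = min r (d / 2)"
  have \<rho>: "\<rho> > 0" "cball z \<rho> \<subseteq> \<Omega>" using r d by (auto simp: \<rho>_def)
  have cl: "norm (grad v x - grad v z) \<le> \<eta>" if "x \<in> cball z \<rho>" for x
  proof -
    have "dist x z < d" using that d(1) by (auto simp: \<rho>_def dist_commute)
    then show ?thesis using d(2)[of x] \<rho>(2) that by (auto simp: dist_norm)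
  qed
  have "\<bar>v x - v y - (x - y) \<bullet> grad v z\<bar> \<le> \<eta> * norm (x - y)"
    if xy: "x \<in> cball z \<rho>" "y \<in> cball z \<rho>" for x y
  proof -
    let ?f = "\<lambda>x. v x - x \<bullet> grad v z"
    have "norm (?f x - ?f y) \<le> \<eta> * norm (x - y)"
    proof (rule differentiable_bound[OF convex_cball _ _ xy(1) xy(2)])
      fix u assume u: "u \<in> cball z \<rho>"
      have "(v has_derivative (\<lambda>h. h \<bullet> grad v u)) (at u within cball z \<rho>)"
        using C1_on_has_derivative[OF C1] u \<rho>(2) has_derivative_at_withinI by blast
      then have "(?f has_derivative (\<lambda>h. h \<bullet> grad v u - h \<bullet> grad v z)) (at u within cball z \<rho>)"
        by (auto intro!: derivative_eq_intros)
      then show "(?f has_derivative (\<lambda>h. h \<bullet> (grad v u - grad v z))) (at u within cball z \<rho>)"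
        by (simp add: inner_diff_right)
      show "onorm (\<lambda>h. h \<bullet> (grad v u - grad v z)) \<le> \<eta>"
      proof (rule onorm_bound)
        fix h
        have "norm (h \<bullet> (grad v u - grad v z)) \<le> norm h * norm (grad v u - grad v z)"
          using Cauchy_Schwarz_ineq2 by simp
        also have "\<dots> \<le> norm h * \<eta>" using cl[OF u] by (intro mult_left_mono) auto
        finally show "norm (h \<bullet> (grad v u - grad v z)) \<le> \<eta> * norm h" by (simp add: mult.commute)
      qed (use \<eta> in simp)
    qed
    then show ?thesis by (simp add: inner_diff_left algebra_simps)
  qed
  then show ?thesis using \<rho> by blast
qed

text \<open>The chord from \<open>x\<close> to \<open>y\<close> is pushed into the level set along the gradient at \<open>z\<close>. Any solution
  of the scalar equation will do, since the level set is almost orthogonal to that direction.\<close>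

lemma level_set_path:
  fixes v :: "'a::euclidean_space \<Rightarrow> real"
  assumes G: "G \<noteq> 0" and cont: "continuous_on (cball z \<rho>) v"
    and strict: "\<And>x y. x \<in> cball z \<rho> \<Longrightarrow> y \<in> cball z \<rho> \<Longrightarrow>
      \<bar>v x - v y - (x - y) \<bullet> G\<bar> \<le> norm G / 4 * norm (x - y)"
    and xy: "x \<in> cball z (\<rho> / 4)" "y \<in> cball z (\<rho> / 4)" "v x = t" "v y = t"
  shows "\<exists>\<gamma> :: real \<Rightarrow> 'a. \<gamma> 0 = x \<and> \<gamma> 1 = y \<and> (\<forall>s\<in>{0..1}. \<gamma> s \<in> cball z \<rho> \<and> v (\<gamma> s) = t) \<and>
     (\<forall>s\<in>{0..1}. \<forall>s'\<in>{0..1}. norm (\<gamma> s - \<gamma> s') \<le> 2 * norm (x - y) * \<bar>s - s'\<bar>)"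
proof -
  define c where "c = norm G"
  define n where "n = G /\<^sub>R c"
  define d where "d = y - x"
  have c: "c > 0" using G by (simp add: c_def)
  have nn: "norm n = 1" and nG: "n \<bullet> G = c"
    using c by (auto simp: n_def c_def power2_norm_eq_inner[symmetric] power2_eq_square)
  have xyr: "x \<in> cball z \<rho>" "y \<in> cball z \<rho>" using xy by (auto intro: order_trans[of _ "\<rho> / 4"] simp: mem_cball) (smt (verit) zero_le_dist)+
  have dr: "norm d \<le> \<rho> / 2"
    using xy norm_triangle_ineq4[of "y - z" "x - z"] by (simp add: d_def dist_norm norm_minus_commute)
  have dG: "\<bar>d \<bullet> G\<bar> \<le> c / 4 * norm d"
    using strict[OF xyr(2) xyr(1)] xy(3,4) by (simp add: d_def c_def)
  define p where "p s = x + s *\<^sub>R d" for s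
  have p: "p s \<in> cball z (\<rho> / 4)" if "s \<in> {0..1}" for s
  proof -
    have "p s = (1 - s) *\<^sub>R x + s *\<^sub>R y" by (simp add: p_def d_def algebra_simps)
    then show ?thesis using convexD_alt[OF convex_cball xy(1,2)] that by simp
  qed
  have pin: "p s + h *\<^sub>R n \<in> cball z \<rho>" if "s \<in> {0..1}" "\<bar>h\<bar> \<le> norm d" for s h
  proof -
    have "dist z (p s + h *\<^sub>R n) \<le> dist z (p s) + norm (h *\<^sub>R n)"
      by (metis add_diff_cancel_left' dist_norm dist_triangle norm_minus_commute)
    also have "\<dots> \<le> \<rho> / 4 + \<rho> / 2" using p[OF that(1)] that(2) dr nn by (intro add_mono) auto
    also have "\<dots> \<le> \<rho>" using dr norm_ge_zero[of d] by linarith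
    finally show ?thesis by simp
  qed
  \<comment> \<open>Moving by norm d along \<open>n\<close> changes \<open>v\<close> by about c *
    norm d, which outweighs the error c / 4 * norm d together with the deviation c / 2 * norm d on
    the chord; the intermediate value theorem then gives a root.\<close>
  have ex: "\<exists>h. \<bar>h\<bar> \<le> norm d \<and> v (p s + h *\<^sub>R n) = t" if s: "s \<in> {0..1}" for s
  proof -
    have ps: "p s \<in> cball z \<rho>" using pin[OF s, of 0] by simp
    have sd: "\<bar>s * (d \<bullet> G)\<bar> \<le> c / 4 * norm d" "norm (s *\<^sub>R d) \<le> norm d"
      using s dG mult_left_le_one_le[of "norm d" s] mult_left_le_one_le[of "\<bar>d \<bullet> G\<bar>" s] by (auto simp: abs_mult)
    have "\<bar>v (p s) - v x - (p s - x) \<bullet> G\<bar> \<le> c / 4 * norm (p s - x)"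
      using strict[OF ps xyr(1)] by (simp add: c_def)
    also have "\<dots> \<le> c / 4 * norm d" using sd(2) c by (simp add: p_def)
    finally have "\<bar>v (p s) - v x - (p s - x) \<bullet> G\<bar> \<le> c / 4 * norm d" .
    moreover have "(p s - x) \<bullet> G = s * (d \<bullet> G)" by (simp add: p_def)
    moreover have "c / 2 * norm d = 2 * (c / 4 * norm d)" by simp
    ultimately have vp: "\<bar>v (p s) - t\<bar> \<le> c / 2 * norm d" using sd(1) xy(3) by linarith
    let ?k = "\<lambda>h. v (p s + h *\<^sub>R n)"
    have e1: "\<bar>?k h - v (p s) - h * c\<bar> \<le> c / 4 * norm d" if "\<bar>h\<bar> = norm d" for h
      using strict[OF pin[OF s, of h] ps] that nn nG by (simp add: c_def)
    have "\<exists>h\<ge>- norm d. h \<le> norm d \<and> ?k h = t"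
    proof (rule IVT')
      define m where "m = c * norm d"
      have m: "c / 4 * norm d = m / 4" "c / 2 * norm d = m / 2" "norm d * c = m" "- norm d * c = - m"
        by (simp_all add: m_def)
      have "m \<ge> 0" using c by (simp add: m_def)
      moreover have "\<bar>?k (- norm d) - v (p s) - - m\<bar> \<le> m / 4" "\<bar>?k (norm d) - v (p s) - m\<bar> \<le> m / 4"
        using e1[of "- norm d"] e1[of "norm d"] unfolding m by simp_all
      ultimately show "?k (- norm d) \<le> t" and "t \<le> ?k (norm d)"
        using vp unfolding m by linarith+
      show "- norm d \<le> norm d" by simp
      have "continuous_on {- norm d..norm d} (\<lambda>h. p s + h *\<^sub>R n)" by (intro continuous_intros)
      moreover have "(\<lambda>h. p s + h *\<^sub>R n) ` {- norm d..norm d} \<subseteq> cball z \<rho>" using pin[OF s] by auto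
      ultimately show "continuous_on {- norm d..norm d} ?k"
        using continuous_on_compose2[OF cont] by blast
    qed
    then show ?thesis by (metis abs_le_iff minus_le_iff)
  qed
  then obtain h0 where h0: "\<And>s. s \<in> {0..1} \<Longrightarrow> \<bar>h0 s\<bar> \<le> norm d \<and> v (p s + h0 s *\<^sub>R n) = t" by metis
  \<comment> \<open>The chosen roots are overridden by 0 at both ends, so that the path runs exactly
    from \<open>x\<close> to \<open>y\<close>.\<close>
  define h where "h s = (if s = 0 \<or> s = 1 then 0 else h0 s)" for s
  define \<gamma> where "\<gamma> s = p s + h s *\<^sub>R n" for s
  have \<gamma>01: "\<gamma> 0 = x" "\<gamma> 1 = y" by (simp_all add: \<gamma>_def h_def p_def d_def)
  have hs: "\<bar>h s\<bar> \<le> norm d" if "s \<in> {0..1}" for s using h0[OF that] by (auto simp: h_def)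
  have \<gamma>t: "v (\<gamma> s) = t" if "s \<in> {0..1}" for s
    using h0[OF that] \<gamma>01 xy(3,4) by (cases "s = 0 \<or> s = 1") (auto simp: \<gamma>_def h_def)
  have \<gamma>in: "\<gamma> s \<in> cball z \<rho>" if "s \<in> {0..1}" for s
    unfolding \<gamma>_def by (rule pin[OF that hs[OF that]])
  \<comment> \<open>Both points lie on the level set, so their difference is almost orthogonal to
    \<open>G\<close>. This bounds the increment of \<open>h\<close> by that along the chord,
    although the roots were chosen arbitrarily.\<close>
  have lip: "norm (\<gamma> s - \<gamma> s') \<le> 2 * norm (x - y) * \<bar>s - s'\<bar>" if s: "s \<in> {0..1}" "s' \<in> {0..1}" for s s'
  proof -
    define a where "a = \<bar>s - s'\<bar> * norm d"
    define b where "b = \<bar>h s - h s'\<bar>"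
    have dif: "\<gamma> s - \<gamma> s' = (s - s') *\<^sub>R d + (h s - h s') *\<^sub>R n" by (simp add: \<gamma>_def p_def algebra_simps)
    have nle: "norm (\<gamma> s - \<gamma> s') \<le> a + b"
      unfolding dif a_def b_def using norm_triangle_ineq[of "(s - s') *\<^sub>R d" "(h s - h s') *\<^sub>R n"] nn by simp
    have "\<bar>(\<gamma> s - \<gamma> s') \<bullet> G\<bar> \<le> c / 4 * norm (\<gamma> s - \<gamma> s')"
      using strict[OF \<gamma>in[OF s(1)] \<gamma>in[OF s(2)]] \<gamma>t s by (simp add: c_def)
    also have "\<dots> \<le> c / 4 * (a + b)" using nle c by (intro mult_left_mono) auto
    finally have 1: "\<bar>(s - s') * (d \<bullet> G) + (h s - h s') * c\<bar> \<le> c / 4 * (a + b)"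
      by (simp add: dif inner_add_left nG)
    have "\<bar>(s - s') * (d \<bullet> G)\<bar> \<le> \<bar>s - s'\<bar> * (c / 4 * norm d)"
      unfolding abs_mult using dG by (intro mult_left_mono) auto
    then have 2: "\<bar>(s - s') * (d \<bullet> G)\<bar> \<le> c / 4 * a" by (simp add: a_def mult_ac)
    have "\<bar>(h s - h s') * c\<bar> = b * c" using c by (simp add: b_def abs_mult)
    with 1 2 have "b * c \<le> c / 4 * a + c / 4 * (a + b)" by linarith
    moreover have "c * (3 / 4 * b) = 3 / 4 * (b * c)" "c * (a / 2) = 2 * (c / 4 * a)"
      "c / 4 * (a + b) = c / 4 * a + (b * c) / 4"
      by (simp_all add: field_simps)
    ultimately have "c * (3 / 4 * b) \<le> c * (a / 2)" by linarith
    then have "3 / 4 * b \<le> a / 2" using c by simp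
    moreover have "a \<ge> 0" by (simp add: a_def)
    ultimately have "norm (\<gamma> s - \<gamma> s') \<le> 2 * a" using nle by linarith
    then show ?thesis by (simp add: a_def d_def norm_minus_commute mult_ac)
  qed
  show ?thesis using \<gamma>01 \<gamma>t \<gamma>in lip by (intro exI[of _ \<gamma>]) auto
qed

text \<open>\<open>g\<close> is differentiable only along the surface, which the segment from
  \<open>x\<close> to \<open>y\<close> leaves. The mean value argument is therefore run along the
  Lipschitz path that \<open>level_set_path\<close> provides inside the surface.\<close>

lemma surface_strict_differentiable:
  fixes v g :: "'a::euclidean_space \<Rightarrow> real"
  assumes op: "open \<Omega>" and C1: "C1_on \<Omega> v" and z: "z \<in> \<Omega>" "v z = t" and G: "grad v z \<noteq> 0"
    and \<xi>: "continuous_on {x\<in>\<Omega>. v x = t} \<xi>"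
    and g: "\<And>x. x \<in> {x\<in>\<Omega>. v x = t} \<Longrightarrow>
      (g has_derivative (\<lambda>h. \<xi> x \<bullet> h)) (at x within {x\<in>\<Omega>. v x = t})"
    and \<eta>: "\<eta> > 0"
  shows "\<exists>\<rho>>0. cball z \<rho> \<subseteq> \<Omega> \<and> (\<forall>x\<in>cball z \<rho>. \<forall>y\<in>cball z \<rho>. v x = t \<longrightarrow> v y = t \<longrightarrow>
     \<bar>g x - g y - \<xi> z \<bullet> (x - y)\<bar> \<le> \<eta> * norm (x - y))"
proof -
  let ?S = "{x\<in>\<Omega>. v x = t}"
  have zS: "z \<in> ?S" using z by simp
  obtain r1 where r1: "r1 > 0" "cball z r1 \<subseteq> \<Omega>" "\<And>x y. x \<in> cball z r1 \<Longrightarrow> y \<in> cball z r1 \<Longrightarrow>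
      \<bar>v x - v y - (x - y) \<bullet> grad v z\<bar> \<le> norm (grad v z) / 4 * norm (x - y)"
    using C1_on_strict_differentiable[OF op C1 z(1), of "norm (grad v z) / 4"] G by auto
  obtain r2 where r2: "r2 > 0" "\<And>x. x \<in> ?S \<Longrightarrow> dist x z < r2 \<Longrightarrow> dist (\<xi> x) (\<xi> z) < \<eta> / 4"
  proof -
    have "\<eta> / 4 > 0" using \<eta> by simp
    moreover have "\<forall>e>0. \<exists>d>0. \<forall>x\<in>?S. dist x z < d \<longrightarrow> dist (\<xi> x) (\<xi> z) < e"
      using \<xi> zS unfolding continuous_on_iff by (rule bspec)
    ultimately show ?thesis using that by metis
  qed
  define r where "r = min r1 (r2 / 2)"
  have r: "r > 0" "r \<le> r1" "r < r2" using r1 r2 by (auto simp: r_def)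
  have rs: "cball z r \<subseteq> cball z r1" using r by (intro subset_cball) auto
  have cont: "continuous_on (cball z r) v"
    using C1_on_imp_continuous_on[OF C1] continuous_on_subset rs r1(2) by blast
  have "\<bar>g x - g y - \<xi> z \<bullet> (x - y)\<bar> \<le> \<eta> * norm (x - y)"
    if xy: "x \<in> cball z (r / 4)" "y \<in> cball z (r / 4)" "v x = t" "v y = t" for x y
  proof -
    obtain \<gamma> :: "real \<Rightarrow> 'a" where \<gamma>: "\<gamma> 0 = x" "\<gamma> 1 = y"
      "\<And>s. s \<in> {0..1} \<Longrightarrow> \<gamma> s \<in> cball z r" "\<And>s. s \<in> {0..1} \<Longrightarrow> v (\<gamma> s) = t"
      "\<And>s s'. s \<in> {0..1} \<Longrightarrow> s' \<in> {0..1} \<Longrightarrow> norm (\<gamma> s - \<gamma> s') \<le> 2 * norm (x - y) * \<bar>s - s'\<bar>"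
    proof -
      have "\<bar>v x - v y - (x - y) \<bullet> grad v z\<bar> \<le> norm (grad v z) / 4 * norm (x - y)"
        if "x \<in> cball z r" "y \<in> cball z r" for x y
        using r1(3)[of x y] that rs by blast
      from level_set_path[OF G cont this xy] show ?thesis using that by blast
    qed
    have \<gamma>S: "\<gamma> s \<in> ?S" if "s \<in> {0..1}" for s using \<gamma>(3,4)[OF that] rs r1(2) by blast
    define \<phi> where "\<phi> s = g (\<gamma> s) - \<xi> z \<bullet> \<gamma> s" for s
    define l where "l = \<eta> * norm (x - y)"
    have l: "l \<ge> 0" using \<eta> by (simp add: l_def)
    \<comment> \<open>Pointwise the slope \<eta> / 2 is reached, a quarter of \<eta> for
      differentiability and a quarter for the variation of \<xi>; the path has Lipschitz constant 2
      * norm (x - y), which gives \<open>l\<close>.\<close>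
    have loc: "\<exists>d>0. \<forall>s'\<in>{0..1}. \<bar>s' - s\<bar> < d \<longrightarrow> \<bar>\<phi> s' - \<phi> s\<bar> \<le> l * \<bar>s' - s\<bar>"
      if s: "s \<in> {0..1}" for s
    proof -
      obtain \<delta> where \<delta>: "\<delta> > 0" "\<And>u. u \<in> ?S \<Longrightarrow> norm (u - \<gamma> s) < \<delta> \<Longrightarrow>
          norm (g u - g (\<gamma> s) - \<xi> (\<gamma> s) \<bullet> (u - \<gamma> s)) \<le> \<eta> / 4 * norm (u - \<gamma> s)"
      proof -
        have "\<forall>e>0. \<exists>d>0. \<forall>u\<in>?S. norm (u - \<gamma> s) < d \<longrightarrow>
            norm (g u - g (\<gamma> s) - \<xi> (\<gamma> s) \<bullet> (u - \<gamma> s)) \<le> e * norm (u - \<gamma> s)"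
          using g[OF \<gamma>S[OF s]] unfolding has_derivative_within_alt by (rule conjunct2)
        moreover have "\<eta> / 4 > 0" using \<eta> by simp
        ultimately show ?thesis using that by metis
      qed
      have "\<bar>\<phi> s' - \<phi> s\<bar> \<le> l * \<bar>s' - s\<bar>"
        if s': "s' \<in> {0..1}" "\<bar>s' - s\<bar> < \<delta> / (2 * norm (x - y) + 1)" for s'
      proof -
        let ?u = "\<gamma> s' - \<gamma> s"
        have u: "norm ?u \<le> 2 * norm (x - y) * \<bar>s' - s\<bar>" by (rule \<gamma>(5)[OF s'(1) s])
        also have "\<dots> \<le> (2 * norm (x - y) + 1) * \<bar>s' - s\<bar>" by (intro mult_right_mono) auto
        also have "\<dots> < \<delta>" using s'(2) by (simp add: pos_less_divide_eq add_nonneg_pos mult.commute)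
        finally have "norm ?u < \<delta>" .
        then have 1: "\<bar>g (\<gamma> s') - g (\<gamma> s) - \<xi> (\<gamma> s) \<bullet> ?u\<bar> \<le> \<eta> / 4 * norm ?u"
          using \<delta>(2)[OF \<gamma>S[OF s'(1)]] by simp
        have "dist (\<gamma> s) z < r2" using \<gamma>(3)[OF s] r by (auto simp: dist_commute)
        then have "norm (\<xi> (\<gamma> s) - \<xi> z) \<le> \<eta> / 4" using r2(2)[OF \<gamma>S[OF s]] by (simp add: dist_norm)
        then have "norm (\<xi> (\<gamma> s) - \<xi> z) * norm ?u \<le> \<eta> / 4 * norm ?u" by (intro mult_right_mono) auto
        then have 2: "\<bar>(\<xi> (\<gamma> s) - \<xi> z) \<bullet> ?u\<bar> \<le> \<eta> / 4 * norm ?u"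
          using Cauchy_Schwarz_ineq2 order_trans by blast
        have "\<phi> s' - \<phi> s = (g (\<gamma> s') - g (\<gamma> s) - \<xi> (\<gamma> s) \<bullet> ?u) + (\<xi> (\<gamma> s) - \<xi> z) \<bullet> ?u"
          by (simp add: \<phi>_def inner_diff_left inner_diff_right)
        then have "\<bar>\<phi> s' - \<phi> s\<bar> \<le> \<eta> / 2 * norm ?u" using 1 2 by linarith
        also have "\<dots> \<le> \<eta> / 2 * (2 * norm (x - y) * \<bar>s' - s\<bar>)" using u \<eta> by (intro mult_left_mono) auto
        finally show ?thesis by (simp add: l_def)
      qed
      moreover have "\<delta> / (2 * norm (x - y) + 1) > 0" using \<delta>(1) by (simp add: add_nonneg_pos)
      ultimately show ?thesis by blast
    qed
    \<comment> \<open>The path need not be differentiable, so the local bounds are joined by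
      bisection: \<open>P\<close> is additive over adjacent intervals and holds on every short
      interval around a point.\<close>
    define P where "P a b \<longleftrightarrow> (0 \<le> a \<longrightarrow> b \<le> 1 \<longrightarrow> \<bar>\<phi> b - \<phi> a\<bar> \<le> l * (b - a))" for a b :: real
    have "P 0 1"
    proof (rule Bolzano[of 0 1 P])
      fix a b c :: real assume "P a b" "P b c" "a \<le> b" "b \<le> c"
      then show "P a c" unfolding P_def by (auto simp: algebra_simps)
    next
      fix s :: real assume "0 \<le> s" "s \<le> 1"
      then obtain d where d: "d > 0" "\<And>s'. s' \<in> {0..1} \<Longrightarrow> \<bar>s' - s\<bar> < d \<Longrightarrow> \<bar>\<phi> s' - \<phi> s\<bar> \<le> l * \<bar>s' - s\<bar>"
        using loc[of s] by auto
      have "P a b" if "a \<le> s" "s \<le> b" "b - a < d" for a b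
        unfolding P_def
      proof (intro impI)
        assume "0 \<le> a" "b \<le> 1"
        then have "a \<in> {0..1}" "\<bar>a - s\<bar> < d" "b \<in> {0..1}" "\<bar>b - s\<bar> < d"
          "\<bar>a - s\<bar> = s - a" "\<bar>b - s\<bar> = b - s"
          using that by simp_all
        then have "\<bar>\<phi> a - \<phi> s\<bar> \<le> l * (s - a)" "\<bar>\<phi> b - \<phi> s\<bar> \<le> l * (b - s)"
          using d(2)[of a] d(2)[of b] by simp_all
        moreover have "l * (b - a) = l * (s - a) + l * (b - s)" by (simp add: algebra_simps)
        ultimately show "\<bar>\<phi> b - \<phi> a\<bar> \<le> l * (b - a)" by linarith
      qed
      then show "\<exists>d>0. \<forall>a b. a \<le> s \<and> s \<le> b \<and> b - a < d \<longrightarrow> P a b" using d(1) by blast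
    qed simp
    then have "\<bar>\<phi> 1 - \<phi> 0\<bar> \<le> l" by (simp add: P_def)
    then show ?thesis by (simp add: \<phi>_def \<gamma>(1,2) l_def inner_diff_right abs_le_iff algebra_simps)
  qed
  moreover have "cball z (r / 4) \<subseteq> \<Omega>" using r rs r1(2) subset_cball[of "r / 4" r z] by auto
  ultimately show ?thesis using r(1) by (intro exI[of _ "r / 4"]) auto
qed

section \<open>Bi-Lipschitz coordinates adapted to levels and leaves\<close>

text \<open>Orthogonal projection onto the complement of \<open>G\<close>; for G = 0 the convention
  on division makes it the identity.\<close>

definition tangential :: "'a::real_inner \<Rightarrow> 'a \<Rightarrow> 'a" where
  "tangential G b = b - ((b \<bullet> G) / (norm G)\<^sup>2) *\<^sub>R G"

text \<open>Lagrange's identity expands \<open>cross3 x (cross3 n e)\<close> in the orthonormal pair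
  \<open>n\<close>, \<open>e\<close>; its squared norm and the square of
  \<open>x \<bullet> cross3 n e\<close> add up to that of \<open>x\<close>.\<close>

lemma cross3_orthonormal:
  fixes n e x :: "real^3"
  assumes "norm n = 1" "norm e = 1" "n \<bullet> e = 0"
  shows "norm (cross3 n e) = 1"
    and "(norm x)\<^sup>2 = (x \<bullet> n)\<^sup>2 + (x \<bullet> e)\<^sup>2 + (x \<bullet> cross3 n e)\<^sup>2"
proof -
  have "(norm (cross3 n e))\<^sup>2 = 1" using norm_cross_dot[of n e] assms by simp
  then show 1: "norm (cross3 n e) = 1" by (simp add: power2_eq_1_iff) (smt (verit) norm_ge_zero)
  have "cross3 x (cross3 n e) = (x \<bullet> e) *\<^sub>R n - (x \<bullet> n) *\<^sub>R e" by (rule Cross3.Lagrange)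
  then have "(norm (cross3 x (cross3 n e)))\<^sup>2 = ((x \<bullet> e) *\<^sub>R n - (x \<bullet> n) *\<^sub>R e) \<bullet> ((x \<bullet> e) *\<^sub>R n - (x \<bullet> n) *\<^sub>R e)"
    by (simp add: power2_norm_eq_inner)
  also have "\<dots> = (x \<bullet> e)\<^sup>2 * (n \<bullet> n) + (x \<bullet> n)\<^sup>2 * (e \<bullet> e) - 2 * (x \<bullet> e) * (x \<bullet> n) * (n \<bullet> e)"
    by (simp add: inner_diff_left inner_diff_right inner_commute power2_eq_square algebra_simps)
  also have "\<dots> = (x \<bullet> e)\<^sup>2 + (x \<bullet> n)\<^sup>2" using assms by (simp add: norm_eq_1)
  finally show "(norm x)\<^sup>2 = (x \<bullet> n)\<^sup>2 + (x \<bullet> e)\<^sup>2 + (x \<bullet> cross3 n e)\<^sup>2"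
    using norm_cross_dot[of x "cross3 n e"] 1 by simp
qed

text \<open>One constant for both chart lemmas and both directions: 2 + 2 / c arises where the
  coordinates control the distance, 1 + C + c / 2 or less in the converse. Here \<open>c\<close> and
  \<open>C\<close> bound the gradient or the surface gradient.\<close>

definition chart_const :: "real \<Rightarrow> real \<Rightarrow> real" where
  "chart_const c C = 2 + 2 / c + C + c"

text \<open>The coordinate along the gradient at \<open>z\<close> is replaced by \<open>v\<close>,
  and the two orthogonal ones are kept as \<open>p\<close>. The constant involves only the gradient
  bounds, not \<open>z\<close>, as the comparison of whole atlases requires.\<close>

lemma level_set_chart:
  fixes v :: "real^3 \<Rightarrow> real"
  assumes op: "open \<Omega>" and C1: "C1_on \<Omega> v" and z: "z \<in> \<Omega>"
    and G: "c \<le> norm (grad v z)" "norm (grad v z) \<le> C" and c: "0 < c"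
  shows "\<exists>\<rho>>0. \<exists>p :: real^3 \<Rightarrow> real \<times> real. cball z \<rho> \<subseteq> \<Omega> \<and> continuous_on UNIV p \<and>
    (\<forall>x\<in>cball z \<rho>. \<forall>y\<in>cball z \<rho>.
       dist x y \<le> chart_const c C * dist (p x, v x) (p y, v y) \<and>
       dist (p x, v x) (p y, v y) \<le> chart_const c C * dist x y)"
proof -
  let ?G = "grad v z"
  define n where "n = ?G /\<^sub>R norm ?G"
  have Gpos: "norm ?G > 0" using G(1) c by linarith
  then have n: "norm n = 1" by (simp add: n_def)
  obtain e' :: "real^3" where e': "e' \<noteq> 0" "orthogonal n e'"
    using orthogonal_to_vector_exists[of n] by auto
  define e where "e = e' /\<^sub>R norm e'"
  have e: "norm e = 1" "n \<bullet> e = 0" using e' by (auto simp: e_def orthogonal_def)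
  define p where "p x = (x \<bullet> e, x \<bullet> cross3 n e)" for x :: "real^3"
  have pc: "continuous_on UNIV p" unfolding p_def by (intro continuous_intros)
  have pd: "(dist (p x) (p y))\<^sup>2 = ((x - y) \<bullet> e)\<^sup>2 + ((x - y) \<bullet> cross3 n e)\<^sup>2" for x y
    by (simp add: p_def dist_Pair_Pair dist_real_def inner_diff_left)
  have split: "(dist x y)\<^sup>2 = ((x - y) \<bullet> n)\<^sup>2 + (dist (p x) (p y))\<^sup>2" for x y
    unfolding pd using cross3_orthonormal(2)[OF n e, of "x - y"] by (simp add: dist_norm)
  have dle: "dist x y \<le> \<bar>(x - y) \<bullet> n\<bar> + dist (p x) (p y)" for x y
  proof (rule power2_le_imp_le)
    show "(dist x y)\<^sup>2 \<le> (\<bar>(x - y) \<bullet> n\<bar> + dist (p x) (p y))\<^sup>2"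
      unfolding split power2_sum by simp
  qed simp
  have ple: "dist (p x) (p y) \<le> dist x y" for x y
    by (rule power2_le_imp_le) (simp_all add: split)
  \<comment> \<open>The tolerance c / 2 leaves an error d / 2 in the bound for \<open>d\<close>
    below, which is absorbed on the left.\<close>
  obtain \<rho> where \<rho>: "\<rho> > 0" "cball z \<rho> \<subseteq> \<Omega>" "\<And>x y. x \<in> cball z \<rho> \<Longrightarrow> y \<in> cball z \<rho> \<Longrightarrow>
      \<bar>v x - v y - (x - y) \<bullet> ?G\<bar> \<le> c / 2 * norm (x - y)"
    using C1_on_strict_differentiable[OF op C1 z, of "c / 2"] c by auto
  have "dist x y \<le> chart_const c C * dist (p x, v x) (p y, v y) \<and>
       dist (p x, v x) (p y, v y) \<le> chart_const c C * dist x y"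
    if xy: "x \<in> cball z \<rho>" "y \<in> cball z \<rho>" for x y
  proof
    define d where "d = dist x y"
    define q where "q = dist (p x, v x) (p y, v y)"
    have d0: "d \<ge> 0" "q \<ge> 0" by (simp_all add: d_def q_def)
    have q: "dist (p x) (p y) \<le> q" "\<bar>v x - v y\<bar> \<le> q" "q \<le> dist (p x) (p y) + \<bar>v x - v y\<bar>"
      unfolding q_def dist_Pair_Pair
      using sqrt_sum_squares_le_sum_abs[of "dist (p x) (p y)" "dist (v x) (v y)"]
      by (simp_all add: dist_real_def real_sqrt_sum_squares_ge1 real_sqrt_sum_squares_ge2 real_le_rsqrt)
    have st: "\<bar>v x - v y - (x - y) \<bullet> ?G\<bar> \<le> c / 2 * d" using \<rho>(3)[OF xy] by (simp add: d_def dist_norm)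
    have Gn: "(x - y) \<bullet> ?G = norm ?G * ((x - y) \<bullet> n)" using Gpos by (simp add: n_def)
    have "c * \<bar>(x - y) \<bullet> n\<bar> \<le> norm ?G * \<bar>(x - y) \<bullet> n\<bar>" using G(1) by (intro mult_right_mono) auto
    also have "\<dots> = \<bar>(x - y) \<bullet> ?G\<bar>" unfolding Gn abs_mult by simp
    also have "\<dots> \<le> q + c / 2 * d" using st q(2) by linarith
    finally have "\<bar>(x - y) \<bullet> n\<bar> \<le> (q + c / 2 * d) / c" using c by (simp add: pos_le_divide_eq mult.commute)
    also have "\<dots> = q / c + d / 2" using c by (simp add: add_divide_distrib)
    finally have "d \<le> q / c + d / 2 + q" using dle[of x y] q(1) unfolding d_def[symmetric] by linarith
    then have "d \<le> 2 * q + 2 * (q / c)" by linarith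
    also have "\<dots> = (2 + 2 / c) * q" by (simp add: algebra_simps)
    also have "\<dots> \<le> chart_const c C * q"
      unfolding chart_const_def using d0 G c by (intro mult_right_mono) auto
    finally show "dist x y \<le> chart_const c C * dist (p x, v x) (p y, v y)" by (simp add: d_def q_def)
    have "\<bar>(x - y) \<bullet> ?G\<bar> \<le> d * norm ?G" unfolding d_def dist_norm by (rule Cauchy_Schwarz_ineq2)
    also have "\<dots> \<le> d * C" using G(2) d0 by (intro mult_left_mono) auto
    finally have "q \<le> d + (d * C + c / 2 * d)" using q(3) ple[of x y] st unfolding d_def[symmetric] by linarith
    also have "\<dots> = (1 + C + c / 2) * d" by (simp add: algebra_simps)
    also have "\<dots> \<le> chart_const c C * d"
      unfolding chart_const_def using d0 c by (intro mult_right_mono) (auto simp: add_increasing)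
    finally show "dist (p x, v x) (p y, v y) \<le> chart_const c C * dist x y" by (simp add: d_def q_def)
  qed
  then show ?thesis using \<rho>(1,2) pc by blast
qed

text \<open>The same one dimension lower: on the surface, \<open>g\<close> replaces the coordinate
  along \<xi>, and \<tau> is the remaining tangent direction, that of the leaf through
  \<open>z\<close>.\<close>

lemma curve_chart:
  fixes v g :: "real^3 \<Rightarrow> real"
  assumes op: "open \<Omega>" and C1: "C1_on \<Omega> v" and z: "z \<in> \<Omega>" "v z = t" and G: "grad v z \<noteq> 0"
    and \<xi>: "continuous_on {x\<in>\<Omega>. v x = t} \<xi>" "\<xi> z \<bullet> grad v z = 0" "c \<le> norm (\<xi> z)" "norm (\<xi> z) \<le> C"
    and g: "\<And>x. x \<in> {x\<in>\<Omega>. v x = t} \<Longrightarrow>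
      (g has_derivative (\<lambda>h. \<xi> x \<bullet> h)) (at x within {x\<in>\<Omega>. v x = t})"
    and c: "c > 0"
  shows "\<exists>\<rho>>0. \<exists>\<tau>. cball z \<rho> \<subseteq> \<Omega> \<and> norm \<tau> = 1 \<and>
    (\<forall>x\<in>cball z \<rho>. \<forall>y\<in>cball z \<rho>. v x = t \<longrightarrow> v y = t \<longrightarrow>
       dist x y \<le> chart_const c C * dist (x \<bullet> \<tau>, g x) (y \<bullet> \<tau>, g y) \<and>
       dist (x \<bullet> \<tau>, g x) (y \<bullet> \<tau>, g y) \<le> chart_const c C * dist x y)"
proof -
  let ?G = "grad v z"
  define n where "n = ?G /\<^sub>R norm ?G"
  have Gpos: "norm ?G > 0" using G by simp
  then have n: "norm n = 1" by (simp add: n_def)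
  define e where "e = \<xi> z /\<^sub>R norm (\<xi> z)"
  have \<xi>pos: "norm (\<xi> z) > 0" using \<xi>(3) c by linarith
  then have e: "norm e = 1" "n \<bullet> e = 0" using \<xi>(2) by (auto simp: e_def n_def inner_commute)
  define \<tau> where "\<tau> = cross3 n e"
  have \<tau>: "norm \<tau> = 1" unfolding \<tau>_def by (rule cross3_orthonormal(1)[OF n e])
  have split: "(norm d)\<^sup>2 = (d \<bullet> n)\<^sup>2 + (d \<bullet> e)\<^sup>2 + (d \<bullet> \<tau>)\<^sup>2" for d
    unfolding \<tau>_def by (rule cross3_orthonormal(2)[OF n e])
  have dle: "norm d \<le> \<bar>d \<bullet> n\<bar> + \<bar>d \<bullet> e\<bar> + \<bar>d \<bullet> \<tau>\<bar>" for d
  proof (rule power2_le_imp_le)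
    show "(norm d)\<^sup>2 \<le> (\<bar>d \<bullet> n\<bar> + \<bar>d \<bullet> e\<bar> + \<bar>d \<bullet> \<tau>\<bar>)\<^sup>2"
      unfolding split power2_sum by (simp add: add_nonneg_nonneg)
  qed simp
  have \<tau>le: "\<bar>d \<bullet> \<tau>\<bar> \<le> norm d" for d
    using Cauchy_Schwarz_ineq2[of d \<tau>] \<tau> by simp
  \<comment> \<open>A tolerance proportional to norm ?G bounds the normal component by d / 4
    whatever the size of the gradient, which thus stays out of the constant.\<close>
  obtain r1 where r1: "r1 > 0" "cball z r1 \<subseteq> \<Omega>" "\<And>x y. x \<in> cball z r1 \<Longrightarrow> y \<in> cball z r1 \<Longrightarrow>
      \<bar>v x - v y - (x - y) \<bullet> ?G\<bar> \<le> norm ?G / 4 * norm (x - y)"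
    using C1_on_strict_differentiable[OF op C1 z(1), of "norm ?G / 4"] Gpos by auto
  have c4: "c / 4 > 0" using c by simp
  obtain r2 where r2: "r2 > 0" "\<And>x y. x \<in> cball z r2 \<Longrightarrow> y \<in> cball z r2 \<Longrightarrow> v x = t \<Longrightarrow> v y = t \<Longrightarrow>
      \<bar>g x - g y - \<xi> z \<bullet> (x - y)\<bar> \<le> c / 4 * norm (x - y)"
    using surface_strict_differentiable[OF op C1 z G \<xi>(1) g c4] by blast
  define \<rho> where "\<rho> = min r1 r2"
  have "dist x y \<le> chart_const c C * dist (x \<bullet> \<tau>, g x) (y \<bullet> \<tau>, g y) \<and>
       dist (x \<bullet> \<tau>, g x) (y \<bullet> \<tau>, g y) \<le> chart_const c C * dist x y"
    if xy: "x \<in> cball z \<rho>" "y \<in> cball z \<rho>" "v x = t" "v y = t" for x y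
  proof
    define d where "d = norm (x - y)"
    define q where "q = dist (x \<bullet> \<tau>, g x) (y \<bullet> \<tau>, g y)"
    have d0: "d \<ge> 0" "q \<ge> 0" by (simp_all add: d_def q_def)
    have x1: "x \<in> cball z r1" "x \<in> cball z r2" "y \<in> cball z r1" "y \<in> cball z r2"
      using xy by (auto simp: \<rho>_def)
    have q: "\<bar>(x - y) \<bullet> \<tau>\<bar> \<le> q" "\<bar>g x - g y\<bar> \<le> q" "q \<le> \<bar>(x - y) \<bullet> \<tau>\<bar> + \<bar>g x - g y\<bar>"
      unfolding q_def dist_Pair_Pair
      using sqrt_sum_squares_le_sum_abs[of "(x - y) \<bullet> \<tau>" "g x - g y"]
      by (simp_all add: dist_real_def inner_diff_left real_le_rsqrt)
    have Gn: "(x - y) \<bullet> ?G = norm ?G * ((x - y) \<bullet> n)" using Gpos by (simp add: n_def)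
    have "norm ?G * \<bar>(x - y) \<bullet> n\<bar> = \<bar>(x - y) \<bullet> ?G\<bar>" unfolding Gn abs_mult by simp
    also have "\<dots> \<le> norm ?G / 4 * d" using r1(3)[OF x1(1,3)] xy(3,4) by (simp add: d_def)
    also have "\<dots> = norm ?G * (d / 4)" by simp
    finally have 1: "\<bar>(x - y) \<bullet> n\<bar> \<le> d / 4" using Gpos by (simp del: times_divide_eq_right)
    have st: "\<bar>g x - g y - \<xi> z \<bullet> (x - y)\<bar> \<le> c / 4 * d"
      using r2(2)[OF x1(2,4) xy(3,4)] by (simp add: d_def)
    have \<xi>e: "\<xi> z \<bullet> (x - y) = norm (\<xi> z) * ((x - y) \<bullet> e)" using \<xi>pos by (simp add: e_def inner_commute)
    have "c * \<bar>(x - y) \<bullet> e\<bar> \<le> norm (\<xi> z) * \<bar>(x - y) \<bullet> e\<bar>" using \<xi>(3) by (intro mult_right_mono) auto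
    also have "\<dots> = \<bar>\<xi> z \<bullet> (x - y)\<bar>" unfolding \<xi>e abs_mult by simp
    also have "\<dots> \<le> q + c / 4 * d" using st q(2) by linarith
    finally have "\<bar>(x - y) \<bullet> e\<bar> \<le> (q + c / 4 * d) / c" using c by (simp add: pos_le_divide_eq mult.commute)
    also have "\<dots> = q / c + d / 4" using c by (simp add: add_divide_distrib)
    finally have "d \<le> d / 4 + (q / c + d / 4) + q" using dle[of "x - y"] 1 q(1) unfolding d_def[symmetric] by linarith
    then have "d \<le> 2 * q + 2 * (q / c)" by linarith
    also have "\<dots> = (2 + 2 / c) * q" by (simp add: algebra_simps)
    also have "\<dots> \<le> chart_const c C * q"
      unfolding chart_const_def using d0 \<xi>(3,4) c by (intro mult_right_mono) auto
    finally show "dist x y \<le> chart_const c C * dist (x \<bullet> \<tau>, g x) (y \<bullet> \<tau>, g y)"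
      by (simp add: d_def q_def dist_norm)
    have "\<bar>\<xi> z \<bullet> (x - y)\<bar> \<le> norm (\<xi> z) * d" unfolding d_def by (rule Cauchy_Schwarz_ineq2)
    also have "\<dots> \<le> C * d" using \<xi>(4) d0 by (intro mult_right_mono) auto
    finally have "q \<le> d + (C * d + c / 4 * d)" using q(3) \<tau>le[of "x - y"] st unfolding d_def[symmetric] by linarith
    also have "\<dots> = (1 + C + c / 4) * d" by (simp add: algebra_simps)
    also have "\<dots> \<le> chart_const c C * d"
      unfolding chart_const_def using d0 c by (intro mult_right_mono) (auto simp: add_increasing)
    finally show "dist (x \<bullet> \<tau>, g x) (y \<bullet> \<tau>, g y) \<le> chart_const c C * dist x y"
      by (simp add: d_def q_def dist_norm)
  qed
  moreover have "cball z \<rho> \<subseteq> \<Omega>" "\<rho> > 0"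
    using r1 r2 subset_cball[of \<rho> r1 z] by (auto simp: \<rho>_def)
  ultimately show ?thesis using \<tau> by blast
qed

text \<open>The gradient of \<open>w\<close> is its tangential part plus \<mu> times the gradient of
  \<open>v\<close>, and the latter is almost orthogonal to x - y when both points lie on one
  level.\<close>

lemma level_set_lipschitz:
  fixes v w :: "'a::euclidean_space \<Rightarrow> real"
  assumes op: "open \<Omega>" and C1: "C1_on \<Omega> v" "C1_on \<Omega> w" and z: "z \<in> \<Omega>" and G: "grad v z \<noteq> 0"
    and \<epsilon>: "\<epsilon> > 0"
  shows "\<exists>\<rho>>0. cball z \<rho> \<subseteq> \<Omega> \<and> (\<forall>x\<in>cball z \<rho>. \<forall>y\<in>cball z \<rho>. v x = v y \<longrightarrow>
     \<bar>w x - w y\<bar> \<le> (norm (tangential (grad v z) (grad w z)) + \<epsilon>) * dist x y)"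
proof -
  let ?G = "grad v z" and ?W = "grad w z"
  define \<mu> where "\<mu> = (?W \<bullet> ?G) / (norm ?G)\<^sup>2"
  \<comment> \<open>Chosen so that the error for \<open>w\<close> and the error for
    \<open>v\<close>, weighted by |\<mu>|, add up to \<epsilon>.\<close>
  define \<eta> where "\<eta> = \<epsilon> / (1 + \<bar>\<mu>\<bar>)"
  have \<eta>: "\<eta> > 0" "\<eta> * (1 + \<bar>\<mu>\<bar>) = \<epsilon>" using \<epsilon> by (auto simp: \<eta>_def add_pos_nonneg)
  obtain r1 where r1: "r1 > 0" "cball z r1 \<subseteq> \<Omega>" "\<And>x y. x \<in> cball z r1 \<Longrightarrow> y \<in> cball z r1 \<Longrightarrow>
      \<bar>v x - v y - (x - y) \<bullet> ?G\<bar> \<le> \<eta> * norm (x - y)"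
    using C1_on_strict_differentiable[OF op C1(1) z \<eta>(1)] by blast
  obtain r2 where r2: "r2 > 0" "\<And>x y. x \<in> cball z r2 \<Longrightarrow> y \<in> cball z r2 \<Longrightarrow>
      \<bar>w x - w y - (x - y) \<bullet> ?W\<bar> \<le> \<eta> * norm (x - y)"
    using C1_on_strict_differentiable[OF op C1(2) z \<eta>(1)] by blast
  define \<rho> where "\<rho> = min r1 r2"
  have "\<bar>w x - w y\<bar> \<le> (norm (tangential ?G ?W) + \<epsilon>) * dist x y"
    if xy: "x \<in> cball z \<rho>" "y \<in> cball z \<rho>" "v x = v y" for x y
  proof -
    let ?d = "x - y"
    have x1: "x \<in> cball z r1" "x \<in> cball z r2" "y \<in> cball z r1" "y \<in> cball z r2"
      using xy by (auto simp: \<rho>_def)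
    have W: "?W = tangential ?G ?W + \<mu> *\<^sub>R ?G" by (simp add: tangential_def \<mu>_def)
    have "?d \<bullet> ?W = ?d \<bullet> tangential ?G ?W + \<mu> * (?d \<bullet> ?G)"
      by (subst W) (simp add: inner_add_right)
    moreover have "\<bar>?d \<bullet> tangential ?G ?W\<bar> \<le> norm ?d * norm (tangential ?G ?W)"
      by (rule Cauchy_Schwarz_ineq2)
    moreover have "\<bar>\<mu> * (?d \<bullet> ?G)\<bar> \<le> \<bar>\<mu>\<bar> * (\<eta> * norm ?d)"
      unfolding abs_mult using r1(3)[OF x1(1,3)] xy(3) by (intro mult_left_mono) auto
    moreover have "\<bar>w x - w y - ?d \<bullet> ?W\<bar> \<le> \<eta> * norm ?d" by (rule r2(2)[OF x1(2,4)])
    ultimately have "\<bar>w x - w y\<bar> \<le> norm ?d * norm (tangential ?G ?W) + \<bar>\<mu>\<bar> * (\<eta> * norm ?d) + \<eta> * norm ?d"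
      by linarith
    also have "\<dots> = (norm (tangential ?G ?W) + \<eta> * (1 + \<bar>\<mu>\<bar>)) * norm ?d" by (simp add: algebra_simps)
    finally show ?thesis by (simp add: \<eta>(2) dist_norm)
  qed
  moreover have "cball z \<rho> \<subseteq> \<Omega>" "\<rho> > 0"
    using r1 r2 subset_cball[of \<rho> r1 z] by (auto simp: \<rho>_def)
  ultimately show ?thesis by blast
qed

text \<open>Lindelof's theorem reduces the balls to countably many. The parameter \<open>a\<close>
  carries the coordinates attached to a ball; as \<open>S\<close> is nonempty, a finite family too
  can be enumerated by all naturals, with repetitions.\<close>

lemma small_ball_cover:
  fixes S :: "'a::euclidean_space set"
  assumes "S \<noteq> {}" and P: "\<And>z. z \<in> S \<Longrightarrow> \<exists>\<rho>>0. \<exists>a. P (cball z \<rho>) a"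
  obtains N :: "nat \<Rightarrow> 'a set" and a where "\<And>i. P (N i) (a i)" "\<And>i. compact (N i)" "S \<subseteq> (\<Union>i. N i)"
proof -
  obtain \<rho> b where \<rho>: "\<And>z. z \<in> S \<Longrightarrow> \<rho> z > 0" "\<And>z. z \<in> S \<Longrightarrow> P (cball z (\<rho> z)) (b z)"
    using P by metis
  let ?F = "(\<lambda>z. ball z (\<rho> z)) ` S"
  obtain F' where F': "F' \<subseteq> ?F" "countable F'" "\<Union>F' = \<Union>?F"
    by (rule Lindelof[of ?F]) auto
  obtain Z where Z: "Z \<subseteq> S" "countable Z" "F' = (\<lambda>z. ball z (\<rho> z)) ` Z"
    using countable_subset_image[of F' "\<lambda>z. ball z (\<rho> z)" S] F'(1,2) by blast
  have SZ: "S \<subseteq> (\<Union>z\<in>Z. cball z (\<rho> z))"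
  proof
    fix x assume x: "x \<in> S"
    then have "x \<in> \<Union>?F" using \<rho>(1) by force
    then have "x \<in> \<Union>F'" by (simp add: F'(3))
    then obtain z where "z \<in> Z" "x \<in> ball z (\<rho> z)" unfolding Z(3) by blast
    then show "x \<in> (\<Union>z\<in>Z. cball z (\<rho> z))" by (auto intro: less_imp_le)
  qed
  then have Zne: "Z \<noteq> {}" using assms(1) by auto
  define e where "e = from_nat_into Z"
  have eZ: "range e = Z" unfolding e_def by (rule range_from_nat_into[OF Zne Z(2)])
  show ?thesis
  proof (rule that[of "\<lambda>i. cball (e i) (\<rho> (e i))" "\<lambda>i. b (e i)"])
    show "P (cball (e i) (\<rho> (e i))) (b (e i))" for i using \<rho>(2) eZ Z(1) by blast
    show "compact (cball (e i) (\<rho> (e i)))" for i by simp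
    show "S \<subseteq> (\<Union>i. cball (e i) (\<rho> (e i)))" using SZ unfolding eZ[symmetric] by (simp add: image_image)
  qed
qed

section \<open>The inequality for functions vanishing at the ends of the leaves\<close>

lemma atlas_integral_empty: "atlas {} N q \<Longrightarrow> atlas_integral {} N q h = 0"
  using atlas_integral_le_const[of "{}" N q h 0] by simp

text \<open>\<open>L\<close> may have many components: each point is linked to small values of
  \<open>w\<close> inside a connected subset, the integral of \<open>D\<close> over all of
  \<open>L\<close> bounds |w| there, and integrating this constant bound over \<open>L\<close> costs
  its length.\<close>

lemma curve_inequality:
  fixes \<tau> :: "nat \<Rightarrow> 'a::euclidean_space" and w :: "'a \<Rightarrow> real"
  assumes at: "atlas L N (\<lambda>i x. x \<bullet> \<tau> i)" and \<tau>: "\<And>i. norm (\<tau> i) = 1"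
    and reach: "\<And>x. x \<in> L \<Longrightarrow> \<exists>\<Gamma>. connected \<Gamma> \<and> continuous_on \<Gamma> w \<and> x \<in> \<Gamma> \<and> \<Gamma> \<subseteq> L \<and>
        (\<forall>e>0. \<exists>y\<in>\<Gamma>. \<bar>w y\<bar> < e)"
    and C: "C > 0" and \<kappa>: "\<And>i. \<kappa> i > 0"
    and lip: "\<And>i x y. x \<in> N i \<inter> L \<Longrightarrow> y \<in> N i \<inter> L \<Longrightarrow> \<bar>w x - w y\<bar> \<le> C * \<kappa> i * \<bar>x \<bullet> \<tau> i - y \<bullet> \<tau> i\<bar>"
    and D: "\<And>i x. x \<in> N i \<inter> L \<Longrightarrow> ennreal (\<kappa> i) \<le> D x" "D \<in> borel_measurable borel"
    and W: "\<And>x. x \<in> L \<Longrightarrow> W x = ennreal \<bar>w x\<bar>"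
  shows "atlas_integral L N (\<lambda>i x. x \<bullet> \<tau> i) W \<le>
    ennreal (2 * C) * atlas_integral L N (\<lambda>i x. x \<bullet> \<tau> i) D * hausdorff1 L"
proof -
  let ?q = "\<lambda>i x. x \<bullet> \<tau> i"
  have "W x \<le> ennreal (2 * C) * atlas_integral L N ?q D" if x: "x \<in> L" for x
  proof -
    obtain \<Gamma> where \<Gamma>: "connected \<Gamma>" "continuous_on \<Gamma> w" "x \<in> \<Gamma>" "\<Gamma> \<subseteq> L"
      "\<And>e. e > 0 \<Longrightarrow> \<exists>y\<in>\<Gamma>. \<bar>w y\<bar> < e" using reach[OF x] by blast
    show ?thesis unfolding W[OF x] by (rule abs_le_atlas_integral[OF at \<Gamma> C \<kappa> lip D])
  qed
  then have "atlas_integral L N ?q W \<le> ennreal (2 * C) * atlas_integral L N ?q D * atlas_integral L N ?q (\<lambda>_. 1)"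
    by (rule atlas_integral_le_const[OF at])
  also have "atlas_integral L N ?q (\<lambda>_. 1) \<le> hausdorff1 L"
  proof (rule atlas_integral_one_le_hausdorff1[OF at])
    fix i x y
    show "\<bar>x \<bullet> \<tau> i - y \<bullet> \<tau> i\<bar> \<le> dist x y"
      using Cauchy_Schwarz_ineq2[of "x - y" "\<tau> i"] \<tau>[of i] by (simp add: dist_norm inner_diff_left)
  qed
  finally show ?thesis by (simp add: mult_left_mono)
qed

lemma chart_const_pos: "0 < c \<Longrightarrow> c \<le> C \<Longrightarrow> chart_const c C > 0"
  unfolding chart_const_def by (intro add_pos_pos) auto

lemma continuous_on_tangential:
  assumes "C1_on \<Omega> v" "C1_on \<Omega> w" "\<And>x. x \<in> \<Omega> \<Longrightarrow> grad v x \<noteq> 0"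
  shows "continuous_on \<Omega> (\<lambda>x. tangential (grad v x) (grad w x))"
  using assms unfolding tangential_def C1_on_def by (auto intro!: continuous_intros)

text \<open>The condition at one level, so that the almost everywhere quantifier over
  \<open>t\<close> stays outside the estimate on a single surface.\<close>

definition foliated_level :: "(real^3) set \<Rightarrow> real \<Rightarrow> real \<Rightarrow> real \<Rightarrow> (real^3 \<Rightarrow> real) \<Rightarrow> real \<Rightarrow> bool"
  where
  "foliated_level \<Omega> cg Cg K v t \<longleftrightarrow>
     (\<exists>g \<xi>. C1_surface_function v {x\<in>\<Omega>. v x = t} g \<xi> \<and>
          (\<forall>x\<in>{x\<in>\<Omega>. v x = t}. cg \<le> norm (\<xi> x) \<and> norm (\<xi> x) \<le> Cg) \<and>
          (AE r in lborel. \<forall>\<Gamma>\<in>components {x\<in>\<Omega>. v x = t \<and> g x = r}. closure \<Gamma> \<inter> frontier \<Omega> \<noteq> {}) \<and>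
          (\<forall>r. hausdorff1 {x\<in>\<Omega>. v x = t \<and> g x = r} \<le> ennreal K))"

lemma level_sets_foliatedD:
  assumes "level_sets_foliated \<Omega> cg Cg K v"
  shows "AE t in lborel. t \<in> v ` \<Omega> \<longrightarrow> foliated_level \<Omega> cg Cg K v t"
  using assms unfolding level_sets_foliated_def
proof (eventually_elim, intro impI)
  fix t
  assume *: "t \<in> v ` \<Omega> \<longrightarrow> (\<exists>g \<xi>. C1_surface_function v {x \<in> \<Omega>. v x = t} g \<xi> \<and>
      (\<forall>x\<in>{x \<in> \<Omega>. v x = t}. cg \<le> norm (\<xi> x) \<and> norm (\<xi> x) \<le> Cg) \<and>
      (AE r in lborel. \<forall>\<Gamma>\<in>components {x \<in> \<Omega>. v x = t \<and> g x = r}.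
        C1_curve \<Gamma> \<and> closure \<Gamma> \<inter> frontier \<Omega> \<noteq> {}) \<and>
      (\<forall>r. hausdorff1 {x \<in> \<Omega>. v x = t \<and> g x = r} \<le> ennreal K))" and "t \<in> v ` \<Omega>"
  then obtain g \<xi> where g: "C1_surface_function v {x \<in> \<Omega>. v x = t} g \<xi>"
      "\<forall>x\<in>{x \<in> \<Omega>. v x = t}. cg \<le> norm (\<xi> x) \<and> norm (\<xi> x) \<le> Cg"
      "AE r in lborel. \<forall>\<Gamma>\<in>components {x \<in> \<Omega>. v x = t \<and> g x = r}.
        C1_curve \<Gamma> \<and> closure \<Gamma> \<inter> frontier \<Omega> \<noteq> {}"
      "\<forall>r. hausdorff1 {x \<in> \<Omega>. v x = t \<and> g x = r} \<le> ennreal K" by blast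
  from g(3) have "AE r in lborel. \<forall>\<Gamma>\<in>components {x \<in> \<Omega>. v x = t \<and> g x = r}. closure \<Gamma> \<inter> frontier \<Omega> \<noteq> {}"
    by eventually_elim blast
  then show "foliated_level \<Omega> cg Cg K v t" unfolding foliated_level_def using g by blast
qed

text \<open>Change from \<open>p\<close> to the coordinates of \<open>curve_chart\<close>, apply
  \<open>curve_inequality\<close> for almost every value of \<open>g\<close>, integrate over these
  values, and change back. The two changes of atlas give the square of the distortion.\<close>

lemma surface_inequality:
  fixes p :: "nat \<Rightarrow> real^3 \<Rightarrow> real \<times> real" and v w :: "real^3 \<Rightarrow> real"
  assumes op: "open \<Omega>" and C1: "C1_on \<Omega> v" "C1_on \<Omega> w" and G: "\<And>x. x \<in> \<Omega> \<Longrightarrow> grad v x \<noteq> 0"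
    and w: "continuous_on (closure \<Omega>) w" "\<And>x. x \<in> frontier \<Omega> \<Longrightarrow> w x = 0"
    and fol: "foliated_level \<Omega> cg Cg K v t" and cg: "cg > 0"
    and at: "atlas {x\<in>\<Omega>. v x = t} N p" and L: "L > 0"
    and bilip: "\<And>i x y. x \<in> N i \<inter> {x\<in>\<Omega>. v x = t} \<Longrightarrow> y \<in> N i \<inter> {x\<in>\<Omega>. v x = t} \<Longrightarrow>
        dist x y \<le> L * dist (p i x) (p i y) \<and> dist (p i x) (p i y) \<le> L * dist x y"
    and \<epsilon>: "\<epsilon> > 0"
    and W: "W \<in> borel_measurable borel" "\<And>x. x \<in> \<Omega> \<Longrightarrow> W x = ennreal \<bar>w x\<bar>"
    and D: "D \<in> borel_measurable borel"
      "\<And>x. x \<in> \<Omega> \<Longrightarrow> D x = ennreal (norm (tangential (grad v x) (grad w x)) + 2 * \<epsilon>)"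
  shows "atlas_integral {x\<in>\<Omega>. v x = t} N p W \<le>
     ennreal (distortion 2 (L * chart_const cg Cg)) ^ 2 * ennreal (2 * chart_const cg Cg) * ennreal K *
     atlas_integral {x\<in>\<Omega>. v x = t} N p D"
proof (cases "{x\<in>\<Omega>. v x = t} = {}")
  case True
  show ?thesis using atlas_integral_empty[of N p W] at unfolding True by simp
next
  case False
  let ?S = "{x\<in>\<Omega>. v x = t}"
  let ?T = "\<lambda>x. norm (tangential (grad v x) (grad w x))"
  let ?L2 = "chart_const cg Cg"
  obtain g \<xi> where g: "C1_surface_function v ?S g \<xi>"
      "\<And>x. x \<in> ?S \<Longrightarrow> cg \<le> norm (\<xi> x) \<and> norm (\<xi> x) \<le> Cg"
      "AE r in lborel. \<forall>\<Gamma>\<in>components {x \<in> \<Omega>. v x = t \<and> g x = r}. closure \<Gamma> \<inter> frontier \<Omega> \<noteq> {}"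
      "\<And>r. hausdorff1 {x \<in> \<Omega>. v x = t \<and> g x = r} \<le> ennreal K"
    using fol unfolding foliated_level_def by blast
  have \<xi>: "continuous_on ?S \<xi>" "\<And>x. x \<in> ?S \<Longrightarrow> \<xi> x \<bullet> grad v x = 0"
    "\<And>x. x \<in> ?S \<Longrightarrow> (g has_derivative (\<lambda>h. \<xi> x \<bullet> h)) (at x within ?S)"
    using g(1) unfolding C1_surface_function_def by blast+
  have gc: "continuous_on ?S g"
    using \<xi>(3) has_derivative_continuous unfolding continuous_on_eq_continuous_within by blast
  have "cg \<le> Cg" using False g(2) by fastforce
  then have L2: "?L2 > 0" using cg by (intro chart_const_pos)
  \<comment> \<open>On each ball \<kappa> will be ?T z + \<epsilon>: a Lipschitz constant of
    \<open>w\<close> along the level and, by continuity of the tangential gradient, at most ?T x + 2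
    * \<epsilon>. The \<epsilon> also keeps it positive where the tangential gradient
    vanishes.\<close>
  define P where "P B a \<longleftrightarrow> (case a of (\<tau>, \<kappa>) \<Rightarrow> compact B \<and> B \<subseteq> \<Omega> \<and> norm \<tau> = 1 \<and> \<kappa> > 0 \<and>
     (\<forall>x\<in>B. \<kappa> \<le> ?T x + 2 * \<epsilon>) \<and>
     (\<forall>x\<in>B. \<forall>y\<in>B. v x = t \<longrightarrow> v y = t \<longrightarrow>
       dist x y \<le> ?L2 * dist (x \<bullet> \<tau>, g x) (y \<bullet> \<tau>, g y) \<and>
       dist (x \<bullet> \<tau>, g x) (y \<bullet> \<tau>, g y) \<le> ?L2 * dist x y \<and> \<bar>w x - w y\<bar> \<le> \<kappa> * dist x y))"
    for B and a :: "(real^3) \<times> real"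
  have loc: "\<exists>\<rho>>0. \<exists>a. P (cball z \<rho>) a" if z: "z \<in> ?S" for z
  proof -
    have z': "z \<in> \<Omega>" "v z = t" using z by auto
    obtain r1 \<tau> where r1: "r1 > 0" "cball z r1 \<subseteq> \<Omega>" "norm \<tau> = 1"
      "\<And>x y. x \<in> cball z r1 \<Longrightarrow> y \<in> cball z r1 \<Longrightarrow> v x = t \<Longrightarrow> v y = t \<Longrightarrow>
       dist x y \<le> ?L2 * dist (x \<bullet> \<tau>, g x) (y \<bullet> \<tau>, g y) \<and>
       dist (x \<bullet> \<tau>, g x) (y \<bullet> \<tau>, g y) \<le> ?L2 * dist x y"
      using curve_chart[OF op C1(1) z' G[OF z'(1)] \<xi>(1) \<xi>(2)[OF z] g(2)[OF z, THEN conjunct1]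
        g(2)[OF z, THEN conjunct2] \<xi>(3) cg] by blast
    obtain r2 where r2: "r2 > 0" "\<And>x y. x \<in> cball z r2 \<Longrightarrow> y \<in> cball z r2 \<Longrightarrow> v x = v y \<Longrightarrow>
       \<bar>w x - w y\<bar> \<le> (?T z + \<epsilon>) * dist x y"
      using level_set_lipschitz[OF op C1 z'(1) G[OF z'(1)] \<epsilon>] by blast
    have "continuous_on \<Omega> ?T" by (intro continuous_intros continuous_on_tangential C1 G)
    then have "\<forall>e>0. \<exists>d>0. \<forall>x\<in>\<Omega>. dist x z < d \<longrightarrow> dist (?T x) (?T z) < e"
      using z'(1) unfolding continuous_on_iff by (rule bspec)
    then obtain r3 where r3: "r3 > 0" "\<And>x. x \<in> \<Omega> \<Longrightarrow> dist x z < r3 \<Longrightarrow> dist (?T x) (?T z) < \<epsilon>"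
      using \<epsilon> by metis
    define \<rho> where "\<rho> = min r1 (min r2 (r3 / 2))"
    have \<rho>: "\<rho> > 0" "\<rho> \<le> r1" "\<rho> \<le> r2" "\<rho> < r3" using r1(1) r2(1) r3(1) by (auto simp: \<rho>_def)
    have sub: "cball z \<rho> \<subseteq> cball z r1" "cball z \<rho> \<subseteq> cball z r2" using \<rho> by (auto intro!: subset_cball)
    have "P (cball z \<rho>) (\<tau>, ?T z + \<epsilon>)"
      unfolding P_def prod.case
    proof (intro conjI ballI impI)
      show "cball z \<rho> \<subseteq> \<Omega>" using sub(1) r1(2) by blast
      show "?T z + \<epsilon> > 0" using \<epsilon> by (simp add: add_nonneg_pos)
      fix x assume x: "x \<in> cball z \<rho>"
      then have "dist x z < r3" using \<rho>(4) by (simp add: dist_commute)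
      moreover have "x \<in> \<Omega>" using x sub(1) r1(2) by blast
      ultimately show "?T z + \<epsilon> \<le> ?T x + 2 * \<epsilon>" using r3(2)[of x] by (simp add: dist_real_def abs_less_iff)
    next
      fix x y assume xy: "x \<in> cball z \<rho>" "y \<in> cball z \<rho>" "v x = t" "v y = t"
      then have "x \<in> cball z r1" "y \<in> cball z r1" "x \<in> cball z r2" "y \<in> cball z r2" using sub by blast+
      then show "dist x y \<le> ?L2 * dist (x \<bullet> \<tau>, g x) (y \<bullet> \<tau>, g y)"
        "dist (x \<bullet> \<tau>, g x) (y \<bullet> \<tau>, g y) \<le> ?L2 * dist x y" "\<bar>w x - w y\<bar> \<le> (?T z + \<epsilon>) * dist x y"
        using r1(4)[of x y] r2(2)[of x y] xy(3,4) by simp_all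
    qed (use r1(3) in auto)
    then show ?thesis using \<rho>(1) by blast
  qed
  obtain N' :: "nat \<Rightarrow> (real^3) set" and a :: "nat \<Rightarrow> (real^3) \<times> real" where N': "\<And>i. P (N' i) (a i)" "\<And>i. compact (N' i)" "?S \<subseteq> (\<Union>i. N' i)"
    using small_ball_cover[OF False, of P] loc by blast
  define \<tau> \<kappa> where "\<tau> i = fst (a i)" and "\<kappa> i = snd (a i)" for i
  have PN: "N' i \<subseteq> \<Omega>" "norm (\<tau> i) = 1" "\<kappa> i > 0" "\<And>x. x \<in> N' i \<Longrightarrow> \<kappa> i \<le> ?T x + 2 * \<epsilon>"
    "\<And>x y. x \<in> N' i \<inter> ?S \<Longrightarrow> y \<in> N' i \<inter> ?S \<Longrightarrow> dist x y \<le> ?L2 * dist (x \<bullet> \<tau> i, g x) (y \<bullet> \<tau> i, g y)"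
    "\<And>x y. x \<in> N' i \<inter> ?S \<Longrightarrow> y \<in> N' i \<inter> ?S \<Longrightarrow> dist (x \<bullet> \<tau> i, g x) (y \<bullet> \<tau> i, g y) \<le> ?L2 * dist x y"
    "\<And>x y. x \<in> N' i \<inter> ?S \<Longrightarrow> y \<in> N' i \<inter> ?S \<Longrightarrow> \<bar>w x - w y\<bar> \<le> \<kappa> i * dist x y" for i
    using N'(1)[of i] unfolding P_def \<tau>_def \<kappa>_def by (auto simp: case_prod_beta)
  let ?\<psi> = "\<lambda>i x. (x \<bullet> \<tau> i, g x)"
  let ?q = "\<lambda>i x. x \<bullet> \<tau> i"
  have at': "atlas ?S N' ?\<psi>"
    unfolding atlas_def chart_def
  proof (intro conjI allI)
    fix i
    show "closed (N' i)" using N'(2) by (rule compact_imp_closed)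
    have "continuous_on (N' i) v"
      using C1_on_imp_continuous_on[OF C1(1)] continuous_on_subset PN(1) by blast
    then have "compact (N' i \<inter> v -` {t})"
      using N'(2)[of i] continuous_closedin_preimage by (meson closed_singleton closedin_compact)
    moreover have "N' i \<inter> v -` {t} = N' i \<inter> ?S" using PN(1)[of i] by auto
    ultimately show "compact (N' i \<inter> ?S)" by simp
    show "continuous_on (N' i \<inter> ?S) (?\<psi> i)"
      by (intro continuous_intros continuous_on_subset[OF gc]) auto
    show "inj_on (?\<psi> i) (N' i \<inter> ?S)"
    proof (rule inj_onI)
      fix x y assume "x \<in> N' i \<inter> ?S" "y \<in> N' i \<inter> ?S" "?\<psi> i x = ?\<psi> i y"
      then show "x = y" using PN(5)[of x i y] by simp
    qed
  qed (rule N'(3))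
  have dim: "DIM(real \<times> real) = 2" by simp
  have Lpos: "L * ?L2 > 0" using L L2 by simp
  let ?c = "ennreal (distortion 2 (L * ?L2))"
  have 1: "atlas_integral ?S N p W \<le> ?c * atlas_integral ?S N' ?\<psi> W"
  proof -
    have "dist (p i x) (p i y) \<le> L * ?L2 * dist (?\<psi> j x) (?\<psi> j y)"
      if "x \<in> N i \<inter> N' j \<inter> ?S" "y \<in> N i \<inter> N' j \<inter> ?S" for i j x y
    proof -
      have "dist (p i x) (p i y) \<le> L * dist x y" using bilip that by blast
      also have "\<dots> \<le> L * (?L2 * dist (?\<psi> j x) (?\<psi> j y))"
        using L that by (intro mult_left_mono PN(5)) auto
      finally show ?thesis by (simp add: mult.assoc)
    qed
    from atlas_integral_le[OF refl at at' Lpos this W(1)] show ?thesis by (simp only: dim)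
  qed
  have 2: "atlas_integral ?S N' ?\<psi> D \<le> ?c * atlas_integral ?S N p D"
  proof -
    have "dist (?\<psi> j x) (?\<psi> j y) \<le> L * ?L2 * dist (p i x) (p i y)"
      if "x \<in> N' j \<inter> N i \<inter> ?S" "y \<in> N' j \<inter> N i \<inter> ?S" for i j x y
    proof -
      have "dist (?\<psi> j x) (?\<psi> j y) \<le> ?L2 * dist x y" using that by (intro PN(6)) auto
      also have "\<dots> \<le> ?L2 * (L * dist (p i x) (p i y))"
        using L2 bilip[of x i y] that by (intro mult_left_mono) auto
      finally show ?thesis by (simp add: mult_ac)
    qed
    from atlas_integral_le[OF refl at' at Lpos this D(1)] show ?thesis by (simp only: dim)
  qed
  have Sr: "{x \<in> ?S. g x = r} = {x \<in> \<Omega>. v x = t \<and> g x = r}" for r by auto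
  have 3: "AE r in lborel. atlas_integral {x \<in> ?S. g x = r} N' ?q W \<le>
      ennreal (2 * ?L2) * ennreal K * atlas_integral {x \<in> ?S. g x = r} N' ?q D"
    using g(3)
  proof eventually_elim
    case (elim r)
    let ?Lr = "{x \<in> ?S. g x = r}"
    have ar: "atlas ?Lr N' ?q" by (rule atlas_slice[OF at'])
    have "atlas_integral ?Lr N' ?q W \<le> ennreal (2 * ?L2) * atlas_integral ?Lr N' ?q D * hausdorff1 ?Lr"
    proof (rule curve_inequality[OF ar PN(2) _ L2 PN(3) _ _ D(1)])
      fix x assume x: "x \<in> ?Lr"
      \<comment> \<open>The leaf through \<open>x\<close>. Its closure contains a boundary point,
        where \<open>w\<close> vanishes, so by continuity up to the boundary \<open>w\<close> takes
        arbitrarily small values on the leaf.\<close>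
      define \<Gamma> where "\<Gamma> = connected_component_set ?Lr x"
      have \<Gamma>: "\<Gamma> \<in> components ?Lr" "connected \<Gamma>" "x \<in> \<Gamma>" "\<Gamma> \<subseteq> ?Lr"
        unfolding \<Gamma>_def
        by (rule componentsI[OF x], rule connected_connected_component,
            rule CollectI, rule connected_component_refl[OF x], rule connected_component_subset)
      then have "closure \<Gamma> \<inter> frontier \<Omega> \<noteq> {}" using elim unfolding Sr by blast
      then obtain b where b: "b \<in> closure \<Gamma>" "b \<in> frontier \<Omega>" by blast
      have \<Gamma>c: "\<Gamma> \<subseteq> closure \<Omega>" using \<Gamma>(4) closure_subset by blast
      have wc: "continuous_on \<Gamma> w" using continuous_on_subset[OF w(1) \<Gamma>c] .
      have "\<exists>y\<in>\<Gamma>. \<bar>w y\<bar> < e" if e: "e > 0" for e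
      proof -
        have "b \<in> closure \<Omega>" using b(2) by (simp add: frontier_def)
        then obtain d where d: "d > 0" "\<And>y. y \<in> closure \<Omega> \<Longrightarrow> dist y b < d \<Longrightarrow> dist (w y) (w b) < e"
          using w(1) e unfolding continuous_on_iff by metis
        obtain y where "y \<in> \<Gamma>" "dist y b < d" using b(1) d(1) by (meson closure_approachable)
        then show ?thesis using d(2)[of y] \<Gamma>c w(2)[OF b(2)] by (auto simp: dist_real_def)
      qed
      then show "\<exists>\<Gamma>. connected \<Gamma> \<and> continuous_on \<Gamma> w \<and> x \<in> \<Gamma> \<and> \<Gamma> \<subseteq> ?Lr \<and> (\<forall>e>0. \<exists>y\<in>\<Gamma>. \<bar>w y\<bar> < e)"
        using \<Gamma> wc by blast
    next
      fix i x y assume xy: "x \<in> N' i \<inter> ?Lr" "y \<in> N' i \<inter> ?Lr"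
      have "\<bar>w x - w y\<bar> \<le> \<kappa> i * dist x y" using xy by (intro PN(7)) auto
      also have "\<dots> \<le> \<kappa> i * (?L2 * dist (?\<psi> i x) (?\<psi> i y))"
        using xy PN(3)[of i] by (intro mult_left_mono PN(5)) auto
      \<comment> \<open>Both points have the same value \<open>r\<close> of \<open>g\<close>, so the
        second coordinate contributes nothing.\<close>
      also have "dist (?\<psi> i x) (?\<psi> i y) = \<bar>x \<bullet> \<tau> i - y \<bullet> \<tau> i\<bar>"
        using xy by (simp add: dist_Pair_Pair dist_real_def)
      finally show "\<bar>w x - w y\<bar> \<le> ?L2 * \<kappa> i * \<bar>x \<bullet> \<tau> i - y \<bullet> \<tau> i\<bar>" by (simp add: mult_ac)
    next
      fix i x assume "x \<in> N' i \<inter> ?Lr"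
      then show "ennreal (\<kappa> i) \<le> D x" using PN(4)[of x i] D(2)[of x] by (auto intro!: ennreal_leI)
    next
      fix x assume "x \<in> ?Lr"
      then show "W x = ennreal \<bar>w x\<bar>" using W(2) by simp
    qed
    moreover have "hausdorff1 ?Lr \<le> ennreal K" unfolding Sr by (rule g(4))
    ultimately have "atlas_integral ?Lr N' ?q W \<le> ennreal (2 * ?L2) * atlas_integral ?Lr N' ?q D * ennreal K"
      by (meson mult_left_mono order_trans zero_le)
    then show ?case by (simp only: mult_ac)
  qed
  have "atlas_integral ?S N' ?\<psi> W = (\<integral>\<^sup>+r. atlas_integral {x \<in> ?S. g x = r} N' ?q W \<partial>lborel)"
    by (rule atlas_fubini(1)[OF at' W(1)])
  also have "\<dots> \<le> (\<integral>\<^sup>+r. ennreal (2 * ?L2) * ennreal K * atlas_integral {x \<in> ?S. g x = r} N' ?q D \<partial>lborel)"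
    by (rule nn_integral_mono_AE[OF 3])
  also have "\<dots> = ennreal (2 * ?L2) * ennreal K * (\<integral>\<^sup>+r. atlas_integral {x \<in> ?S. g x = r} N' ?q D \<partial>lborel)"
    using atlas_fubini(2)[OF at' D(1)] by (intro nn_integral_cmult) simp
  also have "(\<integral>\<^sup>+r. atlas_integral {x \<in> ?S. g x = r} N' ?q D \<partial>lborel) = atlas_integral ?S N' ?\<psi> D"
    by (rule atlas_fubini(1)[OF at' D(1), symmetric])
  finally have 4: "atlas_integral ?S N' ?\<psi> W \<le> ennreal (2 * ?L2) * ennreal K * atlas_integral ?S N' ?\<psi> D" .
  have "atlas_integral ?S N p W \<le> ?c * (ennreal (2 * ?L2) * ennreal K * (?c * atlas_integral ?S N p D))"
    using 1 2 4 by (meson mult_left_mono order_trans zero_le)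
  then show ?thesis by (simp add: power2_eq_square mult_ac)
qed

lemma nn_integral_chart_measure_id:
  assumes "compact N" "h \<in> borel_measurable borel"
  shows "(\<integral>\<^sup>+x. h x \<partial>chart_measure N (\<lambda>x. x)) = (\<integral>\<^sup>+x. h x * indicator N x \<partial>lborel)"
proof -
  have ch: "chart N (\<lambda>x. x)" using assms(1) by (simp add: chart_def)
  have "(\<integral>\<^sup>+x. h x \<partial>chart_measure N (\<lambda>x. x)) =
      (\<integral>\<^sup>+x. h (inv_into N (\<lambda>x. x) x) \<partial>restrict_space lborel N)"
    unfolding chart_measure_def using assms chart_inv_measurable(2)[OF ch]
    by (subst nn_integral_distr) auto
  also have "\<dots> = (\<integral>\<^sup>+x. h (inv_into N (\<lambda>x. x) x) * indicator N x \<partial>lborel)"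
    using assms(1) borel_compact by (intro nn_integral_restrict_space) auto
  also have "\<dots> = (\<integral>\<^sup>+x. h x * indicator N x \<partial>lborel)"
  proof (rule nn_integral_cong)
    fix x
    show "h (inv_into N (\<lambda>x. x) x) * indicator N x = h x * indicator N x"
      using inv_into_f_f[of "\<lambda>x. x" N x] by (cases "x \<in> N") (auto simp: inj_on_def)
  qed
  finally show ?thesis .
qed

text \<open>With the identity as chart, Lebesgue integration becomes an atlas integral, which
  \<open>atlas_integral_le\<close> can compare with the coordinates
  \<open>(p i x, v x)\<close>.\<close>

lemma atlas_integral_id:
  assumes at: "atlas S N (\<lambda>i x. x)" and sub: "\<And>i. N i \<subseteq> S" and h: "h \<in> borel_measurable borel"
  shows "atlas_integral S N (\<lambda>i x. x) h = (\<integral>\<^sup>+x. h x * indicator S x \<partial>lborel)"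
proof -
  have B[measurable]: "disjointed N i \<in> sets borel" for i by (rule disjointed_borel[OF at])
  note h[measurable]
  have NS: "N i \<inter> S = N i" for i using sub[of i] by blast
  have cp: "compact (N i)" for i using at unfolding atlas_def chart_def NS by blast
  have US: "(\<Union>i. N i) = S" using at sub by (auto simp: atlas_def)
  have "(\<integral>\<^sup>+x. h x * indicator (disjointed N i) x \<partial>chart_measure (N i \<inter> S) (\<lambda>x. x)) =
     (\<integral>\<^sup>+x. h x * indicator (disjointed N i) x \<partial>lborel)" for i
    unfolding NS
    by (subst nn_integral_chart_measure_id[OF cp])
       (use disjointed_subset[of N i] in \<open>auto intro!: nn_integral_cong split: split_indicator\<close>)
  then have "atlas_integral S N (\<lambda>i x. x) h = (\<Sum>i. \<integral>\<^sup>+x. h x * indicator (disjointed N i) x \<partial>lborel)"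
    unfolding atlas_integral_def by simp
  also have "\<dots> = (\<integral>\<^sup>+x. (\<Sum>i. h x * indicator (disjointed N i) x) \<partial>lborel)"
    by (rule nn_integral_suminf[symmetric]) measurable
  also have "\<dots> = (\<integral>\<^sup>+x. h x * indicator S x \<partial>lborel)"
    by (simp add: suminf_indicator_disjointed US)
  finally show ?thesis .
qed

text \<open>Each square is the cost of changing the atlas and changing back, in dimension 3 on
  \<open>\<Omega>\<close> and in dimension 2 on a level. The rest comes from
  \<open>curve_inequality\<close>, with \<open>K\<close> bounding the length.\<close>

definition foliation_const :: "real \<Rightarrow> real \<Rightarrow> real \<Rightarrow> real \<Rightarrow> real \<Rightarrow> ennreal" where
  "foliation_const c C cg Cg K =
     ennreal (distortion 3 (chart_const c C)) ^ 2 *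
     (ennreal (distortion 2 (chart_const c C * chart_const cg Cg)) ^ 2 * ennreal (2 * chart_const cg Cg) * ennreal K)"

text \<open>The analogue of \<open>surface_inequality\<close> one dimension higher, with
  \<open>v\<close> in the role of \<open>g\<close> and the identity in that of \<open>p\<close>.
  Since the same \<open>p i\<close> serve every level, both sides of the estimate on the levels are
  Borel in \<open>t\<close>.\<close>

lemma foliation_inequality_aux:
  fixes v w :: "real^3 \<Rightarrow> real"
  assumes op: "open \<Omega>" and C1: "C1_on \<Omega> v" "C1_on \<Omega> w"
    and G: "\<And>x. x \<in> \<Omega> \<Longrightarrow> c \<le> norm (grad v x) \<and> norm (grad v x) \<le> C" and c: "c > 0"
    and w: "continuous_on (closure \<Omega>) w" "\<And>x. x \<in> frontier \<Omega> \<Longrightarrow> w x = 0"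
    and fol: "level_sets_foliated \<Omega> cg Cg K v" and cg: "cg > 0" and \<epsilon>: "\<epsilon> > 0"
  shows "(\<integral>\<^sup>+x. ennreal \<bar>w x\<bar> * indicator \<Omega> x \<partial>lborel) \<le> foliation_const c C cg Cg K *
     (\<integral>\<^sup>+x. ennreal (norm (tangential (grad v x) (grad w x)) + 2 * \<epsilon>) * indicator \<Omega> x \<partial>lborel)"
proof (cases "\<Omega> = {}")
  case False
  let ?L = "chart_const c C"
  have "c \<le> C" using False G by fastforce
  then have L: "?L > 0" by (rule chart_const_pos[OF c])
  have Gne: "grad v x \<noteq> 0" if "x \<in> \<Omega>" for x using G[OF that] c by auto
  \<comment> \<open>The indicator makes \<open>W\<close> and \<open>D\<close> Borel on the whole
    space, as the gradients are controlled on \<open>\<Omega>\<close> only.\<close>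
  define W where "W x = ennreal (indicator \<Omega> x *\<^sub>R \<bar>w x\<bar>)" for x
  define D where "D x = ennreal (indicator \<Omega> x *\<^sub>R (norm (tangential (grad v x) (grad w x)) + 2 * \<epsilon>))" for x
  have "continuous_on \<Omega> (\<lambda>x. \<bar>w x\<bar>)"
    using C1_on_imp_continuous_on[OF C1(2)] by (intro continuous_intros)
  then have Wm: "W \<in> borel_measurable borel"
    unfolding W_def using op by (intro measurable_compose[OF borel_measurable_continuous_on_indicator]) auto
  have "continuous_on \<Omega> (\<lambda>x. norm (tangential (grad v x) (grad w x)) + 2 * \<epsilon>)"
    by (intro continuous_intros continuous_on_tangential C1 Gne)
  then have Dm: "D \<in> borel_measurable borel"
    unfolding D_def using op by (intro measurable_compose[OF borel_measurable_continuous_on_indicator]) auto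
  define P where "P B p \<longleftrightarrow> compact B \<and> B \<subseteq> \<Omega> \<and> continuous_on UNIV p \<and>
     (\<forall>x\<in>B. \<forall>y\<in>B. dist x y \<le> ?L * dist (p x, v x) (p y, v y) \<and>
       dist (p x, v x) (p y, v y) \<le> ?L * dist x y)" for B and p :: "real^3 \<Rightarrow> real \<times> real"
  have loc: "\<exists>\<rho>>0. \<exists>p. P (cball z \<rho>) p" if "z \<in> \<Omega>" for z
    using level_set_chart[OF op C1(1) that, of c C] G[OF that] c compact_cball unfolding P_def by blast
  obtain N :: "nat \<Rightarrow> (real^3) set" and p where N: "\<And>i. P (N i) (p i)" "\<And>i. compact (N i)" "\<Omega> \<subseteq> (\<Union>i. N i)"
    using small_ball_cover[OF False, of P] loc by blast
  have NO: "N i \<inter> \<Omega> = N i" "N i \<subseteq> \<Omega>" for i using N(1)[of i] by (auto simp: P_def)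
  have pl: "dist x y \<le> ?L * dist (p i x, v x) (p i y, v y)"
       "dist (p i x, v x) (p i y, v y) \<le> ?L * dist x y" if "x \<in> N i" "y \<in> N i" for i x y
    using N(1)[of i] that by (auto simp: P_def)
  let ?\<phi> = "\<lambda>i x. (p i x, v x)"
  have at0: "atlas \<Omega> N (\<lambda>i x. x)"
    unfolding atlas_def chart_def NO(1) using N(2,3) by (auto simp: compact_imp_closed)
  have at: "atlas \<Omega> N ?\<phi>"
    unfolding atlas_def chart_def NO(1)
  proof (intro conjI allI)
    fix i
    show "closed (N i)" using N(2) by (rule compact_imp_closed)
    show "compact (N i)" by (rule N(2))
    have "continuous_on UNIV (p i)" using N(1)[of i] by (simp add: P_def)
    then show "continuous_on (N i) (?\<phi> i)"
      using C1_on_imp_continuous_on[OF C1(1)] NO(2)[of i]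
      by (intro continuous_on_Pair) (auto intro: continuous_on_subset)
    show "inj_on (?\<phi> i) (N i)"
    proof (rule inj_onI)
      fix x y assume "x \<in> N i" "y \<in> N i" "?\<phi> i x = ?\<phi> i y"
      then show "x = y" using pl(1)[of x i y] by simp
    qed
  qed (rule N(3))
  have dim: "DIM((real \<times> real) \<times> real) = 3" by simp
  let ?c = "ennreal (distortion 3 ?L)"
  let ?B = "ennreal (distortion 2 (?L * chart_const cg Cg)) ^ 2 * ennreal (2 * chart_const cg Cg) * ennreal K"
  have 1: "atlas_integral \<Omega> N (\<lambda>i x. x) W \<le> ?c * atlas_integral \<Omega> N ?\<phi> W"
  proof -
    have "atlas_integral \<Omega> N (\<lambda>i x. x) W \<le>
        ennreal (distortion DIM(real^3) ?L) * atlas_integral \<Omega> N ?\<phi> W"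
    proof (rule atlas_integral_le[OF _ at0 at L _ Wm])
      fix i j x y assume "x \<in> N i \<inter> N j \<inter> \<Omega>" "y \<in> N i \<inter> N j \<inter> \<Omega>"
      then show "dist x y \<le> ?L * dist (?\<phi> j x) (?\<phi> j y)" by (intro pl(1)) auto
    qed simp
    then show ?thesis by simp
  qed
  have 2: "atlas_integral \<Omega> N ?\<phi> D \<le> ?c * atlas_integral \<Omega> N (\<lambda>i x. x) D"
  proof -
    have "atlas_integral \<Omega> N ?\<phi> D \<le>
        ennreal (distortion DIM((real \<times> real) \<times> real) ?L) * atlas_integral \<Omega> N (\<lambda>i x. x) D"
    proof (rule atlas_integral_le[OF _ at at0 L _ Dm])
      fix i j x y assume "x \<in> N i \<inter> N j \<inter> \<Omega>" "y \<in> N i \<inter> N j \<inter> \<Omega>"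
      then show "dist (?\<phi> i x) (?\<phi> i y) \<le> ?L * dist x y" by (intro pl(2)) auto
    qed simp
    then show ?thesis by (simp only: dim)
  qed
  have 3: "AE t in lborel. atlas_integral {x\<in>\<Omega>. v x = t} N p W \<le> ?B * atlas_integral {x\<in>\<Omega>. v x = t} N p D"
    using level_sets_foliatedD[OF fol]
  proof eventually_elim
    case (elim t)
    have ats: "atlas {x\<in>\<Omega>. v x = t} N p" by (rule atlas_slice[OF at])
    show ?case
    proof (cases "t \<in> v ` \<Omega>")
      case True
      then have f: "foliated_level \<Omega> cg Cg K v t" using elim by blast
      show ?thesis
      proof (rule surface_inequality[OF op C1 Gne w f cg ats L _ \<epsilon> Wm _ Dm])
        fix i x y assume xy: "x \<in> N i \<inter> {x\<in>\<Omega>. v x = t}" "y \<in> N i \<inter> {x\<in>\<Omega>. v x = t}"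
        have "dist (?\<phi> i x) (?\<phi> i y) = dist (p i x) (p i y)" using xy by (simp add: dist_Pair_Pair)
        then show "dist x y \<le> ?L * dist (p i x) (p i y) \<and> dist (p i x) (p i y) \<le> ?L * dist x y"
          using pl[of x i y] xy by simp
      qed (simp_all add: W_def D_def)
    next
      case False
      then have e: "{x\<in>\<Omega>. v x = t} = {}" by auto
      show ?thesis using atlas_integral_empty[of N p W] ats unfolding e by simp
    qed
  qed
  have "atlas_integral \<Omega> N ?\<phi> W = (\<integral>\<^sup>+t. atlas_integral {x\<in>\<Omega>. v x = t} N p W \<partial>lborel)"
    by (rule atlas_fubini(1)[OF at Wm])
  also have "\<dots> \<le> (\<integral>\<^sup>+t. ?B * atlas_integral {x\<in>\<Omega>. v x = t} N p D \<partial>lborel)"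
    by (rule nn_integral_mono_AE[OF 3])
  also have "\<dots> = ?B * (\<integral>\<^sup>+t. atlas_integral {x\<in>\<Omega>. v x = t} N p D \<partial>lborel)"
    using atlas_fubini(2)[OF at Dm] by (intro nn_integral_cmult) simp
  also have "(\<integral>\<^sup>+t. atlas_integral {x\<in>\<Omega>. v x = t} N p D \<partial>lborel) = atlas_integral \<Omega> N ?\<phi> D"
    by (rule atlas_fubini(1)[OF at Dm, symmetric])
  finally have 4: "atlas_integral \<Omega> N ?\<phi> W \<le> ?B * atlas_integral \<Omega> N ?\<phi> D" .
  have "atlas_integral \<Omega> N (\<lambda>i x. x) W \<le> ?c * (?B * (?c * atlas_integral \<Omega> N (\<lambda>i x. x) D))"
    using 1 2 4 by (meson mult_left_mono order_trans zero_le)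
  then have "atlas_integral \<Omega> N (\<lambda>i x. x) W \<le> foliation_const c C cg Cg K * atlas_integral \<Omega> N (\<lambda>i x. x) D"
    by (simp add: foliation_const_def power2_eq_square mult_ac)
  moreover have "(\<integral>\<^sup>+x. W x * indicator \<Omega> x \<partial>lborel) = (\<integral>\<^sup>+x. ennreal \<bar>w x\<bar> * indicator \<Omega> x \<partial>lborel)"
    by (intro nn_integral_cong) (simp add: W_def split: split_indicator)
  moreover have "(\<integral>\<^sup>+x. D x * indicator \<Omega> x \<partial>lborel) =
     (\<integral>\<^sup>+x. ennreal (norm (tangential (grad v x) (grad w x)) + 2 * \<epsilon>) * indicator \<Omega> x \<partial>lborel)"
    by (intro nn_integral_cong) (simp add: D_def split: split_indicator)
  ultimately show ?thesis
    by (simp only: atlas_integral_id[OF at0 NO(2) Wm] atlas_integral_id[OF at0 NO(2) Dm])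
qed simp

section \<open>First variation and alignment of the fluxes\<close>

lemma foliation_const_finite: "foliation_const c C cg Cg K < \<infinity>"
  unfolding foliation_const_def
  by (simp add: ennreal_mult_less_top power_less_top_ennreal)

text \<open>The margin \<epsilon> contributes a fixed multiple of \<epsilon> times the measure of
  \<open>\<Omega>\<close>, which is finite, and so disappears in the limit.\<close>

lemma foliation_inequality:
  fixes v w :: "real^3 \<Rightarrow> real"
  assumes op: "open \<Omega>" and bd: "bounded \<Omega>" and C1: "C1_on \<Omega> v" "C1_on \<Omega> w"
    and G: "\<And>x. x \<in> \<Omega> \<Longrightarrow> c \<le> norm (grad v x) \<and> norm (grad v x) \<le> C" and c: "c > 0"
    and w: "continuous_on (closure \<Omega>) w" "\<And>x. x \<in> frontier \<Omega> \<Longrightarrow> w x = 0"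
    and fol: "level_sets_foliated \<Omega> cg Cg K v" and cg: "cg > 0"
    and int: "integrable (lebesgue_on \<Omega>) (\<lambda>x. norm (tangential (grad v x) (grad w x)))"
      "integrable (lebesgue_on \<Omega>) (\<lambda>x. \<bar>w x\<bar>)"
  shows "(\<integral>x. \<bar>w x\<bar> \<partial>lebesgue_on \<Omega>) \<le> enn2real (foliation_const c C cg Cg K) *
     (\<integral>x. norm (tangential (grad v x) (grad w x)) \<partial>lebesgue_on \<Omega>)"
proof -
  let ?B = "enn2real (foliation_const c C cg Cg K)" and ?M = "lebesgue_on \<Omega>"
  let ?T = "\<lambda>x. norm (tangential (grad v x) (grad w x))"
  have \<Omega>: "\<Omega> \<in> lmeasurable" using bd op by (rule lmeasurable_open)
  interpret finite_measure ?M using \<Omega> by (rule finite_measure_lebesgue_on)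
  have B: "ennreal ?B = foliation_const c C cg Cg K"
    using foliation_const_finite by simp
  have nn: "(\<integral>\<^sup>+x. f x \<partial>?M) = (\<integral>\<^sup>+x. f x * indicator \<Omega> x \<partial>lborel)" for f
    using \<Omega> by (subst nn_integral_restrict_space) (auto simp: nn_integral_completion)
  have le: "(\<integral>x. \<bar>w x\<bar> \<partial>?M) \<le> ?B * ((\<integral>x. ?T x \<partial>?M) + 2 * \<epsilon> * measure ?M (space ?M))"
    if \<epsilon>: "\<epsilon> > 0" for \<epsilon>
  proof -
    have int2: "integrable ?M (\<lambda>x. ?T x + 2 * \<epsilon>)" using int by simp
    have "ennreal (\<integral>x. \<bar>w x\<bar> \<partial>?M) = (\<integral>\<^sup>+x. ennreal \<bar>w x\<bar> \<partial>?M)"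
      using int(2) by (intro nn_integral_eq_integral[symmetric]) auto
    also have "\<dots> \<le> foliation_const c C cg Cg K * (\<integral>\<^sup>+x. ennreal (?T x + 2 * \<epsilon>) \<partial>?M)"
      unfolding nn by (rule foliation_inequality_aux[OF op C1 G c w fol cg \<epsilon>])
    also have "(\<integral>\<^sup>+x. ennreal (?T x + 2 * \<epsilon>) \<partial>?M) = ennreal (\<integral>x. ?T x + 2 * \<epsilon> \<partial>?M)"
      using int2 \<epsilon> by (intro nn_integral_eq_integral) auto
    also have "(\<integral>x. ?T x + 2 * \<epsilon> \<partial>?M) = (\<integral>x. ?T x \<partial>?M) + 2 * \<epsilon> * measure ?M (space ?M)"
      using int(1) by (simp add: mult.commute)
    finally have "ennreal (\<integral>x. \<bar>w x\<bar> \<partial>?M) \<le> ennreal (?B * ((\<integral>x. ?T x \<partial>?M) + 2 * \<epsilon> * measure ?M (space ?M)))"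
      by (simp only: ennreal_mult'[OF enn2real_nonneg] B)
    moreover have "0 \<le> ?B * ((\<integral>x. ?T x \<partial>?M) + 2 * \<epsilon> * measure ?M (space ?M))"
      using \<epsilon> by (intro mult_nonneg_nonneg add_nonneg_nonneg) (auto intro!: integral_nonneg_AE)
    ultimately show ?thesis by (simp only: ennreal_le_iff)
  qed
  show ?thesis
  proof (rule field_le_epsilon)
    fix e :: real assume e: "e > 0"
    let ?m = "measure ?M (space ?M)"
    have pos: "2 * ?B * ?m + 1 > 0" by (simp add: add_nonneg_pos)
    define \<epsilon> where "\<epsilon> = e / (2 * ?B * ?m + 1)"
    have "\<epsilon> > 0" using e pos by (simp add: \<epsilon>_def)
    have "?B * (2 * \<epsilon> * ?m) = (2 * ?B * ?m) * \<epsilon>" by simp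
    also have "\<dots> \<le> (2 * ?B * ?m + 1) * \<epsilon>" using \<open>\<epsilon> > 0\<close> by (intro mult_right_mono) auto
    also have "\<dots> = e" using pos by (simp add: \<epsilon>_def)
    finally show "(\<integral>x. \<bar>w x\<bar> \<partial>?M) \<le> ?B * (\<integral>x. ?T x \<partial>?M) + e"
      using le[OF \<open>\<epsilon> > 0\<close>] by (simp add: distrib_left)
  qed
qed

section \<open>The variational inequality of a minimizer\<close>

text \<open>From 2 * |q| * |q + s d| \<le> |q|^2 + |q + s d|^2, expanded and divided by 2 * |q|. An
  explicit upper bound with quadratic remainder spares differentiation under the integral.\<close>

lemma norm_add_le_second_order:
  fixes q d :: "'a::real_inner"
  assumes "q \<noteq> 0"
  shows "norm (q + s *\<^sub>R d) \<le> norm q + s * ((q \<bullet> d) / norm q) + s\<^sup>2 * ((norm d)\<^sup>2 / (2 * norm q))"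
proof -
  have q: "norm q > 0" using assms by simp
  have "0 \<le> (norm (q + s *\<^sub>R d) - norm q)\<^sup>2" by simp
  then have "2 * norm q * norm (q + s *\<^sub>R d) \<le> (norm (q + s *\<^sub>R d))\<^sup>2 + (norm q)\<^sup>2"
    by (simp add: power2_diff mult_ac)
  also have "(norm (q + s *\<^sub>R d))\<^sup>2 = (norm q)\<^sup>2 + 2 * s * (q \<bullet> d) + s\<^sup>2 * (norm d)\<^sup>2"
    unfolding power2_norm_eq_inner
    by (simp add: inner_add_left inner_add_right inner_commute power2_eq_square algebra_simps)
  also have "\<dots> + (norm q)\<^sup>2 = 2 * norm q * (norm q + s * ((q \<bullet> d) / norm q) + s\<^sup>2 * ((norm d)\<^sup>2 / (2 * norm q)))"
    using q by (simp add: field_simps power2_eq_square)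
  finally show ?thesis using q by simp
qed

text \<open>The energy of the competitor is at least that of the minimizer and, by
  \<open>norm_add_le_second_order\<close>, at most that plus s * X + s^2 * Y. Dividing by
  \<open>s\<close> gives -(s * Y) \<le> X, and \<open>s\<close> tends to 0. The uniform bounds make
  every term integrable.\<close>

lemma (in finite_measure) minimality_first_variation:
  fixes q D :: "'a \<Rightarrow> 'b::euclidean_space" and a h u d :: "'a \<Rightarrow> real"
  assumes m[measurable]: "q \<in> borel_measurable M" "D \<in> borel_measurable M" "a \<in> borel_measurable M"
      "h \<in> borel_measurable M" "u \<in> borel_measurable M" "d \<in> borel_measurable M"
    and a: "AE x in M. 0 \<le> a x \<and> a x \<le> A" and h: "AE x in M. \<bar>h x\<bar> \<le> B"
    and q: "AE x in M. c \<le> norm (q x) \<and> norm (q x) \<le> Q" and c: "c > 0"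
    and D: "AE x in M. norm (D x) \<le> R" and u: "AE x in M. \<bar>u x\<bar> \<le> U" and d: "AE x in M. \<bar>d x\<bar> \<le> V"
    and min: "\<And>s. 0 < s \<Longrightarrow> s \<le> 1 \<Longrightarrow> (\<integral>x. a x * norm (q x) + h x * u x \<partial>M) \<le>
       (\<integral>x. a x * norm (q x + s *\<^sub>R D x) + h x * (u x + s * d x) \<partial>M)"
  shows "integrable M (\<lambda>x. a x * ((q x \<bullet> D x) / norm (q x)) + h x * d x)"
    and "0 \<le> (\<integral>x. a x * ((q x \<bullet> D x) / norm (q x)) + h x * d x \<partial>M)"
proof -
  have iu: "integrable M (\<lambda>x. h x * u x)"
    by (rule integrable_const_bound[where B="B * U"])
      (use h u in \<open>eventually_elim, auto simp: abs_mult intro!: mult_mono'\<close>, measurable)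
  have id: "integrable M (\<lambda>x. h x * d x)"
    by (rule integrable_const_bound[where B="B * V"])
      (use h d in \<open>eventually_elim, auto simp: abs_mult intro!: mult_mono'\<close>, measurable)
  have i0: "integrable M (\<lambda>x. a x * norm (q x))"
    by (rule integrable_const_bound[where B="A * Q"])
      (use a q in \<open>eventually_elim, auto simp: abs_mult intro!: mult_mono'\<close>, measurable)
  have iqs: "integrable M (\<lambda>x. a x * norm (q x + s *\<^sub>R D x))" for s
  proof (rule integrable_const_bound[where B="A * (Q + \<bar>s\<bar> * R)"])
    show "AE x in M. norm (a x * norm (q x + s *\<^sub>R D x)) \<le> A * (Q + \<bar>s\<bar> * R)"
      using a q D
    proof eventually_elim
      case (elim x)
      have "norm (q x + s *\<^sub>R D x) \<le> norm (q x) + \<bar>s\<bar> * norm (D x)"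
        using norm_triangle_ineq[of "q x" "s *\<^sub>R D x"] by simp
      also have "\<dots> \<le> Q + \<bar>s\<bar> * R" using elim by (intro add_mono mult_left_mono) auto
      finally show ?case using elim by (auto simp: abs_mult intro!: mult_mono')
    qed
  qed measurable
  have i1: "integrable M (\<lambda>x. a x * ((q x \<bullet> D x) / norm (q x)))"
  proof (rule integrable_const_bound[where B="A * R"])
    show "AE x in M. norm (a x * ((q x \<bullet> D x) / norm (q x))) \<le> A * R"
      using a q D
    proof eventually_elim
      case (elim x)
      have "\<bar>q x \<bullet> D x\<bar> \<le> norm (q x) * norm (D x)" by (rule Cauchy_Schwarz_ineq2)
      moreover have "norm (q x) > 0" using elim c by linarith
      ultimately have "\<bar>(q x \<bullet> D x) / norm (q x)\<bar> \<le> norm (D x)"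
        by (simp add: pos_divide_le_eq mult.commute)
      then have "\<bar>(q x \<bullet> D x) / norm (q x)\<bar> \<le> R" using elim by linarith
      then show ?case using elim unfolding real_norm_def abs_mult by (intro mult_mono') auto
    qed
  qed measurable
  have i2: "integrable M (\<lambda>x. a x * ((norm (D x))\<^sup>2 / (2 * norm (q x))))"
  proof (rule integrable_const_bound[where B="A * (R\<^sup>2 / (2 * c))"])
    show "AE x in M. norm (a x * ((norm (D x))\<^sup>2 / (2 * norm (q x)))) \<le> A * (R\<^sup>2 / (2 * c))"
      using a q D
    proof eventually_elim
      case (elim x)
      have "(norm (D x))\<^sup>2 / (2 * norm (q x)) \<le> R\<^sup>2 / (2 * c)"
        using elim c by (intro frac_le power_mono) auto
      moreover have "0 \<le> (norm (D x))\<^sup>2 / (2 * norm (q x))" by simp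
      ultimately show ?case
        using elim unfolding real_norm_def abs_mult by (intro mult_mono') simp_all
    qed
  qed measurable
  show int: "integrable M (\<lambda>x. a x * ((q x \<bullet> D x) / norm (q x)) + h x * d x)" using i1 id by simp
  define X where "X = (\<integral>x. a x * ((q x \<bullet> D x) / norm (q x)) + h x * d x \<partial>M)"
  define Y where "Y = (\<integral>x. a x * ((norm (D x))\<^sup>2 / (2 * norm (q x))) \<partial>M)"
  define f0 where "f0 x = a x * norm (q x) + h x * u x" for x
  define f1 where "f1 x = a x * ((q x \<bullet> D x) / norm (q x)) + h x * d x" for x
  define f2 where "f2 x = a x * ((norm (D x))\<^sup>2 / (2 * norm (q x)))" for x
  have f: "integrable M f0" "integrable M f1" "integrable M f2"
    using i0 iu int i2 unfolding f0_def f1_def f2_def by simp_all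
  have X: "- (s * Y) \<le> X" if s: "0 < s" "s \<le> 1" for s
  proof -
    have "(\<integral>x. a x * norm (q x) + h x * u x \<partial>M) \<le> (\<integral>x. a x * norm (q x + s *\<^sub>R D x) + h x * (u x + s * d x) \<partial>M)"
      by (rule min[OF s])
    also have "\<dots> \<le> (\<integral>x. f0 x + s * f1 x + s\<^sup>2 * f2 x \<partial>M)"
    proof (rule integral_mono_AE)
      have "integrable M (\<lambda>x. h x * u x + s * (h x * d x))" using iu id by simp
      then have "integrable M (\<lambda>x. h x * (u x + s * d x))" by (simp add: algebra_simps)
      then show "integrable M (\<lambda>x. a x * norm (q x + s *\<^sub>R D x) + h x * (u x + s * d x))" using iqs by simp
      show "integrable M (\<lambda>x. f0 x + s * f1 x + s\<^sup>2 * f2 x)" using f by simp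
      show "AE x in M. a x * norm (q x + s *\<^sub>R D x) + h x * (u x + s * d x) \<le> f0 x + s * f1 x + s\<^sup>2 * f2 x"
        using a q
      proof eventually_elim
        case (elim x)
        then have "q x \<noteq> 0" using c by auto
        then have "a x * norm (q x + s *\<^sub>R D x) \<le>
          a x * (norm (q x) + s * ((q x \<bullet> D x) / norm (q x)) + s\<^sup>2 * ((norm (D x))\<^sup>2 / (2 * norm (q x))))"
          using elim by (intro mult_left_mono norm_add_le_second_order) auto
        also have "\<dots> + h x * (u x + s * d x) = f0 x + s * f1 x + s\<^sup>2 * f2 x"
          unfolding f0_def f1_def f2_def by (simp only: distrib_left mult.left_commute add_ac)
        finally show ?case by simp
      qed
    qed
    also have "\<dots> = (\<integral>x. a x * norm (q x) + h x * u x \<partial>M) + s * X + s\<^sup>2 * Y"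
    proof -
      have e: "X = (\<integral>x. f1 x \<partial>M)" "Y = (\<integral>x. f2 x \<partial>M)"
        "(\<integral>x. a x * norm (q x) + h x * u x \<partial>M) = (\<integral>x. f0 x \<partial>M)"
        unfolding X_def Y_def f0_def f1_def f2_def by (rule refl)+
      show ?thesis unfolding e using f by simp
    qed
    finally have "0 \<le> s * (X + s * Y)" by (simp add: algebra_simps power2_eq_square)
    then show ?thesis using s by (simp add: zero_le_mult_iff)
  qed
  show "0 \<le> (\<integral>x. a x * ((q x \<bullet> D x) / norm (q x)) + h x * d x \<partial>M)"
    unfolding X_def[symmetric]
  proof (rule field_le_epsilon)
    fix e :: real assume e: "e > 0"
    \<comment> \<open>Makes s * Y at most \<open>e\<close> while staying in the range where
      minimality is assumed; the 1 in the denominator covers Y = 0.\<close>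
    define s where "s = min 1 (e / (\<bar>Y\<bar> + 1))"
    have s: "0 < s" "s \<le> 1" "s \<le> e / (\<bar>Y\<bar> + 1)" using e by (auto simp: s_def)
    have "s * Y \<le> s * (\<bar>Y\<bar> + 1)" using s by (intro mult_left_mono) auto
    also have "\<dots> \<le> e" using s(3) by (simp add: pos_le_divide_eq)
    finally show "0 \<le> X + e" using X[OF s(1,2)] by linarith
  qed
qed

section \<open>The angle between two gradients\<close>

text \<open>The left side, with fluxes of lengths \<alpha> and \<alpha>' along \<open>q\<close> and
  \<open>q'\<close>, is what two opposite first variations add up to. For equal nonnegative lengths
  only the angle term remains, and it has a sign.\<close>

lemma flux_monotonicity_identity:
  fixes q q' :: "'a::real_inner"
  assumes "q \<noteq> 0" "q' \<noteq> 0"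
  defines "\<theta> \<equiv> (q \<bullet> q') / (norm q * norm q')"
  shows "((\<alpha> / norm q) *\<^sub>R q - (\<alpha>' / norm q') *\<^sub>R q') \<bullet> (q' - q) =
    - ((1 - \<theta>) * (\<alpha> * norm q' + \<alpha>' * norm q)) + (\<alpha> - \<alpha>') * (norm q' - norm q)"
proof -
  have n: "norm q > 0" "norm q' > 0" using assms by auto
  have \<theta>: "q \<bullet> q' = \<theta> * (norm q * norm q')" using n by (simp add: \<theta>_def)
  have "((\<alpha> / norm q) *\<^sub>R q - (\<alpha>' / norm q') *\<^sub>R q') \<bullet> (q' - q) =
     \<alpha> / norm q * (q \<bullet> q') - \<alpha> / norm q * (norm q)\<^sup>2 - \<alpha>' / norm q' * (norm q')\<^sup>2 + \<alpha>' / norm q' * (q \<bullet> q')"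
    by (simp add: inner_diff_left inner_diff_right power2_norm_eq_inner inner_commute algebra_simps)
  also have "\<dots> = \<alpha> * norm q' * \<theta> - \<alpha> * norm q - \<alpha>' * norm q' + \<alpha>' * norm q * \<theta>"
    unfolding \<theta> using n by (simp add: power2_eq_square)
  finally show ?thesis by (simp add: algebra_simps)
qed

lemma norm_tangential_power2:
  fixes q b :: "'a::real_inner"
  assumes "q \<noteq> 0"
  shows "(norm (tangential q b))\<^sup>2 = (norm b)\<^sup>2 - (q \<bullet> b)\<^sup>2 / (norm q)\<^sup>2"
proof -
  define k where "k = (b \<bullet> q) / (norm q)\<^sup>2"
  have k: "k * (norm q)\<^sup>2 = b \<bullet> q" using assms by (simp add: k_def)
  have "(norm (tangential q b))\<^sup>2 = (b - k *\<^sub>R q) \<bullet> (b - k *\<^sub>R q)"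
    by (simp add: tangential_def k_def power2_norm_eq_inner)
  also have "\<dots> = (norm b)\<^sup>2 - 2 * k * (b \<bullet> q) + k * (k * (norm q)\<^sup>2)"
    unfolding power2_norm_eq_inner
    by (simp add: inner_diff_left inner_diff_right inner_commute algebra_simps)
  also have "\<dots> = (norm b)\<^sup>2 - k * (b \<bullet> q)" unfolding k by simp
  also have "k * (b \<bullet> q) = (q \<bullet> b)\<^sup>2 / (norm q)\<^sup>2"
    by (simp add: k_def power2_eq_square inner_commute)
  finally show ?thesis .
qed

text \<open>The squared norm is |q'|^2 (1 - \<theta>) (1 + \<theta>), where 1 + \<theta> \<le>
  2.\<close>

lemma norm_tangential_le:
  fixes q q' :: "'a::real_inner"
  assumes "q \<noteq> 0" "q' \<noteq> 0"
  shows "norm (tangential q q') \<le> sqrt 2 * norm q' * sqrt (1 - (q \<bullet> q') / (norm q * norm q'))"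
proof -
  define \<theta> where "\<theta> = (q \<bullet> q') / (norm q * norm q')"
  have n: "norm q > 0" "norm q' > 0" using assms by auto
  have qq: "q \<bullet> q' = \<theta> * (norm q * norm q')" using n by (simp add: \<theta>_def)
  have "\<bar>q \<bullet> q'\<bar> \<le> norm q * norm q'" by (rule Cauchy_Schwarz_ineq2)
  then have "\<bar>\<theta>\<bar> \<le> 1" using n by (simp add: \<theta>_def)
  then have t: "-1 \<le> \<theta>" "\<theta> \<le> 1" by auto
  have "(norm (tangential q q'))\<^sup>2 = (norm q')\<^sup>2 - (q \<bullet> q')\<^sup>2 / (norm q)\<^sup>2"
    by (rule norm_tangential_power2[OF assms(1)])
  also have "\<dots> = (norm q')\<^sup>2 * ((1 - \<theta>) * (1 + \<theta>))"
    unfolding qq using n by (simp add: field_simps power2_eq_square)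
  also have "\<dots> \<le> (norm q')\<^sup>2 * ((1 - \<theta>) * 2)" using t by (intro mult_left_mono) auto
  also have "\<dots> = (sqrt 2 * norm q' * sqrt (1 - \<theta>))\<^sup>2" using t by (simp add: power_mult_distrib)
  finally have sq: "(norm (tangential q q'))\<^sup>2 \<le> (sqrt 2 * norm q' * sqrt (1 - \<theta>))\<^sup>2" .
  have "0 \<le> sqrt 2 * norm q' * sqrt (1 - \<theta>)" using t by simp
  from power2_le_imp_le[OF sq this] show ?thesis by (simp only: \<theta>_def)
qed

lemma norm_tangential_le_norm: "norm (tangential q b) \<le> norm b"
proof (cases "q = 0")
  case False
  then have n: "norm q > 0" by simp
  have "(norm (tangential q b))\<^sup>2 = (norm b)\<^sup>2 - (q \<bullet> b)\<^sup>2 / (norm q)\<^sup>2"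
    by (rule norm_tangential_power2[OF False])
  also have "\<dots> \<le> (norm b)\<^sup>2" by simp
  finally show ?thesis by (rule power2_le_imp_le) simp
qed (simp add: tangential_def)

lemma tangential_diff: "tangential q (x - y) = tangential q x - tangential q y"
  by (simp add: tangential_def inner_diff_left diff_divide_distrib algebra_simps)

lemma tangential_self: "tangential q q = 0"
  by (cases "q = 0") (simp_all add: tangential_def power2_norm_eq_inner)

text \<open>In place of the Cauchy-Schwarz inequality, sqrt y \<le> l / 2 + y / (2 * l) is
  integrated with \<open>l\<close> the square root of the integral of \<open>f\<close>. Hence half
  of the total measure plus 1, instead of the square root of the measure.\<close>

lemma (in finite_measure) integral_sqrt_le:
  fixes f :: "'a \<Rightarrow> real"
  assumes f: "integrable M f" and nn: "AE x in M. 0 \<le> f x"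
  shows "integrable M (\<lambda>x. sqrt (f x))"
    and "(\<integral>x. sqrt (f x) \<partial>M) \<le> (measure M (space M) + 1) / 2 * sqrt (\<integral>x. f x \<partial>M)"
proof -
  have [measurable]: "f \<in> borel_measurable M" using f by simp
  have amgm: "sqrt y \<le> l / 2 + y / (2 * l)" if "l > 0" "y \<ge> 0" for l y :: real
  proof -
    have "0 \<le> (sqrt y - l)\<^sup>2" by simp
    then have "2 * l * sqrt y \<le> y + l\<^sup>2" using that by (simp add: power2_diff mult_ac)
    then show ?thesis using that by (simp add: field_simps power2_eq_square)
  qed
  show int: "integrable M (\<lambda>x. sqrt (f x))"
  proof (rule Bochner_Integration.integrable_bound[of _ "\<lambda>x. 1 / 2 + f x / 2"])
    show "AE x in M. norm (sqrt (f x)) \<le> norm (1 / 2 + f x / 2)"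
      using nn
    proof eventually_elim
      case (elim x)
      then show ?case using amgm[of 1 "f x"] by simp
    qed
  qed (use f in simp, measurable)
  let ?E = "\<integral>x. f x \<partial>M"
  have E0: "?E \<ge> 0" using nn by (rule integral_nonneg_AE)
  show "(\<integral>x. sqrt (f x) \<partial>M) \<le> (measure M (space M) + 1) / 2 * sqrt ?E"
  proof (cases "?E = 0")
    case True
    then have "AE x in M. f x = 0" using integral_nonneg_eq_0_iff_AE[OF f nn] by blast
    then have "AE x in M. sqrt (f x) = 0" by eventually_elim simp
    then have "(\<integral>x. sqrt (f x) \<partial>M) = 0" by (rule integral_eq_zero_AE)
    then show ?thesis using True by simp
  next
    case False
    define l where "l = sqrt ?E"
    have l: "l > 0" "l\<^sup>2 = ?E" using False E0 by (auto simp: l_def)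
    have "(\<integral>x. sqrt (f x) \<partial>M) \<le> (\<integral>x. l / 2 + f x / (2 * l) \<partial>M)"
    proof (rule integral_mono_AE)
      show "AE x in M. sqrt (f x) \<le> l / 2 + f x / (2 * l)"
        using nn by eventually_elim (rule amgm[OF l(1)])
    qed (use int f in auto)
    also have "\<dots> = measure M (space M) * (l / 2) + ?E / (2 * l)" using f by simp
    also have "?E / (2 * l) = l / 2" unfolding l(2)[symmetric] using l(1) by (simp add: power2_eq_square)
    finally show ?thesis unfolding l_def[symmetric] by (simp add: field_simps)
  qed
qed

section \<open>Linear combinations of differentiable, test and Sobolev functions\<close>

lemma grad_lincomb:
  fixes f g :: "'a::euclidean_space \<Rightarrow> real"
  assumes "f differentiable (at x)" "g differentiable (at x)"
  shows "grad (\<lambda>x. a * f x + b * g x) x = a *\<^sub>R grad f x + b *\<^sub>R grad g x"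
proof (rule grad_unique)
  show "((\<lambda>x. a * f x + b * g x) has_derivative (\<lambda>h. h \<bullet> (a *\<^sub>R grad f x + b *\<^sub>R grad g x))) (at x)"
    using has_derivative_grad[OF assms(1)] has_derivative_grad[OF assms(2)]
    by (auto intro!: derivative_eq_intros simp: inner_add_right)
qed

lemma C1_on_lincomb:
  assumes "C1_on \<Omega> f" "C1_on \<Omega> g"
  shows "C1_on \<Omega> (\<lambda>x. a * f x + b * g x)"
    and "\<And>x. x \<in> \<Omega> \<Longrightarrow> grad (\<lambda>x. a * f x + b * g x) x = a *\<^sub>R grad f x + b *\<^sub>R grad g x"
proof -
  have d: "f differentiable (at x)" "g differentiable (at x)" if "x \<in> \<Omega>" for x
    using assms that by (auto simp: C1_on_def)
  show g: "grad (\<lambda>x. a * f x + b * g x) x = a *\<^sub>R grad f x + b *\<^sub>R grad g x" if "x \<in> \<Omega>" for x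
    by (rule grad_lincomb[OF d[OF that]])
  have "continuous_on \<Omega> (\<lambda>x. a *\<^sub>R grad f x + b *\<^sub>R grad g x)"
    using assms unfolding C1_on_def by (intro continuous_intros) auto
  then have "continuous_on \<Omega> (grad (\<lambda>x. a * f x + b * g x))"
    using g by (simp cong: continuous_on_cong)
  moreover have "(\<lambda>x. a * f x + b * g x) differentiable (at x)" if "x \<in> \<Omega>" for x
    using d[OF that] by (intro derivative_intros)
  ultimately show "C1_on \<Omega> (\<lambda>x. a * f x + b * g x)" by (simp add: C1_on_def)
qed

lemma Ck_on_UNIV_lincomb:
  fixes f g :: "'a::euclidean_space \<Rightarrow> real"
  assumes "Ck_on k UNIV f" "Ck_on k UNIV g"
  shows "Ck_on k UNIV (\<lambda>x. a * f x + b * g x)"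
  using assms
proof (induction k arbitrary: f g)
  case 0
  then show ?case by (auto intro!: continuous_intros)
next
  case (Suc k)
  have d: "f differentiable (at x)" "g differentiable (at x)" for x using Suc.prems by auto
  have "(\<lambda>x. grad (\<lambda>x. a * f x + b * g x) x \<bullet> e) = (\<lambda>x. a * (grad f x \<bullet> e) + b * (grad g x \<bullet> e))" for e
    by (simp add: grad_lincomb[OF d] inner_add_left)
  moreover have "Ck_on k UNIV (\<lambda>x. a * (grad f x \<bullet> e) + b * (grad g x \<bullet> e))" for e
    using Suc.prems by (intro Suc.IH) auto
  moreover have "(\<lambda>x. a * f x + b * g x) differentiable (at x)" for x
    using d[of x] by (intro derivative_intros)
  ultimately show ?case by simp
qed

lemma test_function_C1:
  fixes \<phi> :: "'a::euclidean_space \<Rightarrow> real"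
  assumes "test_function \<Omega> \<phi>"
  shows "continuous_on UNIV \<phi>" "continuous_on UNIV (grad \<phi>)" "\<And>x. \<phi> differentiable (at x)"
proof -
  have C: "Ck_on k UNIV \<phi>" for k using assms by (simp add: test_function_def)
  show "continuous_on UNIV \<phi>" using C[of 0] by simp
  have C1: "(\<forall>x. \<phi> differentiable (at x)) \<and> (\<forall>e. continuous_on UNIV (\<lambda>x. grad \<phi> x \<bullet> e))"
    using C[of 1] by simp
  then show "\<And>x. \<phi> differentiable (at x)" by blast
  show "continuous_on UNIV (grad \<phi>)" using C1 by (subst continuous_on_componentwise) blast
qed

lemma test_function_lincomb:
  assumes "test_function \<Omega> \<phi>" "test_function \<Omega> \<psi>"
  shows "test_function \<Omega> (\<lambda>x. a * \<phi> x + b * \<psi> x)"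
proof -
  let ?A = "closure {x. \<phi> x \<noteq> 0}" and ?B = "closure {x. \<psi> x \<noteq> 0}"
  let ?C = "closure {x. a * \<phi> x + b * \<psi> x \<noteq> 0}"
  have "{x. a * \<phi> x + b * \<psi> x \<noteq> 0} \<subseteq> {x. \<phi> x \<noteq> 0} \<union> {x. \<psi> x \<noteq> 0}" by auto
  then have sub: "?C \<subseteq> ?A \<union> ?B" unfolding closure_Un[symmetric] by (rule closure_mono)
  have AB: "compact ?A" "?A \<subseteq> \<Omega>" "compact ?B" "?B \<subseteq> \<Omega>" using assms by (auto simp: test_function_def)
  have "compact ((?A \<union> ?B) \<inter> ?C)" using AB by (intro compact_Int_closed compact_Un) auto
  moreover have "(?A \<union> ?B) \<inter> ?C = ?C" using sub by blast
  ultimately have "compact ?C" by simp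
  moreover have "?C \<subseteq> \<Omega>" using sub AB by blast
  ultimately show ?thesis
    unfolding test_function_def
    using Ck_on_UNIV_lincomb[of _ \<phi> \<psi> a b] assms by (simp add: test_function_def)
qed

lemma norm_lincomb_power2_le:
  fixes x y :: "'b::real_inner"
  shows "(norm (a *\<^sub>R x + b *\<^sub>R y))\<^sup>2 \<le> 2 * a\<^sup>2 * (norm x)\<^sup>2 + 2 * b\<^sup>2 * (norm y)\<^sup>2"
proof -
  have "(norm (a *\<^sub>R x + b *\<^sub>R y))\<^sup>2 \<le> (norm (a *\<^sub>R x) + norm (b *\<^sub>R y))\<^sup>2"
    by (intro power_mono norm_triangle_ineq) simp
  also have "\<dots> \<le> 2 * (norm (a *\<^sub>R x))\<^sup>2 + 2 * (norm (b *\<^sub>R y))\<^sup>2"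
    using sum_squares_ge_zero[of "norm (a *\<^sub>R x) - norm (b *\<^sub>R y)" 0]
    by (simp add: power2_eq_square algebra_simps)
  finally show ?thesis by (simp add: power_mult_distrib mult.assoc)
qed

lemma L2_on_lincomb:
  fixes f g :: "'a::euclidean_space \<Rightarrow> 'b::euclidean_space"
  assumes "L2_on \<Omega> f" "L2_on \<Omega> g"
  shows "L2_on \<Omega> (\<lambda>x. a *\<^sub>R f x + b *\<^sub>R g x)"
proof -
  have [measurable]: "f \<in> borel_measurable (lebesgue_on \<Omega>)" "g \<in> borel_measurable (lebesgue_on \<Omega>)"
    using assms by (auto simp: L2_on_def)
  have "integrable (lebesgue_on \<Omega>) (\<lambda>x. 2 * a\<^sup>2 * (norm (f x))\<^sup>2 + 2 * b\<^sup>2 * (norm (g x))\<^sup>2)"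
    using assms by (simp add: L2_on_def)
  then have "integrable (lebesgue_on \<Omega>) (\<lambda>x. (norm (a *\<^sub>R f x + b *\<^sub>R g x))\<^sup>2)"
    by (rule Bochner_Integration.integrable_bound) (measurable, simp add: norm_lincomb_power2_le)
  then show ?thesis unfolding L2_on_def by simp
qed

lemma continuous_bounded_on_bounded:
  fixes f :: "'a::euclidean_space \<Rightarrow> 'b::real_normed_vector"
  assumes "bounded \<Omega>" "continuous_on UNIV f"
  obtains B where "\<And>x. x \<in> \<Omega> \<Longrightarrow> norm (f x) \<le> B"
proof -
  have "compact (f ` closure \<Omega>)"
    using assms by (intro compact_continuous_image) (auto intro: continuous_on_subset)
  then have "bounded (f ` closure \<Omega>)" by (rule compact_imp_bounded)
  then obtain B where "\<forall>y\<in>f ` closure \<Omega>. norm y \<le> B" unfolding bounded_iff by blast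
  then show ?thesis using that closure_subset by blast
qed

lemma continuous_L2_on:
  fixes f :: "'a::euclidean_space \<Rightarrow> 'b::euclidean_space"
  assumes "\<Omega> \<in> lmeasurable" "bounded \<Omega>" "continuous_on UNIV f"
  shows "L2_on \<Omega> f"
proof -
  interpret finite_measure "lebesgue_on \<Omega>" using assms(1) by (rule finite_measure_lebesgue_on)
  obtain B where B: "\<And>x. x \<in> \<Omega> \<Longrightarrow> norm (f x) \<le> B"
    by (rule continuous_bounded_on_bounded[OF assms(2,3)]) blast
  have f[measurable]: "f \<in> borel_measurable (lebesgue_on \<Omega>)"
    using assms continuous_on_subset by (intro continuous_imp_measurable_on_sets_lebesgue) auto
  have "integrable (lebesgue_on \<Omega>) (\<lambda>x. (norm (f x))\<^sup>2)"
    by (rule integrable_const_bound[where B="B\<^sup>2"])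
      (auto intro!: AE_I2 power_mono B)
  then show ?thesis using f by (simp add: L2_on_def)
qed

lemma L2_on_imp_integrable:
  fixes f :: "'a::euclidean_space \<Rightarrow> 'b::euclidean_space"
  assumes "\<Omega> \<in> lmeasurable" "L2_on \<Omega> f"
  shows "integrable (lebesgue_on \<Omega>) f"
proof -
  interpret finite_measure "lebesgue_on \<Omega>" using assms(1) by (rule finite_measure_lebesgue_on)
  have "norm y \<le> norm (1 + (norm y)\<^sup>2)" for y :: 'b
    using sum_squares_ge_zero[of "norm y - 1" 0] by (simp add: power2_eq_square algebra_simps) (smt (verit) mult_nonneg_nonneg norm_ge_zero)
  moreover have "integrable (lebesgue_on \<Omega>) (\<lambda>x. 1 + (norm (f x))\<^sup>2)" using assms by (simp add: L2_on_def)
  ultimately show ?thesis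
    using assms(2) by (intro Bochner_Integration.integrable_bound[of _ "\<lambda>x. 1 + (norm (f x))\<^sup>2" f]) (auto simp: L2_on_def)
qed

lemma integrable_scaleR_bounded:
  fixes f :: "'a \<Rightarrow> real" and g :: "'a \<Rightarrow> 'b::euclidean_space"
  assumes g: "g \<in> borel_measurable M" "\<And>x. x \<in> space M \<Longrightarrow> norm (g x) \<le> B" and f: "integrable M f"
  shows "integrable M (\<lambda>x. f x *\<^sub>R g x)"
proof (rule Bochner_Integration.integrable_bound[of _ "\<lambda>x. B * f x"])
  show "AE x in M. norm (f x *\<^sub>R g x) \<le> norm (B * f x)"
  proof (rule AE_I2)
    fix x assume x: "x \<in> space M"
    have "\<bar>f x\<bar> * norm (g x) \<le> \<bar>f x\<bar> * \<bar>B\<bar>" using g(2)[OF x] by (intro mult_left_mono) auto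
    then show "norm (f x *\<^sub>R g x) \<le> norm (B * f x)" by (simp add: abs_mult mult.commute)
  qed
qed (use f g in auto)

lemma integrable_bounded_scaleR:
  fixes f :: "'a \<Rightarrow> real" and g :: "'a \<Rightarrow> 'b::euclidean_space"
  assumes f: "f \<in> borel_measurable M" "\<And>x. x \<in> space M \<Longrightarrow> norm (f x) \<le> B" and g: "integrable M g"
  shows "integrable M (\<lambda>x. f x *\<^sub>R g x)"
proof (rule Bochner_Integration.integrable_bound[of _ "\<lambda>x. B *\<^sub>R g x"])
  show "AE x in M. norm (f x *\<^sub>R g x) \<le> norm (B *\<^sub>R g x)"
  proof (rule AE_I2)
    fix x assume x: "x \<in> space M"
    have "\<bar>f x\<bar> * norm (g x) \<le> \<bar>B\<bar> * norm (g x)" using f(2)[OF x] by (intro mult_right_mono) auto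
    then show "norm (f x *\<^sub>R g x) \<le> norm (B *\<^sub>R g x)" by simp
  qed
qed (use f g in auto)

lemma integral_lincomb:
  fixes f g :: "'a \<Rightarrow> 'b::euclidean_space"
  assumes "integrable M f" "integrable M g"
  shows "(\<integral>x. a *\<^sub>R f x + b *\<^sub>R g x \<partial>M) = a *\<^sub>R (\<integral>x. f x \<partial>M) + b *\<^sub>R (\<integral>x. g x \<partial>M)"
  using assms by simp

text \<open>Makes u + s (u' - u) a legitimate competitor. The approximating test functions are
  combined in the same way, and the errors are controlled by
  \<open>norm_lincomb_power2_le\<close>.\<close>

lemma in_H10_lincomb:
  fixes \<Omega> :: "'a::euclidean_space set"
  assumes \<Omega>: "\<Omega> \<in> lmeasurable" "bounded \<Omega>" and w: "in_H10 \<Omega> w G" and w': "in_H10 \<Omega> w' G'"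
  shows "in_H10 \<Omega> (\<lambda>x. a * w x + b * w' x) (\<lambda>x. a *\<^sub>R G x + b *\<^sub>R G' x)"
proof -
  let ?M = "lebesgue_on \<Omega>"
  have L2: "L2_on \<Omega> w" "L2_on \<Omega> G" "L2_on \<Omega> w'" "L2_on \<Omega> G'"
    using w w' by (auto simp: in_H10_def in_H1_def)
  have L2w: "L2_on \<Omega> (\<lambda>x. a * w x + b * w' x)" using L2_on_lincomb[OF L2(1,3), of a b] by simp
  have L2G: "L2_on \<Omega> (\<lambda>x. a *\<^sub>R G x + b *\<^sub>R G' x)" by (rule L2_on_lincomb[OF L2(2,4)])
  note int = L2(1,3)[THEN L2_on_imp_integrable[OF \<Omega>(1)]] L2(2,4)[THEN L2_on_imp_integrable[OF \<Omega>(1)]]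
  have parts: "(\<integral>x. (a * w x + b * w' x) *\<^sub>R grad \<phi> x \<partial>?M) = - (\<integral>x. \<phi> x *\<^sub>R (a *\<^sub>R G x + b *\<^sub>R G' x) \<partial>?M)"
    if \<phi>: "test_function \<Omega> \<phi>" for \<phi>
  proof -
    note c = test_function_C1[OF \<phi>]
    have m: "\<phi> \<in> borel_measurable ?M" "grad \<phi> \<in> borel_measurable ?M"
      using c(1,2) \<Omega>(1) continuous_on_subset by (auto intro!: continuous_imp_measurable_on_sets_lebesgue)
    obtain B1 where B1: "\<And>x. x \<in> \<Omega> \<Longrightarrow> norm (\<phi> x) \<le> B1" by (rule continuous_bounded_on_bounded[OF \<Omega>(2) c(1)]) blast
    obtain B2 where B2: "\<And>x. x \<in> \<Omega> \<Longrightarrow> norm (grad \<phi> x) \<le> B2" by (rule continuous_bounded_on_bounded[OF \<Omega>(2) c(2)]) blast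
    have i: "integrable ?M (\<lambda>x. w x *\<^sub>R grad \<phi> x)" "integrable ?M (\<lambda>x. w' x *\<^sub>R grad \<phi> x)"
      using int(1,2) B2 by (auto intro!: integrable_scaleR_bounded[OF m(2), where B=B2])
    have j: "integrable ?M (\<lambda>x. \<phi> x *\<^sub>R G x)" "integrable ?M (\<lambda>x. \<phi> x *\<^sub>R G' x)"
      using int(3,4) B1 by (auto intro!: integrable_bounded_scaleR[OF m(1), where B=B1])
    have e: "(\<integral>x. w x *\<^sub>R grad \<phi> x \<partial>?M) = - (\<integral>x. \<phi> x *\<^sub>R G x \<partial>?M)"
      "(\<integral>x. w' x *\<^sub>R grad \<phi> x \<partial>?M) = - (\<integral>x. \<phi> x *\<^sub>R G' x \<partial>?M)"
      using w w' \<phi> by (auto simp: in_H10_def in_H1_def)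
    have "(\<integral>x. (a * w x + b * w' x) *\<^sub>R grad \<phi> x \<partial>?M) =
        (\<integral>x. a *\<^sub>R (w x *\<^sub>R grad \<phi> x) + b *\<^sub>R (w' x *\<^sub>R grad \<phi> x) \<partial>?M)"
      by (simp add: scaleR_add_left)
    also have "\<dots> = a *\<^sub>R (\<integral>x. w x *\<^sub>R grad \<phi> x \<partial>?M) + b *\<^sub>R (\<integral>x. w' x *\<^sub>R grad \<phi> x \<partial>?M)"
      by (rule integral_lincomb[OF i])
    also have "\<dots> = - (a *\<^sub>R (\<integral>x. \<phi> x *\<^sub>R G x \<partial>?M) + b *\<^sub>R (\<integral>x. \<phi> x *\<^sub>R G' x \<partial>?M))"
      unfolding e by simp
    also have "a *\<^sub>R (\<integral>x. \<phi> x *\<^sub>R G x \<partial>?M) + b *\<^sub>R (\<integral>x. \<phi> x *\<^sub>R G' x \<partial>?M) =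
        (\<integral>x. a *\<^sub>R (\<phi> x *\<^sub>R G x) + b *\<^sub>R (\<phi> x *\<^sub>R G' x) \<partial>?M)"
      by (rule integral_lincomb[OF j, symmetric])
    also have "\<dots> = (\<integral>x. \<phi> x *\<^sub>R (a *\<^sub>R G x + b *\<^sub>R G' x) \<partial>?M)"
      by (simp add: scaleR_add_right mult.commute)
    finally show ?thesis .
  qed
  obtain \<phi> where \<phi>: "\<And>k. test_function \<Omega> (\<phi> k)"
      "(\<lambda>k. \<integral>x. (w x - \<phi> k x)\<^sup>2 + (norm (G x - grad (\<phi> k) x))\<^sup>2 \<partial>?M) \<longlonglongrightarrow> 0"
    using w by (auto simp: in_H10_def)
  obtain \<psi> where \<psi>: "\<And>k. test_function \<Omega> (\<psi> k)"
      "(\<lambda>k. \<integral>x. (w' x - \<psi> k x)\<^sup>2 + (norm (G' x - grad (\<psi> k) x))\<^sup>2 \<partial>?M) \<longlonglongrightarrow> 0"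
    using w' by (auto simp: in_H10_def)
  let ?\<chi> = "\<lambda>k x. a * \<phi> k x + b * \<psi> k x"
  have \<chi>: "test_function \<Omega> (?\<chi> k)" for k by (rule test_function_lincomb[OF \<phi>(1) \<psi>(1)])
  \<comment> \<open>Test functions and their gradients are bounded on \<open>\<Omega>\<close>, so
    the errors are square integrable. Comparing the Bochner integrals below rests on this, because
    the integral of a non-integrable function is 0.\<close>
  have dif: "integrable ?M (\<lambda>x. (w x - \<phi> x)\<^sup>2 + (norm (G x - grad \<phi> x))\<^sup>2)"
    if "L2_on \<Omega> w" "L2_on \<Omega> G" "test_function \<Omega> \<phi>" for w G and \<phi> :: "'a \<Rightarrow> real"
  proof -
    note c = test_function_C1[OF that(3)]
    have "L2_on \<Omega> (\<lambda>x. w x - \<phi> x)"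
      using L2_on_lincomb[OF that(1) continuous_L2_on[OF \<Omega> c(1)], of 1 "-1"] by simp
    moreover have "L2_on \<Omega> (\<lambda>x. G x - grad \<phi> x)"
      using L2_on_lincomb[OF that(2) continuous_L2_on[OF \<Omega> c(2)], of 1 "-1"] by simp
    ultimately show ?thesis by (simp add: L2_on_def)
  qed
  define I where "I k = (\<integral>x. (w x - \<phi> k x)\<^sup>2 + (norm (G x - grad (\<phi> k) x))\<^sup>2 \<partial>?M)" for k
  define I' where "I' k = (\<integral>x. (w' x - \<psi> k x)\<^sup>2 + (norm (G' x - grad (\<psi> k) x))\<^sup>2 \<partial>?M)" for k
  define Z where "Z k = (\<integral>x. (a * w x + b * w' x - ?\<chi> k x)\<^sup>2 +
      (norm (a *\<^sub>R G x + b *\<^sub>R G' x - grad (?\<chi> k) x))\<^sup>2 \<partial>?M)" for k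
  have Zle: "Z k \<le> 2 * a\<^sup>2 * I k + 2 * b\<^sup>2 * I' k" for k
  proof -
    have i: "integrable ?M (\<lambda>x. 2 * a\<^sup>2 * ((w x - \<phi> k x)\<^sup>2 + (norm (G x - grad (\<phi> k) x))\<^sup>2))"
      "integrable ?M (\<lambda>x. 2 * b\<^sup>2 * ((w' x - \<psi> k x)\<^sup>2 + (norm (G' x - grad (\<psi> k) x))\<^sup>2))"
      by (intro integrable_mult_right dif[OF L2(1,2) \<phi>(1)], intro integrable_mult_right dif[OF L2(3,4) \<psi>(1)])
    have "Z k \<le> (\<integral>x. 2 * a\<^sup>2 * ((w x - \<phi> k x)\<^sup>2 + (norm (G x - grad (\<phi> k) x))\<^sup>2) +
        2 * b\<^sup>2 * ((w' x - \<psi> k x)\<^sup>2 + (norm (G' x - grad (\<psi> k) x))\<^sup>2) \<partial>?M)"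
      unfolding Z_def
    proof (rule integral_mono)
      show "integrable ?M (\<lambda>x. (a * w x + b * w' x - ?\<chi> k x)\<^sup>2 +
          (norm (a *\<^sub>R G x + b *\<^sub>R G' x - grad (?\<chi> k) x))\<^sup>2)"
        by (rule dif[OF L2w L2G \<chi>])
      show "integrable ?M (\<lambda>x. 2 * a\<^sup>2 * ((w x - \<phi> k x)\<^sup>2 + (norm (G x - grad (\<phi> k) x))\<^sup>2) +
        2 * b\<^sup>2 * ((w' x - \<psi> k x)\<^sup>2 + (norm (G' x - grad (\<psi> k) x))\<^sup>2))"
        by (rule Bochner_Integration.integrable_add[OF i])
      fix x
      have g: "grad (?\<chi> k) x = a *\<^sub>R grad (\<phi> k) x + b *\<^sub>R grad (\<psi> k) x"
        by (rule grad_lincomb[OF test_function_C1(3)[OF \<phi>(1)] test_function_C1(3)[OF \<psi>(1)]])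
      have 1: "(a * w x + b * w' x - ?\<chi> k x)\<^sup>2 \<le> 2 * a\<^sup>2 * (w x - \<phi> k x)\<^sup>2 + 2 * b\<^sup>2 * (w' x - \<psi> k x)\<^sup>2"
      proof -
        have "a * w x + b * w' x - ?\<chi> k x = a *\<^sub>R (w x - \<phi> k x) + b *\<^sub>R (w' x - \<psi> k x)"
          by (simp add: algebra_simps)
        then show ?thesis using norm_lincomb_power2_le[of a "w x - \<phi> k x" b "w' x - \<psi> k x"] by simp
      qed
      have 2: "(norm (a *\<^sub>R G x + b *\<^sub>R G' x - grad (?\<chi> k) x))\<^sup>2 \<le>
          2 * a\<^sup>2 * (norm (G x - grad (\<phi> k) x))\<^sup>2 + 2 * b\<^sup>2 * (norm (G' x - grad (\<psi> k) x))\<^sup>2"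
      proof -
        have "a *\<^sub>R G x + b *\<^sub>R G' x - grad (?\<chi> k) x =
          a *\<^sub>R (G x - grad (\<phi> k) x) + b *\<^sub>R (G' x - grad (\<psi> k) x)"
          unfolding g by (simp add: algebra_simps)
        then show ?thesis using norm_lincomb_power2_le[of a "G x - grad (\<phi> k) x" b "G' x - grad (\<psi> k) x"] by simp
      qed
      show "(a * w x + b * w' x - ?\<chi> k x)\<^sup>2 + (norm (a *\<^sub>R G x + b *\<^sub>R G' x - grad (?\<chi> k) x))\<^sup>2 \<le>
        2 * a\<^sup>2 * ((w x - \<phi> k x)\<^sup>2 + (norm (G x - grad (\<phi> k) x))\<^sup>2) +
        2 * b\<^sup>2 * ((w' x - \<psi> k x)\<^sup>2 + (norm (G' x - grad (\<psi> k) x))\<^sup>2)"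
        using add_mono[OF 1 2] by (simp only: distrib_left add_ac)
    qed
    also have "\<dots> = 2 * a\<^sup>2 * I k + 2 * b\<^sup>2 * I' k"
      unfolding I_def I'_def by (subst Bochner_Integration.integral_add[OF i]) (simp only: integral_mult_right_zero)
    finally show ?thesis .
  qed
  have "(\<lambda>k. 2 * a\<^sup>2 * I k + 2 * b\<^sup>2 * I' k) \<longlonglongrightarrow> 2 * a\<^sup>2 * 0 + 2 * b\<^sup>2 * 0"
    using \<phi>(2) \<psi>(2) unfolding I_def[symmetric] I'_def[symmetric] by (intro tendsto_intros)
  then have lim: "(\<lambda>k. 2 * a\<^sup>2 * I k + 2 * b\<^sup>2 * I' k) \<longlonglongrightarrow> 0" by simp
  have "Z \<longlonglongrightarrow> 0"
  proof (rule tendsto_sandwich[OF _ _ tendsto_const lim])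
    show "\<forall>\<^sub>F k in sequentially. 0 \<le> Z k" unfolding Z_def by (intro always_eventually allI integral_nonneg_AE) auto
    show "\<forall>\<^sub>F k in sequentially. Z k \<le> 2 * a\<^sup>2 * I k + 2 * b\<^sup>2 * I' k" using Zle by (intro always_eventually allI)
  qed
  then show ?thesis
    unfolding in_H10_def in_H1_def Z_def using L2w L2G parts \<chi>
    by (intro conjI allI impI exI[of _ "\<lambda>k. ?\<chi> k"]) auto
qed

section \<open>From differences of the data to the alignment of the gradients\<close>

text \<open>\<open>Linf_norm\<close> goes through \<open>enn2real\<close>, which sends an infinite
  supremum to 0; the finiteness in \<open>Linf_on\<close> rules that out.\<close>

lemma AE_le_Linf_norm:
  assumes "Linf_on \<Omega> f"
  shows "AE x in lebesgue_on \<Omega>. \<bar>f x\<bar> \<le> Linf_norm \<Omega> f"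
proof -
  let ?e = "esssup (lebesgue_on \<Omega>) (\<lambda>x. ennreal \<bar>f x\<bar>)"
  have "?e < top" using assms by (simp add: Linf_on_def)
  then have e: "?e = ennreal (Linf_norm \<Omega> f)" by (simp add: Linf_norm_def)
  have "AE x in lebesgue_on \<Omega>. ennreal \<bar>f x\<bar> \<le> ?e" by (rule esssup_AE)
  then show ?thesis unfolding e by eventually_elim (simp add: Linf_norm_def)
qed

lemma Linf_on_diff:
  assumes f: "Linf_on \<Omega> f" and g: "Linf_on \<Omega> g"
  shows "Linf_on \<Omega> (\<lambda>x. f x - g x)"
proof -
  have [measurable]: "f \<in> borel_measurable (lebesgue_on \<Omega>)" "g \<in> borel_measurable (lebesgue_on \<Omega>)"
    using assms by (auto simp: Linf_on_def)
  have "AE x in lebesgue_on \<Omega>. ennreal \<bar>f x - g x\<bar> \<le> ennreal (Linf_norm \<Omega> f + Linf_norm \<Omega> g)"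
    using AE_le_Linf_norm[OF f] AE_le_Linf_norm[OF g] by eventually_elim (intro ennreal_leI, linarith)
  then have "esssup (lebesgue_on \<Omega>) (\<lambda>x. ennreal \<bar>f x - g x\<bar>) \<le> ennreal (Linf_norm \<Omega> f + Linf_norm \<Omega> g)"
    by (intro esssup_I) measurable
  also have "\<dots> < top" by simp
  finally show ?thesis by (simp add: Linf_on_def)
qed

text \<open>Division by 0 gives 0 for a zero vector, so the bound by 1 holds without excluding
  zeros.\<close>

definition cosine :: "'a::real_inner \<Rightarrow> 'a \<Rightarrow> real" where
  "cosine q q' = (q \<bullet> q') / (norm q * norm q')"

lemma cosine_bounds: "\<bar>cosine q q'\<bar> \<le> 1"
proof (cases "q = 0 \<or> q' = 0")
  case False
  then have "norm q * norm q' > 0" by simp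
  then show ?thesis using Cauchy_Schwarz_ineq2[of q q'] by (simp add: cosine_def abs_div_pos[symmetric])
qed (auto simp: cosine_def)

lemma cosine_measurable [measurable]:
  fixes q q' :: "'a \<Rightarrow> 'b::euclidean_space"
  assumes "q \<in> borel_measurable M" "q' \<in> borel_measurable M"
  shows "(\<lambda>x. cosine (q x) (q' x)) \<in> borel_measurable M"
  using assms unfolding cosine_def by measurable

lemma (in finite_measure) integrable_one_minus_cosine:
  fixes q q' :: "'a \<Rightarrow> 'b::euclidean_space"
  assumes [measurable]: "q \<in> borel_measurable M" "q' \<in> borel_measurable M"
  shows "integrable M (\<lambda>x. 1 - cosine (q x) (q' x))"
  by (rule integrable_const_bound[where B=2])
    (use cosine_bounds[of "q _" "q' _"] in \<open>auto intro!: AE_I2 simp: abs_le_iff\<close>)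

text \<open>The direction of variation is q' - q - \<Phi>, with \<Phi> the change of the force.
  \<Phi> is split off and paired with the flux difference \<open>J\<close>, of norm at most 2 * A;
  the rest is \<open>flux_monotonicity_identity\<close>, whose weight a * norm q' + a' * norm q is
  at least 2 * m * c.\<close>

lemma flux_variation_le:
  fixes q q' \<Phi> :: "'a::real_inner"
  assumes a: "m \<le> a" "a \<le> A" "m \<le> a'" "a' \<le> A" "\<bar>a - a'\<bar> \<le> \<alpha>" and m: "m > 0"
    and q: "c \<le> norm q" "norm q \<le> Q" "c \<le> norm q'" "norm q' \<le> Q" and c: "c > 0"
  shows "a * ((q \<bullet> (q' - q - \<Phi>)) / norm q) + a' * ((q' \<bullet> (- (q' - q - \<Phi>))) / norm q') \<le>
    - (2 * m * c * (1 - cosine q q')) + \<alpha> * Q + 2 * A * norm \<Phi>"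
proof -
  have q0: "q \<noteq> 0" "q' \<noteq> 0" using q c by auto
  define J where "J = (a / norm q) *\<^sub>R q - (a' / norm q') *\<^sub>R q'"
  have J: "norm J \<le> 2 * A"
  proof -
    have "norm J \<le> norm ((a / norm q) *\<^sub>R q) + norm ((a' / norm q') *\<^sub>R q')"
      unfolding J_def by (rule norm_triangle_ineq4)
    also have "\<dots> = a + a'" using q0 a m by simp
    finally show ?thesis using a by linarith
  qed
  have "a * ((q \<bullet> (q' - q - \<Phi>)) / norm q) + a' * ((q' \<bullet> (- (q' - q - \<Phi>))) / norm q') = J \<bullet> (q' - q - \<Phi>)"
    unfolding J_def by (simp only: inner_diff_left inner_scaleR_left inner_minus_right) simp
  also have "\<dots> = J \<bullet> (q' - q) - J \<bullet> \<Phi>" by (simp only: inner_diff_right)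
  also have "J \<bullet> (q' - q) = - ((1 - cosine q q') * (a * norm q' + a' * norm q)) + (a - a') * (norm q' - norm q)"
    unfolding J_def cosine_def by (rule flux_monotonicity_identity[OF q0])
  finally have eq: "a * ((q \<bullet> (q' - q - \<Phi>)) / norm q) + a' * ((q' \<bullet> (- (q' - q - \<Phi>))) / norm q') =
     - ((1 - cosine q q') * (a * norm q' + a' * norm q)) + (a - a') * (norm q' - norm q) - J \<bullet> \<Phi>" .
  have "m * c \<le> a * norm q'" "m * c \<le> a' * norm q" using a q m c by (auto intro!: mult_mono)
  then have "(1 - cosine q q') * (2 * m * c) \<le> (1 - cosine q q') * (a * norm q' + a' * norm q)"
    using cosine_bounds[of q q'] by (intro mult_left_mono) auto
  moreover have "(a - a') * (norm q' - norm q) \<le> \<alpha> * Q"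
  proof -
    have "(a - a') * (norm q' - norm q) \<le> \<bar>a - a'\<bar> * \<bar>norm q' - norm q\<bar>"
      unfolding abs_mult[symmetric] by (rule abs_ge_self)
    also have "\<dots> \<le> \<alpha> * Q"
    proof (rule mult_mono')
      have "0 \<le> norm q" "0 \<le> norm q'" by simp_all
      then show "\<bar>norm q' - norm q\<bar> \<le> Q" using q by linarith
    qed (use a in auto)
    finally show ?thesis .
  qed
  moreover have "- (J \<bullet> \<Phi>) \<le> 2 * A * norm \<Phi>"
  proof -
    have "\<bar>J \<bullet> \<Phi>\<bar> \<le> norm J * norm \<Phi>" by (rule Cauchy_Schwarz_ineq2)
    also have "\<dots> \<le> 2 * A * norm \<Phi>" using J by (rule mult_right_mono) simp
    finally show ?thesis by linarith
  qed
  ultimately show ?thesis unfolding eq by (simp add: mult.commute)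
qed

text \<open>The two first variations have opposite directions, so their nonnegative sum leaves,
  besides the angle, only differences: of \<open>a\<close>, of \<open>h\<close> paired with
  \<open>d\<close>, and \<Phi>. The term with \<eta> still contains the integral of |d|, to be
  removed in \<open>close_stability_estimate\<close>.\<close>

lemma (in finite_measure) alignment_estimate:
  fixes q q' \<Phi> :: "'a \<Rightarrow> 'b::euclidean_space" and a a' h h' d :: "'a \<Rightarrow> real"
  assumes qm: "q \<in> borel_measurable M" "q' \<in> borel_measurable M"
    and a: "AE x in M. m \<le> a x \<and> a x \<le> A" "AE x in M. m \<le> a' x \<and> a' x \<le> A"
      "AE x in M. \<bar>a x - a' x\<bar> \<le> \<alpha>" and m: "m > 0"
    and h: "AE x in M. \<bar>h x - h' x\<bar> \<le> \<eta>"
    and q: "AE x in M. c \<le> norm (q x) \<and> norm (q x) \<le> Q" "AE x in M. c \<le> norm (q' x) \<and> norm (q' x) \<le> Q"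
    and c: "c > 0"
    and \<Phi>: "integrable M (\<lambda>x. norm (\<Phi> x))" and d: "integrable M (\<lambda>x. \<bar>d x\<bar>)"
    and X: "integrable M (\<lambda>x. a x * ((q x \<bullet> (q' x - q x - \<Phi> x)) / norm (q x)) + h x * d x)"
      "0 \<le> (\<integral>x. a x * ((q x \<bullet> (q' x - q x - \<Phi> x)) / norm (q x)) + h x * d x \<partial>M)"
    and X': "integrable M (\<lambda>x. a' x * ((q' x \<bullet> (- (q' x - q x - \<Phi> x))) / norm (q' x)) + h' x * (- d x))"
      "0 \<le> (\<integral>x. a' x * ((q' x \<bullet> (- (q' x - q x - \<Phi> x))) / norm (q' x)) + h' x * (- d x) \<partial>M)"
  shows "2 * m * c * (\<integral>x. 1 - cosine (q x) (q' x) \<partial>M) \<le>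
    measure M (space M) * (\<alpha> * Q) + 2 * A * (\<integral>x. norm (\<Phi> x) \<partial>M) + \<eta> * (\<integral>x. \<bar>d x\<bar> \<partial>M)"
proof -
  define f1 where "f1 x = a x * ((q x \<bullet> (q' x - q x - \<Phi> x)) / norm (q x)) + h x * d x" for x
  define f2 where "f2 x = a' x * ((q' x \<bullet> (- (q' x - q x - \<Phi> x))) / norm (q' x)) + h' x * (- d x)" for x
  define k where "k x = 1 - cosine (q x) (q' x)" for x
  have f: "integrable M f1" "integrable M f2" "0 \<le> (\<integral>x. f1 x \<partial>M)" "0 \<le> (\<integral>x. f2 x \<partial>M)"
    using X X' unfolding f1_def f2_def by simp_all
  have k: "integrable M k" unfolding k_def by (rule integrable_one_minus_cosine[OF qm])
  have "0 \<le> (\<integral>x. f1 x + f2 x \<partial>M)" using f by simp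
  also have "\<dots> \<le> (\<integral>x. \<alpha> * Q + 2 * A * norm (\<Phi> x) + \<eta> * \<bar>d x\<bar> - 2 * m * c * k x \<partial>M)"
  proof (rule integral_mono_AE)
    show "integrable M (\<lambda>x. f1 x + f2 x)" using f by simp
    show "integrable M (\<lambda>x. \<alpha> * Q + 2 * A * norm (\<Phi> x) + \<eta> * \<bar>d x\<bar> - 2 * m * c * k x)"
      using k \<Phi> d by simp
    show "AE x in M. f1 x + f2 x \<le> \<alpha> * Q + 2 * A * norm (\<Phi> x) + \<eta> * \<bar>d x\<bar> - 2 * m * c * k x"
      using a h q
    proof eventually_elim
      case (elim x)
      have 1: "a x * ((q x \<bullet> (q' x - q x - \<Phi> x)) / norm (q x)) + a' x * ((q' x \<bullet> (- (q' x - q x - \<Phi> x))) / norm (q' x)) \<le>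
        - (2 * m * c * (1 - cosine (q x) (q' x))) + \<alpha> * Q + 2 * A * norm (\<Phi> x)"
        using elim m c by (intro flux_variation_le) auto
      have "h x * d x + h' x * (- d x) = (h x - h' x) * d x" by (simp add: algebra_simps)
      also have "\<dots> \<le> \<bar>h x - h' x\<bar> * \<bar>d x\<bar>" unfolding abs_mult[symmetric] by (rule abs_ge_self)
      also have "\<dots> \<le> \<eta> * \<bar>d x\<bar>" using elim by (intro mult_right_mono) auto
      finally have 2: "h x * d x + h' x * (- d x) \<le> \<eta> * \<bar>d x\<bar>" .
      show ?case using 1 2 unfolding f1_def f2_def k_def by linarith
    qed
  qed
  also have "\<dots> = measure M (space M) * (\<alpha> * Q) + 2 * A * (\<integral>x. norm (\<Phi> x) \<partial>M) + \<eta> * (\<integral>x. \<bar>d x\<bar> \<partial>M) -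
      2 * m * c * (\<integral>x. k x \<partial>M)"
    using k \<Phi> d by simp
  finally show ?thesis by (simp add: k_def)
qed

text \<open>Pointwise this is \<open>norm_tangential_le\<close>; \<open>integral_sqrt_le\<close>
  then takes the square root out of the integral, and this is where the exponent 1/2 enters the
  final estimate.\<close>

lemma (in finite_measure) tangential_estimate:
  fixes q q' \<Phi> :: "'a \<Rightarrow> 'b::euclidean_space"
  assumes qm[measurable]: "q \<in> borel_measurable M" "q' \<in> borel_measurable M" "\<Phi> \<in> borel_measurable M"
    and q: "AE x in M. c \<le> norm (q x) \<and> norm (q x) \<le> Q" "AE x in M. c \<le> norm (q' x) \<and> norm (q' x) \<le> Q"
    and c: "c > 0" and \<Phi>: "integrable M (\<lambda>x. norm (\<Phi> x))"
  shows "integrable M (\<lambda>x. norm (tangential (q x) (q' x - q x - \<Phi> x)))"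
    and "(\<integral>x. norm (tangential (q x) (q' x - q x - \<Phi> x)) \<partial>M) \<le>
      sqrt 2 * \<bar>Q\<bar> * ((measure M (space M) + 1) / 2) * sqrt (\<integral>x. 1 - cosine (q x) (q' x) \<partial>M) +
      (\<integral>x. norm (\<Phi> x) \<partial>M)"
proof -
  let ?k = "\<lambda>x. 1 - cosine (q x) (q' x)"
  have k: "integrable M ?k" by (rule integrable_one_minus_cosine[OF qm(1,2)])
  have k0: "AE x in M. 0 \<le> ?k x" using cosine_bounds by (auto simp: abs_le_iff)
  note s = integral_sqrt_le[OF k k0]
  have meas: "(\<lambda>x. norm (tangential (q x) (q' x - q x - \<Phi> x))) \<in> borel_measurable M"
    unfolding tangential_def by measurable
  have le: "AE x in M. norm (tangential (q x) (q' x - q x - \<Phi> x)) \<le> sqrt 2 * \<bar>Q\<bar> * sqrt (?k x) + norm (\<Phi> x)"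
    using q
  proof eventually_elim
    case (elim x)
    then have n: "q x \<noteq> 0" "q' x \<noteq> 0" using c by auto
    have "tangential (q x) (q' x - q x - \<Phi> x) = tangential (q x) (q' x) - tangential (q x) (\<Phi> x)"
      by (simp add: tangential_diff tangential_self)
    then have "norm (tangential (q x) (q' x - q x - \<Phi> x)) \<le> norm (tangential (q x) (q' x)) + norm (tangential (q x) (\<Phi> x))"
      by (simp add: norm_triangle_ineq4)
    also have "\<dots> \<le> sqrt 2 * norm (q' x) * sqrt (?k x) + norm (\<Phi> x)"
      unfolding cosine_def by (intro add_mono norm_tangential_le[OF n] norm_tangential_le_norm)
    also have "sqrt 2 * norm (q' x) * sqrt (?k x) \<le> sqrt 2 * \<bar>Q\<bar> * sqrt (?k x)"
      using elim cosine_bounds[of "q x" "q' x"] by (intro mult_right_mono mult_left_mono) auto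
    finally show ?case by simp
  qed
  have i: "integrable M (\<lambda>x. sqrt 2 * \<bar>Q\<bar> * sqrt (?k x) + norm (\<Phi> x))" using s(1) \<Phi> by simp
  show int: "integrable M (\<lambda>x. norm (tangential (q x) (q' x - q x - \<Phi> x)))"
    by (rule Bochner_Integration.integrable_bound[OF i meas]) (use le in \<open>eventually_elim, simp\<close>)
  have "(\<integral>x. norm (tangential (q x) (q' x - q x - \<Phi> x)) \<partial>M) \<le> (\<integral>x. sqrt 2 * \<bar>Q\<bar> * sqrt (?k x) + norm (\<Phi> x) \<partial>M)"
    by (rule integral_mono_AE[OF int i le])
  also have "\<dots> = sqrt 2 * \<bar>Q\<bar> * (\<integral>x. sqrt (?k x) \<partial>M) + (\<integral>x. norm (\<Phi> x) \<partial>M)"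
    using s(1) \<Phi> by simp
  also have "sqrt 2 * \<bar>Q\<bar> * (\<integral>x. sqrt (?k x) \<partial>M) \<le>
      sqrt 2 * \<bar>Q\<bar> * ((measure M (space M) + 1) / 2 * sqrt (\<integral>x. ?k x \<partial>M))"
    using s(2) by (intro mult_left_mono) auto
  finally show "(\<integral>x. norm (tangential (q x) (q' x - q x - \<Phi> x)) \<partial>M) \<le>
      sqrt 2 * \<bar>Q\<bar> * ((measure M (space M) + 1) / 2) * sqrt (\<integral>x. 1 - cosine (q x) (q' x) \<partial>M) +
      (\<integral>x. norm (\<Phi> x) \<partial>M)" by (simp add: mult.assoc)
qed

section \<open>Closing the estimate\<close>

text \<open>\<open>B\<close> and \<open>k1\<close> come from N \<le> B * (k1 * sqrt E + \<phi>),
  \<open>k2\<close> and \<open>k3\<close> from the two bounds on \<open>E\<close>. The first summand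
  settles the case \<phi> \<ge> 1 and bounds \<open>N\<close> when \<phi> < 1; the second settles
  that case, with the first inserted for the \<open>N\<close> next to \<eta>.\<close>

definition stability_const :: "real \<Rightarrow> real \<Rightarrow> real \<Rightarrow> real \<Rightarrow> real" where
  "stability_const B k1 k2 k3 =
     B * (k1 * sqrt k3 + 1) + B * (k1 * sqrt k2 * (1 + sqrt (B * (k1 * sqrt k3 + 1))) + 1)"

text \<open>For \<open>\<phi> \<ge> 1\<close> the estimate holds by the a priori bound on \<open>E\<close>; for \<open>\<phi> < 1\<close> that bound makes \<open>N\<close>
  bounded, which turns the term \<open>\<eta> * N\<close> into a multiple of \<open>\<eta>\<close>.\<close>

lemma close_stability_estimate:
  fixes N E \<phi> \<alpha> \<eta> W :: real
  assumes nn: "0 \<le> B" "0 \<le> k1" "0 \<le> k2" "0 \<le> k3" "0 \<le> N" "0 \<le> \<phi>" "0 \<le> \<alpha>" "0 \<le> \<eta>"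
    and N: "N \<le> B * (k1 * sqrt E + \<phi>)" and E: "E \<le> k2 * (\<alpha> + \<phi> + \<eta> * N)" "E \<le> k3" and W: "\<phi> \<le> W"
  shows "N \<le> stability_const B k1 k2 k3 * (sqrt \<eta> + sqrt \<alpha> + max (sqrt W) W)"
proof -
  define N0 where "N0 = B * (k1 * sqrt k3 + 1)"
  define C1 where "C1 = B * (k1 * sqrt k2 * (1 + sqrt N0) + 1)"
  have C: "stability_const B k1 k2 k3 = N0 + C1" by (simp add: stability_const_def N0_def C1_def)
  have N00: "0 \<le> N0" unfolding N0_def using nn by simp
  have C10: "0 \<le> C1" unfolding C1_def using nn N00 by simp
  have R0: "0 \<le> sqrt \<eta> + sqrt \<alpha>" using nn by simp
  have sE: "sqrt E \<le> sqrt k3" using E(2) by simp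
  have N1: "N \<le> B * (k1 * sqrt k3 + \<phi>)"
    using N mult_left_mono[OF sE nn(2)] nn(1) by (meson add_right_mono mult_left_mono order_trans)
  show ?thesis
  proof (cases "\<phi> \<ge> 1")
    case True
    have "k1 * sqrt k3 + \<phi> \<le> (k1 * sqrt k3 + 1) * \<phi>"
      using True nn mult_left_mono[OF True, of "k1 * sqrt k3"] by (simp add: algebra_simps)
    then have "N \<le> B * ((k1 * sqrt k3 + 1) * \<phi>)" using N1 nn(1) by (meson mult_left_mono order_trans)
    also have "\<dots> = N0 * \<phi>" by (simp add: N0_def)
    also have "\<dots> \<le> N0 * (sqrt \<eta> + sqrt \<alpha> + max (sqrt W) W)"
      using W R0 N00 by (intro mult_left_mono) auto
    also have "\<dots> \<le> (N0 + C1) * (sqrt \<eta> + sqrt \<alpha> + max (sqrt W) W)"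
      using C10 R0 W nn by (intro mult_right_mono) auto
    finally show ?thesis by (simp add: C)
  next
    case False
    have "B * (k1 * sqrt k3 + \<phi>) \<le> N0" unfolding N0_def using False nn by (intro mult_left_mono) auto
    then have NN: "N \<le> N0" using N1 by linarith
    have W0: "0 \<le> W" using W nn by linarith
    have "E \<le> k2 * (\<alpha> + W + \<eta> * N0)"
      using E(1) W NN nn by (meson add_mono mult_left_mono order_refl order_trans)
    then have "sqrt E \<le> sqrt (k2 * (\<alpha> + W + \<eta> * N0))" by simp
    also have "\<dots> = sqrt k2 * sqrt (\<alpha> + W + \<eta> * N0)" by (rule real_sqrt_mult)
    \<comment> \<open>Subadditivity of the square root separates the three differences of the
      data.\<close>
    also have "sqrt (\<alpha> + W + \<eta> * N0) \<le> sqrt \<alpha> + sqrt W + sqrt \<eta> * sqrt N0"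
    proof -
      have "sqrt (\<alpha> + W + \<eta> * N0) \<le> sqrt (\<alpha> + W) + sqrt (\<eta> * N0)"
        using nn W0 N00 by (intro sqrt_add_le_add_sqrt) auto
      also have "sqrt (\<alpha> + W) \<le> sqrt \<alpha> + sqrt W" using nn W0 by (intro sqrt_add_le_add_sqrt)
      finally show ?thesis by (simp add: real_sqrt_mult)
    qed
    finally have sE: "sqrt E \<le> sqrt k2 * (sqrt \<alpha> + sqrt W + sqrt \<eta> * sqrt N0)" using nn by (simp add: mult_left_mono)
    define S where "S = sqrt \<eta> + sqrt \<alpha> + max (sqrt W) W"
    have s0: "0 \<le> sqrt \<eta>" "0 \<le> sqrt \<alpha>" "0 \<le> sqrt W" "sqrt W \<le> max (sqrt W) W" using nn W0 by auto
    have "sqrt \<alpha> + sqrt W \<le> S" "sqrt \<eta> \<le> S" using s0 unfolding S_def by linarith+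
    then have "sqrt \<alpha> + sqrt W + sqrt \<eta> * sqrt N0 \<le> S + S * sqrt N0"
      using N00 by (intro add_mono mult_right_mono) auto
    also have "\<dots> = (1 + sqrt N0) * S" by (simp add: algebra_simps)
    finally have "sqrt k2 * (sqrt \<alpha> + sqrt W + sqrt \<eta> * sqrt N0) \<le> sqrt k2 * ((1 + sqrt N0) * S)"
      using nn by (intro mult_left_mono) auto
    then have "k1 * sqrt E \<le> k1 * (sqrt k2 * ((1 + sqrt N0) * S))" using sE nn by (intro mult_left_mono) auto
    moreover have "\<phi> \<le> S" using W s0 unfolding S_def by linarith
    ultimately have "k1 * sqrt E + \<phi> \<le> (k1 * sqrt k2 * (1 + sqrt N0) + 1) * S" by (simp add: algebra_simps)
    then have "N \<le> B * ((k1 * sqrt k2 * (1 + sqrt N0) + 1) * S)" using N nn(1) by (meson mult_left_mono order_trans)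
    also have "\<dots> = C1 * S" by (simp add: C1_def)
    also have "\<dots> \<le> (N0 + C1) * S" using N00 s0 unfolding S_def by (intro mult_right_mono) auto
    finally show ?thesis by (simp add: C S_def)
  qed
qed

section \<open>The stability estimate\<close>

text \<open>The flux has norm \<sigma> times the norm in question, and both it and \<sigma> are
  bounded on both sides. The lower bound excludes critical points of u + f, so that its levels have
  charts everywhere.\<close>

lemma admissible_gradient_bounds:
  assumes "admissible \<Omega> \<sigma>0 \<sigma>1 m M a F H u" "0 < \<sigma>0" "0 < \<sigma>1" "x \<in> \<Omega>"
  shows "m / \<sigma>1 \<le> norm (grad u x + F x)" "norm (grad u x + F x) \<le> M / \<sigma>0"
proof -
  obtain \<sigma> where \<sigma>: "\<sigma>0 \<le> \<sigma>" "\<sigma> \<le> \<sigma>1" "m \<le> norm (\<sigma> *\<^sub>R (grad u x + F x))" "norm (\<sigma> *\<^sub>R (grad u x + F x)) \<le> M"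
    using assms(1,4) unfolding admissible_def by metis
  let ?n = "norm (grad u x + F x)"
  have "norm (\<sigma> *\<^sub>R (grad u x + F x)) = \<sigma> * ?n" using \<sigma>(1) assms(2) by simp
  moreover have "\<sigma>0 * ?n \<le> \<sigma> * ?n" "\<sigma> * ?n \<le> \<sigma>1 * ?n" using \<sigma> by (auto intro!: mult_right_mono)
  ultimately have "m \<le> \<sigma>1 * ?n" "\<sigma>0 * ?n \<le> M" using \<sigma> by linarith+
  then show "m / \<sigma>1 \<le> ?n" "?n \<le> M / \<sigma>0"
    using assms(2,3) by (simp_all add: pos_divide_le_eq pos_le_divide_eq mult.commute)
qed

lemma C1_closure_bounded:
  fixes u :: "'a::euclidean_space \<Rightarrow> real"
  assumes "bounded \<Omega>" "C1_closure \<Omega> u"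
  obtains R where "\<And>x. x \<in> \<Omega> \<Longrightarrow> \<bar>u x\<bar> \<le> R \<and> norm (grad u x) \<le> R"
proof -
  obtain G where G: "continuous_on (closure \<Omega>) u" "continuous_on (closure \<Omega>) G" "\<And>x. x \<in> \<Omega> \<Longrightarrow> G x = grad u x"
    using assms(2) unfolding C1_closure_def by blast
  have "compact (closure \<Omega>)" using assms(1) by simp
  then have "bounded (u ` closure \<Omega>)" "bounded (G ` closure \<Omega>)"
    using G by (auto intro!: compact_imp_bounded compact_continuous_image)
  then obtain B1 B2 where B: "\<forall>y\<in>u ` closure \<Omega>. norm y \<le> B1" "\<forall>y\<in>G ` closure \<Omega>. norm y \<le> B2"
    unfolding bounded_iff by blast
  show ?thesis
  proof (rule that[of "max B1 B2"])
    fix x assume x: "x \<in> \<Omega>"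
    then have "x \<in> closure \<Omega>" using closure_subset by blast
    then have "\<bar>u x\<bar> \<le> B1" "norm (G x) \<le> B2" using B by auto
    then show "\<bar>u x\<bar> \<le> max B1 B2 \<and> norm (grad u x) \<le> max B1 B2" using G(3)[OF x] by auto
  qed
qed

lemma C1_closure_measurable:
  fixes u :: "'a::euclidean_space \<Rightarrow> real"
  assumes "\<Omega> \<in> lmeasurable" "C1_closure \<Omega> u"
  shows "u \<in> borel_measurable (lebesgue_on \<Omega>)" "grad u \<in> borel_measurable (lebesgue_on \<Omega>)"
proof -
  have C1: "C1_on \<Omega> u" using assms(2) by (simp add: C1_closure_def)
  have \<Omega>: "\<Omega> \<in> sets lebesgue" using assms(1) by auto
  show "u \<in> borel_measurable (lebesgue_on \<Omega>)"
    by (rule continuous_imp_measurable_on_sets_lebesgue[OF C1_on_imp_continuous_on[OF C1] \<Omega>])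
  show "grad u \<in> borel_measurable (lebesgue_on \<Omega>)"
    using C1 \<Omega> by (intro continuous_imp_measurable_on_sets_lebesgue) (auto simp: C1_on_def)
qed

text \<open>The competitors (1 - s) u + s u' are available by \<open>in_H10_lincomb\<close>. Only
  regularity and zero boundary values are asked of \<open>u'\<close>, so the lemma applies to two
  solutions in either order although their data differ.\<close>

lemma admissible_first_variation:
  fixes \<Omega> :: "'a::euclidean_space set"
  assumes \<Omega>: "\<Omega> \<in> lmeasurable" "bounded \<Omega>" and \<sigma>: "0 < \<sigma>0" "0 < \<sigma>1" and m: "0 < m"
    and a: "Linf_on \<Omega> a" "AE x in lebesgue_on \<Omega>. m \<le> a x \<and> a x \<le> M" and H: "Linf_on \<Omega> H"
    and F: "F \<in> borel_measurable (lebesgue_on \<Omega>)"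
    and u: "admissible \<Omega> \<sigma>0 \<sigma>1 m M a F H u" and u': "C1_closure \<Omega> u'" "in_H10 \<Omega> u' (grad u')"
  shows "integrable (lebesgue_on \<Omega>)
      (\<lambda>x. a x * (((grad u x + F x) \<bullet> (grad u' x - grad u x)) / norm (grad u x + F x)) + H x * (u' x - u x))"
    and "0 \<le> (\<integral>x. a x * (((grad u x + F x) \<bullet> (grad u' x - grad u x)) / norm (grad u x + F x)) +
      H x * (u' x - u x) \<partial>lebesgue_on \<Omega>)"
proof -
  let ?M = "lebesgue_on \<Omega>"
  interpret finite_measure ?M using \<Omega>(1) by (rule finite_measure_lebesgue_on)
  have uC: "C1_closure \<Omega> u" and uH: "in_H10 \<Omega> u (grad u)"
    and umin: "\<And>w Dw. in_H10 \<Omega> w Dw \<Longrightarrow> energy \<Omega> a F H u (grad u) \<le> energy \<Omega> a F H w Dw"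
    using u by (auto simp: admissible_def minimizes_energy_def)
  obtain R where R: "\<And>x. x \<in> \<Omega> \<Longrightarrow> \<bar>u x\<bar> \<le> R \<and> norm (grad u x) \<le> R"
    by (rule C1_closure_bounded[OF \<Omega>(2) uC]) blast
  obtain R' where R': "\<And>x. x \<in> \<Omega> \<Longrightarrow> \<bar>u' x\<bar> \<le> R' \<and> norm (grad u' x) \<le> R'"
    by (rule C1_closure_bounded[OF \<Omega>(2) u'(1)]) blast
  note meas[measurable] = C1_closure_measurable[OF \<Omega>(1) uC] C1_closure_measurable[OF \<Omega>(1) u'(1)] F
  have [measurable]: "a \<in> borel_measurable ?M" "H \<in> borel_measurable ?M"
    using a H by (auto simp: Linf_on_def)
  have sp: "space ?M = \<Omega>" by simp
  have min: "(\<integral>x. a x * norm (grad u x + F x) + H x * u x \<partial>?M) \<le>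
      (\<integral>x. a x * norm (grad u x + F x + s *\<^sub>R (grad u' x - grad u x)) + H x * (u x + s * (u' x - u x)) \<partial>?M)" for s
  proof -
    have "(\<lambda>x. (1 - s) *\<^sub>R grad u x + s *\<^sub>R grad u' x + F x) = (\<lambda>x. grad u x + F x + s *\<^sub>R (grad u' x - grad u x))"
      "(\<lambda>x. (1 - s) * u x + s * u' x) = (\<lambda>x. u x + s * (u' x - u x))"
      by (simp_all add: algebra_simps)
    then have eq: "(1 - s) *\<^sub>R grad u x + s *\<^sub>R grad u' x + F x = grad u x + F x + s *\<^sub>R (grad u' x - grad u x)"
      "(1 - s) * u x + s * u' x = u x + s * (u' x - u x)" for x by metis+
    show ?thesis using umin[OF in_H10_lincomb[OF \<Omega> uH u'(2), of "1 - s" s]] unfolding energy_def eq .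
  qed
  have a0: "AE x in ?M. 0 \<le> a x \<and> a x \<le> M" using a(2) by eventually_elim (use m in linarith)
  have q: "AE x in ?M. m / \<sigma>1 \<le> norm (grad u x + F x) \<and> norm (grad u x + F x) \<le> M / \<sigma>0"
    using admissible_gradient_bounds[OF u \<sigma>] by (intro AE_I2) auto
  have D: "AE x in ?M. norm (grad u' x - grad u x) \<le> R' + R"
    using R R' by (intro AE_I2) (smt (verit) norm_triangle_ineq4 sp)
  have U: "AE x in ?M. \<bar>u x\<bar> \<le> R" "AE x in ?M. \<bar>u' x - u x\<bar> \<le> R' + R"
    using R R' by (auto intro!: AE_I2) (smt (verit))
  have c: "m / \<sigma>1 > 0" using m \<sigma> by simp
  note * = minimality_first_variation[of "\<lambda>x. grad u x + F x" "\<lambda>x. grad u' x - grad u x" a H u "\<lambda>x. u' x - u x",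
      OF _ _ _ _ _ _ a0 AE_le_Linf_norm[OF H] q c D U min]
  show "integrable ?M
      (\<lambda>x. a x * (((grad u x + F x) \<bullet> (grad u' x - grad u x)) / norm (grad u x + F x)) + H x * (u' x - u x))"
    by (rule *(1)) measurable
  show "0 \<le> (\<integral>x. a x * (((grad u x + F x) \<bullet> (grad u' x - grad u x)) / norm (grad u x + F x)) +
      H x * (u' x - u x) \<partial>?M)"
    by (rule *(2)) measurable
qed

lemma W11_norm_ge_L1_norm_grad_diff:
  fixes f f' :: "'a::euclidean_space \<Rightarrow> real"
  assumes "C1_on \<Omega> f" "C1_on \<Omega> f'" "\<Omega> \<in> sets lebesgue"
  shows "(\<integral>x. norm (grad f' x - grad f x) \<partial>lebesgue_on \<Omega>) \<le> W11_norm \<Omega> (\<lambda>x. f x - f' x)"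
proof -
  have "grad (\<lambda>x. f x - f' x) x = grad f x - grad f' x" if "x \<in> \<Omega>" for x
    using C1_on_lincomb(2)[OF assms(1,2) that, of 1 "-1"] by simp
  then have "L1_norm \<Omega> (grad (\<lambda>x. f x - f' x)) = (\<integral>x. norm (grad f' x - grad f x) \<partial>lebesgue_on \<Omega>)"
    unfolding L1_norm_def by (intro Bochner_Integration.integral_cong) (auto simp: norm_minus_commute)
  moreover have "0 \<le> L1_norm \<Omega> (\<lambda>x. f x - f' x)"
    unfolding L1_norm_def by (intro integral_nonneg_AE) simp
  ultimately show ?thesis by (simp add: W11_norm_def)
qed

text \<open>All data change at once, since the differences of \<open>a\<close>, \<open>H\<close> and
  \<open>f\<close> enter the sum of the two first variations additively. The arguments of
  \<open>stability_const\<close> are the foliation constant, the factor of sqrt E in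
  \<open>tangential_estimate\<close>, a common coefficient divided by the angle weight 2 * m * (m /
  \<sigma>1), and 2 * \<mu>, which comes from 1 - cos \<le> 2.\<close>

theorem single_foliation_stability:
  fixes \<Omega> :: "(real^3) set"
  assumes \<Omega>: "open \<Omega>" "bounded \<Omega>" and pos: "0 < m" "0 < \<sigma>0" "0 < \<sigma>1" "0 < cg"
    and a: "Linf_on \<Omega> a" "AE x in lebesgue_on \<Omega>. m \<le> a x \<and> a x \<le> M"
    and a': "Linf_on \<Omega> a'" "AE x in lebesgue_on \<Omega>. m \<le> a' x \<and> a' x \<le> M"
    and H: "Linf_on \<Omega> H" "Linf_on \<Omega> H'" and f: "C1_on \<Omega> f" "C1_on \<Omega> f'"
    and u: "admissible \<Omega> \<sigma>0 \<sigma>1 m M a (grad f) H u"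
    and u': "admissible \<Omega> \<sigma>0 \<sigma>1 m M a' (grad f') H' u'"
    and bdry: "\<And>x. x \<in> frontier \<Omega> \<Longrightarrow> u x = 0 \<and> u' x = 0"
    and fol: "level_sets_foliated \<Omega> cg Cg K (\<lambda>x. u x + f x)"
  defines "\<mu> \<equiv> measure lebesgue \<Omega>" and "Q \<equiv> M / \<sigma>0"
  shows "L1_norm \<Omega> (\<lambda>x. u x - u' x) \<le>
     stability_const (enn2real (foliation_const (m / \<sigma>1) Q cg Cg K)) (sqrt 2 * \<bar>Q\<bar> * ((\<mu> + 1) / 2))
       ((\<mu> * \<bar>Q\<bar> + 2 * \<bar>M\<bar> + 1) / (2 * m * (m / \<sigma>1))) (2 * \<mu>) *
     (sqrt (Linf_norm \<Omega> (\<lambda>x. H x - H' x)) + sqrt (Linf_norm \<Omega> (\<lambda>x. a x - a' x)) +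
       max (sqrt (W11_norm \<Omega> (\<lambda>x. f x - f' x))) (W11_norm \<Omega> (\<lambda>x. f x - f' x)))"
proof -
  let ?M = "lebesgue_on \<Omega>" and ?c = "m / \<sigma>1"
  have \<Omega>m: "\<Omega> \<in> lmeasurable" using \<Omega> by (intro lmeasurable_open)
  have \<Omega>s: "\<Omega> \<in> sets lebesgue" using \<Omega>m by auto
  interpret finite_measure ?M using \<Omega>m by (rule finite_measure_lebesgue_on)
  have \<mu>: "measure ?M (space ?M) = \<mu>"
    unfolding \<mu>_def using \<Omega>s by (simp add: measure_restrict_space)
  have uC: "C1_closure \<Omega> u" "C1_closure \<Omega> u'" and uH: "in_H10 \<Omega> u (grad u)" "in_H10 \<Omega> u' (grad u')"
    using u u' by (auto simp: admissible_def minimizes_energy_def)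
  have u1: "C1_on \<Omega> u" "C1_on \<Omega> u'" "continuous_on (closure \<Omega>) u" "continuous_on (closure \<Omega>) u'"
    using uC by (auto simp: C1_closure_def)
  have fm[measurable]: "grad f \<in> borel_measurable ?M" "grad f' \<in> borel_measurable ?M"
    using f \<Omega>s by (auto intro!: continuous_imp_measurable_on_sets_lebesgue simp: C1_on_def)
  note um[measurable] = C1_closure_measurable[OF \<Omega>m uC(1)] C1_closure_measurable[OF \<Omega>m uC(2)]
  define q where "q x = grad u x + grad f x" for x
  define q' where "q' x = grad u' x + grad f' x" for x
  define \<Phi> where "\<Phi> x = grad f' x - grad f x" for x
  define d where "d x = u' x - u x" for x
  have qm[measurable]: "q \<in> borel_measurable ?M" "q' \<in> borel_measurable ?M" "\<Phi> \<in> borel_measurable ?M" "d \<in> borel_measurable ?M"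
    unfolding q_def[abs_def] q'_def[abs_def] \<Phi>_def[abs_def] d_def[abs_def] by measurable
  have D: "q' x - q x - \<Phi> x = grad u' x - grad u x" "- (q' x - q x - \<Phi> x) = grad u x - grad u' x" for x
    by (simp_all add: q_def q'_def \<Phi>_def)
  have qb: "?c \<le> norm (q x) \<and> norm (q x) \<le> Q" "?c \<le> norm (q' x) \<and> norm (q' x) \<le> Q" if "x \<in> \<Omega>" for x
    using admissible_gradient_bounds[OF u pos(2,3) that] admissible_gradient_bounds[OF u' pos(2,3) that]
    by (auto simp: q_def q'_def Q_def)
  then have qA: "AE x in ?M. ?c \<le> norm (q x) \<and> norm (q x) \<le> Q" "AE x in ?M. ?c \<le> norm (q' x) \<and> norm (q' x) \<le> Q"
    by (auto intro!: AE_I2)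
  have c: "?c > 0" using pos by simp
  obtain R where R: "\<And>x. x \<in> \<Omega> \<Longrightarrow> \<bar>u x\<bar> \<le> R \<and> norm (grad u x) \<le> R"
    by (rule C1_closure_bounded[OF \<Omega>(2) uC(1)]) blast
  obtain R' where R': "\<And>x. x \<in> \<Omega> \<Longrightarrow> \<bar>u' x\<bar> \<le> R' \<and> norm (grad u' x) \<le> R'"
    by (rule C1_closure_bounded[OF \<Omega>(2) uC(2)]) blast
  \<comment> \<open>The gradients of \<open>f\<close> and \<open>f'\<close> are not bounded by
    assumption; \<Phi> is bounded because \<open>q\<close>, \<open>q'\<close> and the gradients of
    \<open>u\<close>, \<open>u'\<close> are. \<open>R\<close> and \<open>R'\<close> serve
    integrability only and stay out of the constant.\<close>
  have \<Phi>i: "integrable ?M (\<lambda>x. norm (\<Phi> x))"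
  proof (rule integrable_const_bound[where B="Q + R' + Q + R"])
    show "AE x in ?M. norm (norm (\<Phi> x)) \<le> Q + R' + Q + R"
    proof (rule AE_I2)
      fix x assume "x \<in> space ?M"
      then have x: "x \<in> \<Omega>" by simp
      have "\<Phi> x = (q' x - grad u' x) - (q x - grad u x)" by (simp add: \<Phi>_def q_def q'_def)
      then have "norm (\<Phi> x) \<le> (norm (q' x) + norm (grad u' x)) + (norm (q x) + norm (grad u x))"
        using norm_triangle_ineq4[of "q' x - grad u' x" "q x - grad u x"]
          norm_triangle_ineq4[of "q' x" "grad u' x"] norm_triangle_ineq4[of "q x" "grad u x"] by simp
      then show "norm (norm (\<Phi> x)) \<le> Q + R' + Q + R" using qb[OF x] R[OF x] R'[OF x] by simp
    qed
  qed measurable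
  have di: "integrable ?M (\<lambda>x. \<bar>d x\<bar>)"
  proof (rule integrable_const_bound[where B="R' + R"])
    show "AE x in ?M. norm \<bar>d x\<bar> \<le> R' + R"
    proof (rule AE_I2)
      fix x assume "x \<in> space ?M"
      then have x: "x \<in> \<Omega>" by simp
      show "norm \<bar>d x\<bar> \<le> R' + R" using R[OF x] R'[OF x] unfolding d_def real_norm_def abs_idempotent by linarith
    qed
  qed measurable
  define \<alpha> where "\<alpha> = Linf_norm \<Omega> (\<lambda>x. a x - a' x)"
  define \<eta> where "\<eta> = Linf_norm \<Omega> (\<lambda>x. H x - H' x)"
  have \<alpha>: "AE x in ?M. \<bar>a x - a' x\<bar> \<le> \<alpha>" "0 \<le> \<alpha>"
    unfolding \<alpha>_def using AE_le_Linf_norm[OF Linf_on_diff[OF a(1) a'(1)]] by (auto simp: Linf_norm_def)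
  have \<eta>: "AE x in ?M. \<bar>H x - H' x\<bar> \<le> \<eta>" "0 \<le> \<eta>"
    unfolding \<eta>_def using AE_le_Linf_norm[OF Linf_on_diff[OF H]] by (auto simp: Linf_norm_def)
  define E where "E = (\<integral>x. 1 - cosine (q x) (q' x) \<partial>?M)"
  define \<phi> where "\<phi> = (\<integral>x. norm (\<Phi> x) \<partial>?M)"
  define N where "N = (\<integral>x. \<bar>d x\<bar> \<partial>?M)"
  have nn: "0 \<le> \<mu>" "0 \<le> \<phi>" "0 \<le> N" by (auto simp: \<mu>_def \<phi>_def N_def intro!: integral_nonneg_AE)
  note X = admissible_first_variation[OF \<Omega>m \<Omega>(2) pos(2,3,1) a H(1) fm(1) u uC(2) uH(2)]
  note X' = admissible_first_variation[OF \<Omega>m \<Omega>(2) pos(2,3,1) a' H(2) fm(2) u' uC(1) uH(1)]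
  have Xq: "integrable ?M (\<lambda>x. a x * ((q x \<bullet> (q' x - q x - \<Phi> x)) / norm (q x)) + H x * d x)"
      "0 \<le> (\<integral>x. a x * ((q x \<bullet> (q' x - q x - \<Phi> x)) / norm (q x)) + H x * d x \<partial>?M)"
    unfolding D(1) unfolding q_def d_def by (rule X(1), rule X(2))
  have md: "- d x = u x - u' x" for x by (simp add: d_def)
  have Xq': "integrable ?M (\<lambda>x. a' x * ((q' x \<bullet> (- (q' x - q x - \<Phi> x))) / norm (q' x)) + H' x * (- d x))"
      "0 \<le> (\<integral>x. a' x * ((q' x \<bullet> (- (q' x - q x - \<Phi> x))) / norm (q' x)) + H' x * (- d x) \<partial>?M)"
    unfolding D(2) md unfolding q'_def by (rule X'(1), rule X'(2))
  have "2 * m * ?c * E \<le> \<mu> * (\<alpha> * Q) + 2 * M * \<phi> + \<eta> * N"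
    using alignment_estimate[OF qm(1,2) a(2) a'(2) \<alpha>(1) pos(1) \<eta>(1) qA c \<Phi>i di Xq Xq']
    by (simp only: \<mu> E_def \<phi>_def N_def)
  \<comment> \<open>The summand 1 takes care of the term \<eta> * N, so that one coefficient serves
    all three differences.\<close>
  also have "\<dots> \<le> (\<mu> * \<bar>Q\<bar> + 2 * \<bar>M\<bar> + 1) * (\<alpha> + \<phi> + \<eta> * N)"
  proof -
    have 1: "\<mu> * (\<alpha> * Q) \<le> \<mu> * \<bar>Q\<bar> * \<alpha>"
      using nn \<alpha>(2) mult_left_mono[OF abs_ge_self[of Q], of "\<mu> * \<alpha>"] by (simp add: mult_ac)
    have 2: "2 * M * \<phi> \<le> 2 * \<bar>M\<bar> * \<phi>" using nn by (intro mult_right_mono) auto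
    have k: "0 \<le> \<mu> * \<bar>Q\<bar>" "0 \<le> \<eta> * N" using nn \<eta>(2) by auto
    have "0 \<le> \<mu> * \<bar>Q\<bar> * (\<phi> + \<eta> * N)" "0 \<le> (2 * \<bar>M\<bar>) * (\<alpha> + \<eta> * N)" "0 \<le> \<alpha> + \<phi>"
      using k nn \<alpha>(2) by (auto intro!: mult_nonneg_nonneg add_nonneg_nonneg)
    then show ?thesis using 1 2 by (simp add: algebra_simps)
  qed
  finally have E0: "2 * m * ?c * E \<le> (\<mu> * \<bar>Q\<bar> + 2 * \<bar>M\<bar> + 1) * (\<alpha> + \<phi> + \<eta> * N)" .
  have E1: "E \<le> (\<mu> * \<bar>Q\<bar> + 2 * \<bar>M\<bar> + 1) / (2 * m * ?c) * (\<alpha> + \<phi> + \<eta> * N)"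
  proof -
    have "E \<le> k / P * S" if "P > 0" "P * E \<le> k * S" for P k S :: real
      using that by (simp add: field_simps)
    from this[OF _ E0] show ?thesis using pos by simp
  qed
  have E2: "E \<le> 2 * \<mu>"
  proof -
    have "E \<le> (\<integral>x. 2 \<partial>?M)"
      unfolding E_def
    proof (rule integral_mono)
      show "integrable ?M (\<lambda>x. 1 - cosine (q x) (q' x))" by (rule integrable_one_minus_cosine[OF qm(1,2)])
      show "1 - cosine (q x) (q' x) \<le> 2" for x using cosine_bounds[of "q x" "q' x"] by (simp add: abs_le_iff)
    qed simp
    then show ?thesis using \<mu> by simp
  qed
  note te = tangential_estimate[OF qm(1-3) qA c \<Phi>i]
  have C1v: "C1_on \<Omega> (\<lambda>x. u x + f x)" "\<And>x. x \<in> \<Omega> \<Longrightarrow> grad (\<lambda>x. u x + f x) x = q x"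
    using C1_on_lincomb(1)[OF u1(1) f(1), of 1 1] C1_on_lincomb(2)[OF u1(1) f(1), of _ 1 1]
    by (simp_all add: q_def)
  have C1d: "C1_on \<Omega> d" "\<And>x. x \<in> \<Omega> \<Longrightarrow> grad d x = q' x - q x - \<Phi> x"
    using C1_on_lincomb(1)[OF u1(2,1), of 1 "-1"] C1_on_lincomb(2)[OF u1(2,1), of _ 1 "-1"]
    unfolding D d_def[abs_def] by simp_all
  let ?T = "\<lambda>x. norm (tangential (grad (\<lambda>x. u x + f x) x) (grad d x))"
  have Teq: "?T x = norm (tangential (q x) (q' x - q x - \<Phi> x))" if "x \<in> space ?M" for x
    using that C1v(2)[of x] C1d(2)[of x] by simp
  have Ti: "integrable ?M ?T"
    using te(1) Teq by (subst Bochner_Integration.integrable_cong[OF refl Teq])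
  have Tint: "(\<integral>x. ?T x \<partial>?M) = (\<integral>x. norm (tangential (q x) (q' x - q x - \<Phi> x)) \<partial>?M)"
    using Teq by (intro Bochner_Integration.integral_cong) auto
  let ?B = "enn2real (foliation_const ?c Q cg Cg K)"
  let ?k1 = "sqrt 2 * \<bar>Q\<bar> * ((\<mu> + 1) / 2)"
  have "N \<le> ?B * (\<integral>x. ?T x \<partial>?M)"
    unfolding N_def
  proof (rule foliation_inequality[OF \<Omega> C1v(1) C1d(1) _ c _ _ fol pos(4) Ti di])
    show "?c \<le> norm (grad (\<lambda>x. u x + f x) x) \<and> norm (grad (\<lambda>x. u x + f x) x) \<le> Q" if "x \<in> \<Omega>" for x
      using qb(1)[OF that] C1v(2)[OF that] by simp
    show "continuous_on (closure \<Omega>) d" unfolding d_def[abs_def] using u1(3,4) by (intro continuous_intros)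
    show "d x = 0" if "x \<in> frontier \<Omega>" for x using bdry[OF that] by (simp add: d_def)
  qed
  also have "\<dots> \<le> ?B * (?k1 * sqrt E + \<phi>)"
    unfolding Tint using te(2) by (intro mult_left_mono) (simp_all only: \<mu> E_def \<phi>_def enn2real_nonneg)
  finally have N1: "N \<le> ?B * (?k1 * sqrt E + \<phi>)" .
  have W: "\<phi> \<le> W11_norm \<Omega> (\<lambda>x. f x - f' x)"
    unfolding \<phi>_def \<Phi>_def by (rule W11_norm_ge_L1_norm_grad_diff[OF f \<Omega>s])
  have "L1_norm \<Omega> (\<lambda>x. u x - u' x) = N"
    unfolding L1_norm_def N_def d_def by (simp add: abs_minus_commute)
  then show ?thesis
    using close_stability_estimate[OF _ _ _ _ nn(3,2) \<alpha>(2) \<eta>(2) N1 E1 E2 W] nn(1) pos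
    unfolding \<alpha>_def \<eta>_def by simp
qed

theorem theorem4p2:
  fixes \<Omega> :: "(real^3) set" and m M k1 K \<sigma>0 \<sigma>1 cg Cg :: real
  assumes "open \<Omega>" and "connected \<Omega>" and "bounded \<Omega>" and "lipschitz_boundary \<Omega>"
    and "0 < m" and "0 < \<sigma>0" and "0 < \<sigma>1" and "0 < cg"
  shows "\<exists>C. \<forall>(a :: real^3 \<Rightarrow> real) a' H H' f f' u u1 u2 u'.
     Linf_on \<Omega> a \<and> (AE x in lebesgue_on \<Omega>. m \<le> a x \<and> a x \<le> M) \<and>
     Linf_on \<Omega> a' \<and> (AE x in lebesgue_on \<Omega>. m \<le> a' x \<and> a' x \<le> M) \<and>
     Linf_on \<Omega> H \<and> Linf_on \<Omega> H' \<and>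
     C1_on \<Omega> f \<and> continuous_on (closure \<Omega>) f \<and>
     C1_on \<Omega> f' \<and> continuous_on (closure \<Omega>) f' \<and>
     L1_on \<Omega> (grad f) \<and> L1_norm \<Omega> (grad f) \<le> k1 \<and>
     admissible \<Omega> \<sigma>0 \<sigma>1 m M a (grad f) H u \<and>
     admissible \<Omega> \<sigma>0 \<sigma>1 m M a (grad f) H' u1 \<and>
     admissible \<Omega> \<sigma>0 \<sigma>1 m M a' (grad f) H' u2 \<and>
     admissible \<Omega> \<sigma>0 \<sigma>1 m M a' (grad f') H' u' \<and>
     (\<forall>x\<in>frontier \<Omega>. u x = 0 \<and> u1 x = 0 \<and> u2 x = 0 \<and> u' x = 0) \<and>
     level_sets_foliated \<Omega> cg Cg K (\<lambda>x. u x + f x) \<and>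
     level_sets_foliated \<Omega> cg Cg K (\<lambda>x. u1 x + f x) \<and>
     level_sets_foliated \<Omega> cg Cg K (\<lambda>x. u2 x + f x)
     \<longrightarrow> L1_norm \<Omega> (\<lambda>x. u x - u' x) \<le>
          C * (sqrt (Linf_norm \<Omega> (\<lambda>x. H x - H' x)) + sqrt (Linf_norm \<Omega> (\<lambda>x. a x - a' x)) +
               max (sqrt (W11_norm \<Omega> (\<lambda>x. f x - f' x))) (W11_norm \<Omega> (\<lambda>x. f x - f' x)))"
  \<comment> \<open>\<open>exI\<close> comes first, so the schematic witness cannot depend on the
    data; unification takes the constant of \<open>single_foliation_stability\<close>, built from
    the measure of \<open>\<Omega>\<close> and the numerical parameters.\<close>
  by (intro exI allI impI, elim conjE,
      rule single_foliation_stability[OF assms(1,3,5-8)]) (assumption | blast)+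

end
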